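(* Let $p_1$ be an odd prime and $p$ an odd prime with $p\neq p_1$ and $\gcd(p_1,p-1)=1$. Assume that the index of $\langle p\rangle$ in $(\mathbb{Z}/p_1\mathbb{Z})^\ast$ equals its index in $(\mathbb{Z}/p_1^{x}\mathbb{Z})^\ast$ for all $x\ge1$, and that the index of $\langle p\rangle$ in $(\mathbb{Z}/2p_1\mathbb{Z})^\ast$ equals its index in $(\mathbb{Z}/2p_1^{x}\mathbb{Z})^\ast$ for all $x\ge 1$. Let $h=2p_1$ and let $e=[(\mathbb{Z}/h\mathbb{Z})^\ast:\langle p\rangle]$. Let $k=2p_1^{e_1}$ ($e_1\ge1$) and assume $\langle p\rangle$ also has index $e$ in $(\mathbb{Z}/k\mathbb{Z})^\ast$. Put $q_1=p^{d}$ and $q=p^{f}$, where $d=\phi(h)/e$ and $f=\phi(k)/e$. Let $H$ be any subset of $\{0,1,\dots,h-1\}$ with $\sum_{i\in H}\zeta_{p_1}^{i}=0$, where $\zeta_{p_1}=e^{2\pi i/p_1}$. Let \[ D=\bigcup_{i\in H}C_i^{(h,q_1)}\quad\text{and}\quad D'=\bigcup_{i_1=0}^{p_1^{e_1-1}-1}\bigcup_{i\in H}C^{(k,q)}_{2i_1+ik/h}. \] If $D$ is a skew Hadamard difference set (respectively, a Paley type partial difference set) in $(\mathbb{F}_{q_1},+)$, then $D'$ is a skew Hadamard difference set (respectively, a Paley type partial difference set) in $(\mathbb{F}_q,+)$.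
   Context: $\phi$ is Euler's totient function. For a prime power $Q$, an integer $N>1$ with $N\mid Q-1$, and a fixed primitive element $\gamma$ of $\mathbb{F}_Q$, the cyclotomic classes of order $N$ are $C_i^{(N,Q)}=\gamma^i\langle\gamma^N\rangle$, $0\le i\le N-1$ (indices read modulo $N$). A subset $D$ of a finite additive group $G$ is a skew Hadamard difference set if $G$ is the disjoint union of $D$, $-D$ and $\{0\}$ and $D$ is a difference set (every nonzero element of $G$ arises the same number of times as a difference of two elements of $D$). A subset $D$ of $G$ with $0\notin D$ and $-D=D$ is a Paley type partial difference set if the Cayley graph $\mathrm{Cay}(G,D)$ (vertices $G$, $x\sim y$ iff $x-y\in D$) is strongly regular with parameters $(v,\frac{v-1}{2},\frac{v-5}{4},\frac{v-1}{4})$, $v=|G|$.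
   Formalization: The fixed primitive elements of F_{q_1} and F_q are assumed compatible: under an embedding of F_{q_1} in F_q, that of F_{q_1} is the relative norm of that of F_q. For independent choices the claim fails, e.g. p_1=13, p=3, e_1=2 for some H. *)

theory Defs
  imports
    Complex_Main
    "HOL-Library.Cardinality"
    "HOL-Number_Theory.Number_Theory"
    "HOL-Algebra.Generated_Groups"
begin

definition unit_index :: "nat \<Rightarrow> nat \<Rightarrow> nat" where
  "unit_index n a =
     (let G = units_of (residue_ring (int n))
      in card (rcosets\<^bsub>G\<^esub> (generate G {int a mod int n})))"

definition mult_gen :: "'a::field \<Rightarrow> 'a set" where
  "mult_gen g = range (\<lambda>t::int. g powi t)"

definition primitive_element :: "'a::{field,finite} \<Rightarrow> bool" where
  "primitive_element g \<longleftrightarrow> mult_gen g = UNIV - {0}"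

text \<open>
  The index is an arbitrary natural number; since \<open>g ^ N\<close> lies in the subgroup it generates,
  the class depends only on the index modulo \<open>N\<close>.
\<close>
definition cyclotomic_class :: "nat \<Rightarrow> 'a::{field,finite} \<Rightarrow> nat \<Rightarrow> 'a set" where
  "cyclotomic_class N g i = (\<lambda>x. g ^ i * x) ` mult_gen (g ^ N)"

definition difference_set :: "'g::{ab_group_add,finite} set \<Rightarrow> bool" where
  "difference_set D \<longleftrightarrow>
     (\<exists>l. \<forall>g. g \<noteq> 0 \<longrightarrow> card {(x, y). x \<in> D \<and> y \<in> D \<and> x - y = g} = l)"

definition skew_hadamard_difference_set :: "'g::{ab_group_add,finite} set \<Rightarrow> bool" where
  "skew_hadamard_difference_set D \<longleftrightarrow>
     D \<inter> uminus ` D = {} \<and> 0 \<notin> D \<and> 0 \<notin> uminus ` D \<and> D \<union> uminus ` D \<union> {0} = UNIV \<and>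
     difference_set D"

definition cayley_adj :: "'g::ab_group_add set \<Rightarrow> 'g \<Rightarrow> 'g \<Rightarrow> bool" where
  "cayley_adj D x y \<longleftrightarrow> x - y \<in> D"

text \<open>
  A strongly regular graph is simple, undirected, and neither edgeless nor complete.
\<close>
definition strongly_regular ::
    "('v::finite \<Rightarrow> 'v \<Rightarrow> bool) \<Rightarrow> nat \<Rightarrow> nat \<Rightarrow> nat \<Rightarrow> nat \<Rightarrow> bool" where
  "strongly_regular adj v k l m \<longleftrightarrow>
     CARD('v) = v \<and>
     (\<forall>x. \<not> adj x x) \<and> (\<forall>x y. adj x y \<longrightarrow> adj y x) \<and>
     (\<exists>x y. adj x y) \<and> (\<exists>x y. x \<noteq> y \<and> \<not> adj x y) \<and>
     (\<forall>x. card {z. adj x z} = k) \<and>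
     (\<forall>x y. adj x y \<longrightarrow> card {z. adj x z \<and> adj y z} = l) \<and>
     (\<forall>x y. x \<noteq> y \<and> \<not> adj x y \<longrightarrow> card {z. adj x z \<and> adj y z} = m)"

text \<open>
  The three equations say \<open>k = (v - 1)/2\<close>, \<open>l = (v - 5)/4\<close>, \<open>m = (v - 1)/4\<close> with exact division,
  so that \<open>v \<equiv> 1 (mod 4)\<close> and \<open>v \<ge> 5\<close> are part of the notion.
\<close>
definition paley_type_pds :: "'g::{ab_group_add,finite} set \<Rightarrow> bool" where
  "paley_type_pds D \<longleftrightarrow>
     0 \<notin> D \<and> uminus ` D = D \<and>
     (\<exists>k l m. strongly_regular (cayley_adj D) CARD('g) k l m \<and>
        2 * k + 1 = CARD('g) \<and> 4 * l + 5 = CARD('g) \<and> 4 * m + 1 = CARD('g))"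

text \<open>
  The classes of the two fields are taken with respect to compatible primitive elements: for the
  embedding of the smaller field (order \<open>q1\<close>) into the larger one (order \<open>q\<close>), the image of \<open>g1\<close> is
  \<open>g\<close> to the power \<open>(q - 1)/(q1 - 1)\<close>, i.e. the relative norm of \<open>g\<close>. Replacing \<open>g1\<close> by another
  primitive element multiplies the index set of a union of classes by a unit, which need not
  preserve the property of being a difference set. If \<open>q = q1\<close>, compatible means equal up to
  the identification of the two fields.
\<close>
definition compatible_elements :: "'a::{field,finite} \<Rightarrow> 'b::{field,finite} \<Rightarrow> bool" where
  "compatible_elements g1 g \<longleftrightarrow>
     (\<exists>emb :: 'a \<Rightarrow> 'b.
        (\<forall>x y. emb (x + y) = emb x + emb y) \<and>
        (\<forall>x y. emb (x * y) = emb x * emb y) \<and>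
        emb 1 = 1 \<and>
        emb g1 = g ^ ((CARD('b) - 1) div (CARD('a) - 1)))"

end

theory Submission
  imports Defs "HOL-Algebra.Algebraic_Closure_Type"
begin

text \<open>
  Write $s = p_1^{e_1 - 1}$. The character values of $D$ and $D'$
  are combinations of Gauss sums of order $h$ over $F_{q_1}$ and of order $k$ over $F_q$; the
  condition on $H$ removes every character except the trivial, the quadratic and the primitive ones.
  All remaining Gauss sums over $F_q$ turn out to be one and the same real constant $C$, with
  $C^2 = q_1^{s-1}$, times the corresponding Gauss sum over $F_{q_1}$. Hence the nontrivial
  character values satisfy $\psi(D') + 1/2 = C (\psi(D) + 1/2)$, and both kinds of difference sets
  are characterised by the value $\mp q_1/4$ of $(\psi(D) + 1/2)^2$.

  For a primitive character $\chi'$ of order $k$, the index hypothesis makes the $s$ characters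
  $\chi' \rho$ with $\rho^s = 1$ conjugate under the Frobenius map. Their Gauss sums agree, so
  $s\, G(\chi') = \sum_y \chi(N y) \psi(\mathrm{Tr}(y^s))$ with the norm and trace to $F_{q_1}$. This is
  a coefficient of the logarithmic derivative of the $L$-function attached to the multiplicative
  function $f \mapsto \chi(\prod y_i)\, \psi(\sum y_i^s)$ on monic polynomials with roots $y_i$ over
  $F_{q_1}$. As all earlier coefficients vanish, the sum is $s$ times a sum over the polynomials of
  degree $s$. By Newton's identities $\sum y_i^s$ is affine in the constant coefficient, so that sum
  is $G(\chi)$ times a factor which is, up to a sign, independent of $\chi$; it is real because
  $s$ is odd, and its modulus is known from those of the Gauss sums. For the quadratic
  character the ratio is $\pm C$, and the sign follows from a congruence modulo $1 - \zeta$ with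
  $\zeta$ of $p_1$-power order.
\<close>

hide_const (open) Divisibility.prime up_ring.coeff up_ring.monom module.smult Coset.order

section \<open>Monic polynomials over an algebraically closed field\<close>

text \<open>Only the square of C enters the final criterion, but the quadratic and the primitive
  terms are added before squaring. So they need the same C, sign included; this is why the quadratic
  character gets a separate argument. The index hypothesis says that p has order d p1^(x-1) modulo
  p1^x. Hence p1 divides q1 - 1 exactly once, and q1^i - 1 contains exactly one more factor p1 than
  i. The Frobenius orbits of length s and the vanishing of the lower coefficients both rest on this.
  Newton's identities leave \<psi>(s b) in place of \<psi>(b); gcd(p1, p - 1) = 1 reduces the
  resulting factor \<chi>(s) to a sign that is the same for all primitive \<chi>. In the index
  classes 0 and p1 modulo h, it is the union over i1 that leaves only the trivial and the quadratic
  character; the condition on H removes the other even classes. Both fields are placed in one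
  algebraic closure as fixed points of Frobenius powers, so polynomials can be handled through their
  multisets of roots.\<close>

lemma proots_prod_linear: "proots (\<Prod>x\<in>#A. [:- x, 1:]) = (A :: 'c::field multiset)"
proof -
  have "0 \<notin># image_mset (\<lambda>x. [:- x, 1:]) A" by auto
  from proots_prod_mset[OF this] show ?thesis
    by (simp add: multiset.map_comp o_def)
qed

lemma monic_eq_prod_proots:
  fixes f :: "'c::alg_closed_field poly"
  assumes "lead_coeff f = 1"
  shows "f = (\<Prod>x\<in>#proots f. [:- x, 1:])"
proof -
  have "f \<noteq> 0" using assms by auto
  then obtain A where A: "f = smult (lead_coeff f) (\<Prod>x\<in>#A. [:- x, 1:])"
    using alg_closed_imp_factorization[of f] by auto
  with assms show ?thesis by (metis proots_prod_linear smult_1_left)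
qed

lemma monic_prod_linear: "lead_coeff (\<Prod>x\<in>#A. [:- x, 1:]) = (1 :: 'c::field)"
  by (induction A) (simp_all del: mult_pCons_left mult_pCons_right add: lead_coeff_mult)

lemma degree_prod_linear: "degree (\<Prod>x\<in>#A. [:- x, 1::'c::field:]) = size A"
proof (induction A)
  case (add x A)
  have "(\<Prod>x\<in>#A. [:- x, 1::'c:]) \<noteq> 0"
    using monic_prod_linear[of A] by force
  then show ?case using add
    by (simp del: mult_pCons_left mult_pCons_right add: degree_mult_eq)
qed simp

lemma size_proots_monic:
  fixes f :: "'c::alg_closed_field poly"
  assumes "lead_coeff f = 1"
  shows "size (proots f) = degree f"
  using monic_eq_prod_proots[OF assms] degree_prod_linear by metis

text \<open>Inclusion of root multisets lets the later counting of divisors do without irreducible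
  factors.\<close>

lemma monic_dvd_iff_proots:
  fixes f g :: "'c::alg_closed_field poly"
  assumes "lead_coeff f = 1" "lead_coeff g = 1"
  shows "f dvd g \<longleftrightarrow> proots f \<subseteq># proots g"
proof
  assume "f dvd g"
  then obtain r where r: "g = f * r" by (elim dvdE)
  with assms have "f \<noteq> 0" "r \<noteq> 0" by auto
  then show "proots f \<subseteq># proots g" by (simp add: r proots_mult)
next
  assume "proots f \<subseteq># proots g"
  then obtain B where "proots g = proots f + B" by (metis subset_mset.le_iff_add)
  then have "g = f * (\<Prod>x\<in>#B. [:- x, 1:])"
    using monic_eq_prod_proots[OF assms(1)] monic_eq_prod_proots[OF assms(2)]
    by (metis image_mset_union prod_mset.union)
  then show "f dvd g" by simp
qed

text \<open>Logarithmic differentiation: a factor 1 - yX contributes yX / (1 - yX), the series of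
  the y^i with i > 0. Multiplying through by the product avoids inverting it.\<close>

lemma newton_fps:
  fixes R :: "'c::field multiset"
  shows "- (fps_X * fps_deriv (\<Prod>y\<in>#R. 1 - fps_const y * fps_X)) =
     (\<Prod>y\<in>#R. 1 - fps_const y * fps_X) * (\<Sum>y\<in>#R. Abs_fps (\<lambda>i. if i = 0 then 0 else y ^ i))"
proof (induction R)
  case (add y R)
  define A where "A = (\<Prod>y\<in>#R. 1 - fps_const y * fps_X)"
  define L where "L = 1 - fps_const y * (fps_X :: 'c fps)"
  define G where "G = Abs_fps (\<lambda>i. if i = 0 then 0 else y ^ i)"
  define T where "T = (\<Sum>y\<in>#R. Abs_fps (\<lambda>i. if i = 0 then 0 else y ^ i))"
  have LG: "L * G = fps_const y * fps_X"
  proof (rule fps_ext)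
    fix n
    have "(L * G) $ n = G $ n - y * (if n = 0 then 0 else G $ (n - 1))"
      by (simp add: L_def left_diff_distrib mult.assoc)
    also have "\<dots> = (fps_const y * fps_X) $ n"
      by (cases n) (auto simp: G_def)
    finally show "(L * G) $ n = (fps_const y * fps_X) $ n" .
  qed
  have dL: "fps_deriv L = - fps_const y" by (simp add: L_def)
  have IH: "- (fps_X * fps_deriv A) = A * T" using add by (simp add: A_def T_def)
  have "- (fps_X * fps_deriv (L * A)) = A * (fps_const y * fps_X) + L * - (fps_X * fps_deriv A)"
    by (simp add: dL algebra_simps flip: fps_const_neg)
  also have "\<dots> = L * A * (G + T)"
    unfolding IH LG[symmetric] by (simp add: algebra_simps)
  finally show ?case by (simp add: A_def L_def G_def T_def)
qed simp

lemma fps_nth_sum_mset: "(\<Sum>y\<in>#R. F y) $ i = (\<Sum>y\<in>#R. F y $ i)"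
  by (induction R) auto

lemma fps_of_poly_prod_mset: "fps_of_poly (\<Prod>y\<in>#R. F y) = (\<Prod>y\<in>#R. fps_of_poly (F y))"
  by (induction R) (auto simp: fps_of_poly_mult)

lemma reflect_poly_prod_mset:
  "reflect_poly (\<Prod>y\<in>#R. F y) = (\<Prod>y\<in>#R. reflect_poly (F y :: 'c::field poly))"
  by (induction R) (auto simp: reflect_poly_mult)

text \<open>Coefficient comparison at X^i in \<open>newton_fps\<close>: the reversed polynomial is
  the product of the 1 - yX, so its coefficient at l is \<open>coeff f (n - l)\<close>, without
  truncation because l <= i <= n.\<close>

lemma newton_recursion:
  fixes f :: "'c::alg_closed_field poly"
  assumes f: "lead_coeff f = 1" "degree f = n" and i: "0 < i" "i \<le> n"
  shows "(\<Sum>y\<in>#proots f. y ^ i) =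
     - of_nat i * coeff f (n - i) - (\<Sum>l\<in>{1..<i}. coeff f (n - l) * (\<Sum>y\<in>#proots f. y ^ (i - l)))"
proof -
  define R where "R = proots f"
  define A where "A = (\<Prod>y\<in>#R. 1 - fps_const y * fps_X)"
  define T where "T = (\<Sum>y\<in>#R. Abs_fps (\<lambda>i. if i = 0 then 0 else y ^ i))"
  have "reflect_poly f = (\<Prod>y\<in>#R. reflect_poly [:- y, 1:])"
    using monic_eq_prod_proots[OF f(1)] by (metis R_def reflect_poly_prod_mset)
  also have "fps_of_poly \<dots> = A"
    unfolding A_def fps_of_poly_prod_mset
    by (intro arg_cong[where f = prod_mset] image_mset_cong)
       (auto simp: reflect_poly_def fps_of_poly_pCons)
  finally have A: "fps_of_poly (reflect_poly f) = A" .
  have An: "A $ l = coeff f (n - l)" if "l \<le> n" for l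
    using that f(2) by (simp add: A[symmetric] coeff_reflect_poly)
  have A0: "A $ 0 = 1" using An[of 0] f by simp
  have Tn: "T $ l = (if l = 0 then 0 else \<Sum>y\<in>#R. y ^ l)" for l
    by (auto simp: T_def fps_nth_sum_mset)
  have "- (fps_X * fps_deriv A) $ i = (A * T) $ i"
    using newton_fps[of R] by (simp add: A_def T_def)
  moreover have "- (fps_X * fps_deriv A) $ i = - of_nat i * A $ i"
    using i by (cases i) (auto simp: algebra_simps)
  ultimately have "- of_nat i * A $ i = (\<Sum>l\<in>{0..i}. A $ l * T $ (i - l))"
    by (simp add: fps_mult_nth)
  also have "\<dots> = T $ i + (\<Sum>l\<in>{1..<i}. A $ l * T $ (i - l))"
  proof -
    have "{0..i} = insert 0 (insert i {1..<i})" using i by auto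
    then show ?thesis using i A0 Tn[of 0] by simp
  qed
  finally have "T $ i = - of_nat i * A $ i - (\<Sum>l\<in>{1..<i}. A $ l * T $ (i - l))"
    by (simp add: algebra_simps)
  also have "(\<Sum>l\<in>{1..<i}. A $ l * T $ (i - l)) =
     (\<Sum>l\<in>{1..<i}. coeff f (n - l) * (\<Sum>y\<in>#R. y ^ (i - l)))"
    using i by (intro sum.cong refl) (auto simp: An Tn)
  finally show ?thesis using i by (simp add: Tn An R_def)
qed

text \<open>The constant coefficient enters Newton's identities for the first time at exponent n,
  and there only through the term -n \<open>coeff f 0\<close>; the lower power sums agree by
  induction. Stating an invariant spares an explicit formula for the power sum.\<close>

lemma power_sum_const_coeff:
  fixes f f' :: "'c::alg_closed_field poly"
  assumes f: "lead_coeff f = 1" "degree f = n" and f': "lead_coeff f' = 1" "degree f' = n"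
    and eq: "\<And>i. i > 0 \<Longrightarrow> coeff f i = coeff f' i" and n: "n > 0"
  shows "(\<Sum>y\<in>#proots f. y ^ n) + of_nat n * coeff f 0 =
         (\<Sum>y\<in>#proots f'. y ^ n) + of_nat n * coeff f' 0"
proof -
  have P: "(\<Sum>y\<in>#proots f. y ^ i) = (\<Sum>y\<in>#proots f'. y ^ i)" if "0 < i" "i < n" for i
    using that
  proof (induction i rule: less_induct)
    case (less i)
    have "(\<Sum>l\<in>{1..<i}. coeff f (n - l) * (\<Sum>y\<in>#proots f. y ^ (i - l))) =
       (\<Sum>l\<in>{1..<i}. coeff f' (n - l) * (\<Sum>y\<in>#proots f'. y ^ (i - l)))"
      using less by (intro sum.cong refl arg_cong2[where f = "(*)"]) (auto simp: eq)
    then show ?case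
      using newton_recursion[OF f, of i] newton_recursion[OF f', of i] less eq[of "n - i"] by simp
  qed
  have "(\<Sum>l\<in>{1..<n}. coeff f (n - l) * (\<Sum>y\<in>#proots f. y ^ (n - l))) =
       (\<Sum>l\<in>{1..<n}. coeff f' (n - l) * (\<Sum>y\<in>#proots f'. y ^ (n - l)))"
    by (intro sum.cong refl arg_cong2[where f = "(*)"]) (auto simp: eq P)
  then show ?thesis
    using newton_recursion[OF f, of n] newton_recursion[OF f', of n] n by simp
qed

section \<open>Polynomials over a finite subfield\<close>

locale frobenius_closure =
  fixes Q d :: nat and ty :: "'c::alg_closed_field itself"
  assumes char: "prime CHAR('c)" and Q: "Q = CHAR('c) ^ d" and d: "d > 0"
begin

definition K :: "nat \<Rightarrow> 'c set" where "K n = {x. x ^ (Q ^ n) = x}"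

definition Mon :: "nat \<Rightarrow> 'c poly set" where
  "Mon n = {f. degree f = n \<and> lead_coeff f = 1 \<and> (\<forall>i. coeff f i \<in> K 1)}"

text \<open>For n > 0 and y in \<open>K n\<close>, the field of order Q^n, this is the
  characteristic polynomial of y over \<open>K 1\<close>, a power of its minimal polynomial.\<close>

definition orb :: "nat \<Rightarrow> 'c \<Rightarrow> 'c poly" where "orb n y = (\<Prod>i<n. [:- (y ^ (Q ^ i)), 1:])"

lemma Q_gt1: "Q > 1"
  using prime_gt_1_nat[OF char] d unfolding Q by (rule one_less_power)

lemma add_pow: "(x + y :: 'c) ^ (Q ^ n) = x ^ (Q ^ n) + y ^ (Q ^ n)"
  by (rule freshmans_dream'[OF char]) (auto simp: Q simp flip: power_mult)

lemma sum_pow: "(sum f A :: 'c) ^ (Q ^ n) = (\<Sum>i\<in>A. f i ^ (Q ^ n))"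
  by (rule freshmans_dream_sum'[OF char]) (auto simp: Q simp flip: power_mult)

lemma minus_pow: "(- x :: 'c) ^ (Q ^ n) = - (x ^ (Q ^ n))"
proof -
  have "(- x) ^ (Q ^ n) + x ^ (Q ^ n) = 0"
    using add_pow[of "- x" x n] Q_gt1 by (simp add: power_0_left)
  then show ?thesis by (simp add: eq_neg_iff_add_eq_0)
qed

lemma diff_pow: "(x - y :: 'c) ^ (Q ^ n) = x ^ (Q ^ n) - y ^ (Q ^ n)"
  using add_pow[of x "- y" n] by (simp add: minus_pow)

lemma pow_inj: "(x :: 'c) ^ (Q ^ n) = y ^ (Q ^ n) \<longleftrightarrow> x = y"
  using diff_pow[of x y n] Q_gt1 by fastforce

lemma pow_inj1: "(x :: 'c) ^ Q = y ^ Q \<longleftrightarrow> x = y"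
  using pow_inj[of x 1 y] by simp

lemma K_0 [simp]: "0 \<in> K n" and K_1 [simp]: "1 \<in> K n"
  using Q_gt1 by (auto simp: K_def)

lemma K_add [simp]: "x \<in> K n \<Longrightarrow> y \<in> K n \<Longrightarrow> x + y \<in> K n"
  by (simp add: K_def add_pow)

lemma K_minus [simp]: "x \<in> K n \<Longrightarrow> - x \<in> K n"
  by (simp add: K_def minus_pow)

lemma K_minus_iff [simp]: "- x \<in> K n \<longleftrightarrow> x \<in> K n"
  using K_minus[of x n] K_minus[of "- x" n] by auto

lemma K_diff [simp]: "x \<in> K n \<Longrightarrow> y \<in> K n \<Longrightarrow> x - y \<in> K n"
  by (simp add: K_def diff_pow)

lemma K_mult [simp]: "x \<in> K n \<Longrightarrow> y \<in> K n \<Longrightarrow> x * y \<in> K n"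
  by (simp add: K_def power_mult_distrib)

lemma K_of_nat [simp]: "of_nat m \<in> K n"
  by (induction m) auto

lemma K1_iff: "x \<in> K 1 \<longleftrightarrow> x ^ Q = x"
  by (simp add: K_def)

text \<open>The elements of \<open>K n\<close> are roots of X^(Q^n) - X. The bound is attained once
  a field of that order has been embedded.\<close>

lemma finite_K: "n > 0 \<Longrightarrow> finite (K n)" and card_K_le: "n > 0 \<Longrightarrow> card (K n) \<le> Q ^ n"
proof -
  assume n: "n > 0"
  define P where "P = monom 1 (Q ^ n) - [:0, 1 :: 'c:]"
  have "Q ^ n > 1" using Q_gt1 n by (metis one_less_power)
  then have "coeff P (Q ^ n) = 1" using n unfolding P_def by (auto simp: coeff_pCons simp del: One_nat_def split: nat.splits)
  then have "P \<noteq> 0" by auto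
  moreover have "K n = {x. poly P x = 0}"
    by (auto simp: P_def K_def poly_monom)
  moreover have "degree P \<le> Q ^ n"
    using \<open>Q ^ n > 1\<close> unfolding P_def by (intro degree_diff_le) (auto simp: degree_monom_le)
  ultimately show "finite (K n)" "card (K n) \<le> Q ^ n"
    using poly_roots_finite[of P] card_poly_roots_bound[of P] by auto
qed

text \<open>Frobenius on coefficients is multiplicative, so \<open>Fr f = f\<close> is a convenient
  way to say that the coefficients lie in \<open>K 1\<close>: it passes to products and
  cofactors.\<close>

definition Fr :: "'c poly \<Rightarrow> 'c poly" where "Fr f = map_poly (\<lambda>x. x ^ Q) f"

lemma coeff_Fr: "coeff (Fr f) i = coeff f i ^ Q"
  using Q_gt1 by (simp add: Fr_def coeff_map_poly)

lemma Fr_mult: "Fr (f * g) = Fr f * Fr g"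
proof (rule poly_eqI)
  fix n
  have "(\<Sum>i\<le>n. coeff f i * coeff g (n - i)) ^ Q = (\<Sum>i\<le>n. (coeff f i * coeff g (n - i)) ^ Q)"
    using sum_pow[of "\<lambda>i. coeff f i * coeff g (n - i)" "{..n}" 1] by simp
  then show "coeff (Fr (f * g)) n = coeff (Fr f * Fr g) n"
    by (simp add: coeff_Fr coeff_mult power_mult_distrib)
qed

lemma Fr_linear: "Fr [:- x, 1:] = [:- (x ^ Q), 1:]"
  using minus_pow[of x 1] Q_gt1
  by (intro poly_eqI) (auto simp: coeff_Fr coeff_pCons split: nat.splits)

lemma Fr_1: "Fr 1 = 1"
  using Q_gt1 by (intro poly_eqI) (auto simp: coeff_Fr coeff_1)

lemma Fr_prod_linear: "Fr (\<Prod>x\<in>#A. [:- x, 1:]) = (\<Prod>x\<in>#A. [:- (x ^ Q), 1:])"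
  by (induction A) (simp_all only: image_mset_add_mset prod_mset.add_mset Fr_mult Fr_linear
      image_mset_empty prod_mset_empty Fr_1)

lemma Fr_eq_iff: "Fr f = f \<longleftrightarrow> (\<forall>i. coeff f i \<in> K 1)"
  by (auto simp: poly_eq_iff coeff_Fr K_def)

lemma MonD:
  assumes "f \<in> Mon n"
  shows "lead_coeff f = 1" "degree f = n" "Fr f = f" "f \<noteq> 0"
  using assms by (auto simp: Mon_def Fr_eq_iff)

lemma MonI: "lead_coeff f = 1 \<Longrightarrow> degree f = n \<Longrightarrow> Fr f = f \<Longrightarrow> f \<in> Mon n"
  by (auto simp: Mon_def Fr_eq_iff)

lemma proots_Mon:
  assumes "f \<in> Mon n"
  shows "image_mset (\<lambda>x. x ^ Q) (proots f) = proots f"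
proof -
  have f: "f = (\<Prod>x\<in>#proots f. [:- x, 1:])"
    by (rule monic_eq_prod_proots) (rule MonD[OF assms])
  have "f = Fr f" using MonD[OF assms] by simp
  also have "\<dots> = Fr (\<Prod>x\<in>#proots f. [:- x, 1:])" using f by simp
  also have "\<dots> = (\<Prod>x\<in>#image_mset (\<lambda>x. x ^ Q) (proots f). [:- x, 1:])"
    by (simp add: Fr_prod_linear multiset.map_comp o_def)
  finally show ?thesis by (metis proots_prod_linear)
qed

lemma order_Mon:
  assumes "f \<in> Mon n"
  shows "order (x ^ Q) f = order x f"
proof -
  have "count (image_mset (\<lambda>x. x ^ Q) A) (x ^ Q) = count A x" for A :: "'c multiset"
    by (induction A) (auto simp: pow_inj1)
  then have "count (image_mset (\<lambda>x. x ^ Q) (proots f)) (x ^ Q) = count (proots f) x" .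
  then show ?thesis using MonD[OF assms] by (simp add: proots_Mon[OF assms])
qed

lemma order_Mon': "f \<in> Mon n \<Longrightarrow> order (x ^ (Q ^ i)) f = order x f"
proof (induction i)
  case (Suc i)
  have "x ^ (Q ^ Suc i) = (x ^ (Q ^ i)) ^ Q"
    by (simp add: mult.commute flip: power_mult)
  then show ?case using Suc order_Mon by simp
qed simp

lemma prod_mset_pow: "(\<Prod>\<^sub># M :: 'c) ^ n = (\<Prod>x\<in>#M. x ^ n)"
  by (induction M) (auto simp: power_mult_distrib)

lemma prod_roots_K:
  assumes "f \<in> Mon n"
  shows "\<Prod>\<^sub># (proots f) \<in> K 1"
proof -
  have "\<Prod>\<^sub># (proots f) ^ Q = \<Prod>\<^sub># (image_mset (\<lambda>x. x ^ Q) (proots f))"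
    by (simp add: prod_mset_pow)
  then show ?thesis unfolding K1_iff by (simp add: proots_Mon[OF assms])
qed

lemma sum_mset_pow: "(\<Sum>\<^sub># M :: 'c) ^ Q = (\<Sum>x\<in>#M. x ^ Q)"
  using add_pow[where n = 1] Q_gt1 by (induction M) auto

lemma power_sum_K:
  assumes "f \<in> Mon n"
  shows "(\<Sum>y\<in>#proots f. y ^ s) \<in> K 1"
proof -
  have "(\<Sum>y\<in>#proots f. y ^ s) ^ Q = (\<Sum>y\<in>#image_mset (\<lambda>x. x ^ Q) (proots f). y ^ s)"
    unfolding sum_mset_pow by (simp add: multiset.map_comp o_def mult.commute flip: power_mult)
  then show ?thesis unfolding K1_iff by (simp add: proots_Mon[OF assms])
qed

lemma orb_altdef: "orb n y = (\<Prod>x\<in>#image_mset (\<lambda>i. y ^ (Q ^ i)) (mset_set {..<n}). [:- x, 1:])"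
  unfolding orb_def prod_unfold_prod_mset by (simp add: multiset.map_comp o_def)

lemma proots_orb: "proots (orb n y) = image_mset (\<lambda>i. y ^ (Q ^ i)) (mset_set {..<n})"
  unfolding orb_altdef by (rule proots_prod_linear)

text \<open>Frobenius shifts the index of each factor by one, and y^(Q^n) = y closes the
  cycle.\<close>

lemma orb_Mon:
  assumes "y \<in> K n"
  shows "orb n y \<in> Mon n"
proof (rule MonI)
  show "lead_coeff (orb n y) = 1" unfolding orb_altdef by (rule monic_prod_linear)
  show "degree (orb n y) = n" unfolding orb_altdef degree_prod_linear by simp
  show "Fr (orb n y) = orb n y"
  proof (cases n)
    case 0
    then show ?thesis by (simp add: orb_def Fr_1)
  next
    case (Suc m)
    have "Fr (orb n y) = (\<Prod>i<n. [:- (y ^ (Q ^ Suc i)), 1:])"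
      unfolding orb_altdef Fr_prod_linear prod_unfold_prod_mset
      by (simp add: multiset.map_comp o_def mult.commute flip: power_mult)
    also have "\<dots> = (\<Prod>i<m. [:- (y ^ (Q ^ Suc i)), 1:]) * [:- y, 1:]"
      using assms by (simp add: Suc K_def)
    also have "\<dots> = orb n y"
      unfolding orb_def Suc prod.lessThan_Suc_shift by (simp add: mult.commute)
    finally show ?thesis .
  qed
qed

lemma finite_Mon: "finite (Mon n)"
proof (rule finite_subset)
  show "Mon n \<subseteq> Poly ` {xs. set xs \<subseteq> K 1 \<and> length xs = Suc n}"
  proof
    fix f assume f: "f \<in> Mon n"
    then have "f \<noteq> 0" using MonD by blast
    have "f = Poly (coeffs f)" by simp
    moreover have "set (coeffs f) \<subseteq> K 1" using f by (auto simp: Mon_def coeffs_def)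
    moreover have "length (coeffs f) = Suc n"
      using f \<open>f \<noteq> 0\<close> by (simp add: Mon_def length_coeffs_degree)
    ultimately show "f \<in> Poly ` {xs. set xs \<subseteq> K 1 \<and> length xs = Suc n}" by blast
  qed
  show "finite (Poly ` {xs. set xs \<subseteq> K 1 \<and> length xs = Suc n})"
    using finite_lists_length_eq[OF finite_K[of 1]] by auto
qed

lemma Mon_0: "Mon 0 = {1}"
proof -
  have "f = 1" if "f \<in> Mon 0" for f
    using MonD[OF that] by (metis degree_eq_zeroE lead_coeff_pCons(2) one_pCons)
  moreover have "1 \<in> Mon 0" by (rule MonI) (auto simp: Fr_1)
  ultimately show ?thesis by auto
qed

lemma Mon_mult: "f \<in> Mon m \<Longrightarrow> g \<in> Mon n \<Longrightarrow> f * g \<in> Mon (m + n)"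
proof (rule MonI)
  assume fg: "f \<in> Mon m" "g \<in> Mon n"
  note f = MonD[OF fg(1)] and g = MonD[OF fg(2)]
  show "lead_coeff (f * g) = 1" using f(1) g(1) by (metis lead_coeff_mult mult_1)
  show "degree (f * g) = m + n" using degree_mult_eq[OF f(4) g(4)] f(2) g(2) by simp
  show "Fr (f * g) = f * g" using f(3) g(3) by (simp add: Fr_mult)
qed

lemma Mon_cofactor:
  assumes "f \<in> Mon m" "f * g \<in> Mon n" "m \<le> n"
  shows "g \<in> Mon (n - m)"
proof (rule MonI)
  note f = MonD[OF assms(1)] and fg = MonD[OF assms(2)]
  have g: "g \<noteq> 0" using fg by auto
  show "lead_coeff g = 1" using fg(1) f(1) by (simp add: lead_coeff_mult)
  show "degree g = n - m" using fg(2) f(2,4) g by (simp add: degree_mult_eq)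
  have "f * Fr g = f * g" using fg(3) f(3) by (simp add: Fr_mult)
  then show "Fr g = g" using f(4) by simp
qed

end

lemma card_residues_below:
  assumes "m > 0" "r < m"
  shows "card {i'. i' < m * i \<and> i' mod m = r} = (i :: nat)"
proof -
  have "{i'. i' < m * i \<and> i' mod m = r} = (\<lambda>t. m * t + r) ` {..<i}"
  proof (intro equalityI subsetI)
    fix x assume "x \<in> {i'. i' < m * i \<and> i' mod m = r}"
    then have "x = m * (x div m) + r" "x div m < i"
      using assms by (auto simp: div_less_iff_less_mult mult.commute)
    then show "x \<in> (\<lambda>t. m * t + r) ` {..<i}" by blast
  next
    fix x assume "x \<in> (\<lambda>t. m * t + r) ` {..<i}"
    then obtain t where t: "x = m * t + r" "t < i" by auto
    have "m * Suc t \<le> m * i" using t(2) by (intro mult_le_mono2) simp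
    then have "m * t + r < m * i" using assms(2) by simp
    then show "x \<in> {i'. i' < m * i \<and> i' mod m = r}" using t assms by simp
  qed
  moreover have "inj_on (\<lambda>t. m * t + r) {..<i}" using assms by (auto simp: inj_on_def)
  ultimately show ?thesis by (simp add: card_image)
qed

section \<open>Counting the divisors of the form \<open>orb j y\<close>\<close>

context frobenius_closure
begin

lemma pow_pow: "((y :: 'c) ^ (Q ^ i)) ^ (Q ^ j) = y ^ (Q ^ (i + j))"
  by (simp add: power_add flip: power_mult)

lemma count_proots_orb: "count (proots (orb j y)) z = card {i. i < j \<and> y ^ (Q ^ i) = z}"
proof -
  have "count (image_mset f (mset_set A)) z = card {i\<in>A. f i = z}" if "finite A" for f and A :: "nat set"
    using that
  proof induction
    case (insert x A)
    have "{i \<in> insert x A. f i = z} = (if f x = z then insert x {i\<in>A. f i = z} else {i\<in>A. f i = z})"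
      by auto
    with insert show ?case by simp
  qed simp
  from this[of "{..<j}"] show ?thesis by (simp add: proots_orb)
qed

text \<open>Let m be the length of the Frobenius orbit of y. Then y lies in \<open>K j\<close> iff m
  divides j, and \<open>orb (m * i) y\<close> has every conjugate of y as a root of multiplicity i.
  As all conjugates have the same order in f, it divides f iff i <= \<open>order y f\<close>. So the
  counted j are the m i with i from 1 to \<open>order y f\<close>.\<close>

lemma card_orbit_factors:
  assumes f: "f \<in> Mon n" and y: "poly f y = 0"
  shows "card {j\<in>{1..n}. y \<in> K j \<and> orb j y dvd f} = order y f"
proof -
  note fD = MonD[OF f]
  define Z where "Z = {z. poly f z = 0}"
  have finZ: "finite Z" unfolding Z_def using fD(4) by (rule poly_roots_finite)
  \<comment> \<open>All Frobenius images of y are roots of f, hence finite in number; injectivity of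
    Frobenius turns a repetition into a return to y itself.\<close>
  have "order (y ^ (Q ^ i)) f > 0" for i
    using y fD(4) by (simp add: order_Mon'[OF f] order_gt_0_iff)
  then have "range (\<lambda>i. y ^ (Q ^ i)) \<subseteq> Z"
    using fD(4) by (auto simp: Z_def order_gt_0_iff)
  then have "finite (range (\<lambda>i. y ^ (Q ^ i)))" using finZ finite_subset by blast
  then have "\<not> inj (\<lambda>i. y ^ (Q ^ i))" using finite_imageD infinite_UNIV_nat by blast
  then obtain i i' where i: "i < i'" "y ^ (Q ^ i) = y ^ (Q ^ i')"
    unfolding inj_def by (metis linorder_neqE_nat)
  have shift: "y ^ (Q ^ a) = y ^ (Q ^ (a + b)) \<longleftrightarrow> y = y ^ (Q ^ b)" for a b
    using pow_inj[of y a "y ^ (Q ^ b)"] by (simp add: pow_pow add.commute)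
  define m where "m = (LEAST m. m > 0 \<and> y ^ (Q ^ m) = y)"
  have "i' - i > 0 \<and> y ^ (Q ^ (i' - i)) = y" using i shift[of i "i' - i"] by simp
  then have "m > 0 \<and> y ^ (Q ^ m) = y" unfolding m_def by (rule LeastI)
  then have m: "m > 0" "y ^ (Q ^ m) = y" by auto
  have m_least: "m \<le> l" if "l > 0" "y ^ (Q ^ l) = y" for l
    unfolding m_def using that by (intro Least_le) auto
  have mult: "y ^ (Q ^ (m * l)) = y" for l
  proof (induction l)
    case (Suc l)
    have "y ^ (Q ^ (m * Suc l)) = (y ^ (Q ^ (m * l))) ^ (Q ^ m)" by (simp add: pow_pow add.commute)
    then show ?case using Suc m by simp
  qed simp
  have red: "y ^ (Q ^ l) = y ^ (Q ^ (l mod m))" for l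
  proof -
    have "y ^ (Q ^ l) = (y ^ (Q ^ (m * (l div m)))) ^ (Q ^ (l mod m))" by (simp add: pow_pow)
    then show ?thesis by (simp add: mult)
  qed
  have eq_small: "a = b" if "y ^ (Q ^ a) = y ^ (Q ^ b)" "a < m" "b < m" for a b
    using that
  proof (induction a b rule: linorder_wlog)
    case (le a b)
    have "y = y ^ (Q ^ (b - a))" using le shift[of a "b - a"] by simp
    then have "\<not> b - a > 0" using m_least[of "b - a"] le by force
    then show ?case using le by simp
  qed auto
  have per: "y ^ (Q ^ a) = y ^ (Q ^ b) \<longleftrightarrow> a mod m = b mod m" for a b
    using red[of a] red[of b] eq_small[of "a mod m" "b mod m"] m(1) by auto
  have inK: "y \<in> K j \<longleftrightarrow> m dvd j" for j
    using per[of j 0] m(1) by (auto simp: K_def dvd_eq_mod_eq_0)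
  have dvd_iff: "orb (m * i) y dvd f \<longleftrightarrow> i \<le> order y f" if i: "i > 0" for i
  proof -
    have cpM: "orb (m * i) y \<in> Mon (m * i)" by (rule orb_Mon) (simp add: inK)
    have cnt: "count (proots (orb (m * i) y)) (y ^ (Q ^ l)) = i" for l
      unfolding count_proots_orb per using m(1) by (intro card_residues_below) auto
    have cnt0: "count (proots (orb (m * i) y)) z = 0" if "z \<notin> range (\<lambda>l. y ^ (Q ^ l))" for z
      unfolding count_proots_orb using that by auto
    have "orb (m * i) y dvd f \<longleftrightarrow> proots (orb (m * i) y) \<subseteq># proots f"
      using MonD(1)[OF cpM] fD(1) by (rule monic_dvd_iff_proots)
    also have "\<dots> \<longleftrightarrow> i \<le> order y f"
    proof
      assume "proots (orb (m * i) y) \<subseteq># proots f"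
      then have "count (proots (orb (m * i) y)) (y ^ (Q ^ 0)) \<le> count (proots f) (y ^ (Q ^ 0))"
        by (rule mset_subset_eq_count)
      then show "i \<le> order y f" using fD(4) unfolding cnt by simp
    next
      assume le: "i \<le> order y f"
      show "proots (orb (m * i) y) \<subseteq># proots f"
      proof (rule mset_subset_eqI)
        fix z
        show "count (proots (orb (m * i) y)) z \<le> count (proots f) z"
        proof (cases "z \<in> range (\<lambda>l. y ^ (Q ^ l))")
          case True
          then obtain l where "z = y ^ (Q ^ l)" by auto
          then show ?thesis using le fD(4) cnt[of l] by (simp add: order_Mon'[OF f])
        qed (simp add: cnt0)
      qed
    qed
    finally show ?thesis .
  qed
  have "{j\<in>{1..n}. y \<in> K j \<and> orb j y dvd f} = (\<lambda>i. m * i) ` {1..order y f}"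
  proof (intro equalityI subsetI)
    fix j assume "j \<in> {j\<in>{1..n}. y \<in> K j \<and> orb j y dvd f}"
    then obtain i where "j = m * i" "i > 0" "orb (m * i) y dvd f"
      by (auto simp: inK elim!: dvdE)
    then show "j \<in> (\<lambda>i. m * i) ` {1..order y f}" using dvd_iff by auto
  next
    fix j assume "j \<in> (\<lambda>i. m * i) ` {1..order y f}"
    then obtain i where i: "j = m * i" "i \<in> {1..order y f}" by blast
    then have i: "j = m * i" "i > 0" "i \<le> order y f" by auto
    have "orb j y dvd f" using dvd_iff i by simp
    moreover have "y \<in> K j" by (simp add: inK i)
    moreover have "j \<le> n"
      using dvd_imp_degree_le[OF \<open>orb j y dvd f\<close> fD(4)] MonD(2)[OF orb_Mon[OF \<open>y \<in> K j\<close>]] fD(2) by simp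
    ultimately show "j \<in> {j\<in>{1..n}. y \<in> K j \<and> orb j y dvd f}" using i m(1) by auto
  qed
  then show ?thesis using m(1) by (simp add: card_image inj_on_def)
qed

text \<open>Summing over y first, \<open>card_orbit_factors\<close> turns the count into the sum of
  the root multiplicities of f. Each y that occurs is a root of f since X - y is the factor of
  \<open>orb j y\<close> at index 0.\<close>

lemma card_factors:
  assumes f: "f \<in> Mon n"
  shows "(\<Sum>j\<in>{1..n}. card {y\<in>K j. orb j y dvd f}) = n"
proof -
  note fD = MonD[OF f]
  define Z where "Z = {z. poly f z = 0}"
  have finZ: "finite Z" unfolding Z_def using fD(4) by (rule poly_roots_finite)
  have root: "y \<in> Z" if "j \<in> {1..n}" "orb j y dvd f" for j y
  proof -
    have "poly (orb j y) y = 0" using that(1) by (auto simp: orb_def poly_prod intro!: bexI[of _ 0])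
    then show ?thesis using that(2) by (auto simp: Z_def)
  qed
  have "(\<Sum>j\<in>{1..n}. card {y\<in>K j. orb j y dvd f})
      = (\<Sum>j\<in>{1..n}. \<Sum>y\<in>Z. if y \<in> K j \<and> orb j y dvd f then 1 else 0)"
  proof (rule sum.cong[OF refl])
    fix j assume j: "j \<in> {1..n}"
    have "{y\<in>K j. orb j y dvd f} = {y\<in>Z. y \<in> K j \<and> orb j y dvd f}" using root[OF j] by auto
    then show "card {y\<in>K j. orb j y dvd f} = (\<Sum>y\<in>Z. if y \<in> K j \<and> orb j y dvd f then 1 else 0)"
      using finZ by (simp add: sum.If_cases Int_def)
  qed
  also have "\<dots> = (\<Sum>y\<in>Z. \<Sum>j\<in>{1..n}. if y \<in> K j \<and> orb j y dvd f then 1 else 0)"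
    by (rule sum.swap)
  also have "\<dots> = (\<Sum>y\<in>Z. card {j\<in>{1..n}. y \<in> K j \<and> orb j y dvd f})"
    by (simp add: sum.If_cases Int_def)
  also have "\<dots> = (\<Sum>y\<in>Z. order y f)"
    by (intro sum.cong refl card_orbit_factors[OF f]) (simp add: Z_def)
  also have "\<dots> = size (proots f)"
    using fD(4) by (simp add: size_multiset_overloaded_eq Z_def)
  also have "\<dots> = n" using size_proots_monic[OF fD(1)] fD(2) by simp
  finally show ?thesis .
qed

end

section \<open>The L-function of a multiplicative function on monic polynomials\<close>

locale frobenius_characters = frobenius_closure Q d ty
  for Q d and ty :: "'c::alg_closed_field itself" +
  fixes \<chi> \<psi> :: "'c \<Rightarrow> complex" and s :: nat
  assumes \<chi>_mult: "\<And>x y. x \<in> K 1 \<Longrightarrow> y \<in> K 1 \<Longrightarrow> \<chi> (x * y) = \<chi> x * \<chi> y"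
    and \<chi>_1: "\<chi> 1 = 1"
    and \<psi>_add: "\<And>x y. x \<in> K 1 \<Longrightarrow> y \<in> K 1 \<Longrightarrow> \<psi> (x + y) = \<psi> x * \<psi> y"
    and \<psi>_0: "\<psi> 0 = 1"
begin

definition lam :: "'c poly \<Rightarrow> complex" where
  "lam f = \<chi> (\<Prod>\<^sub># (proots f)) * \<psi> (\<Sum>y\<in>#proots f. y ^ s)"

definition c :: "nat \<Rightarrow> complex" where "c n = (\<Sum>f\<in>Mon n. lam f)"

text \<open>For y in \<open>K j\<close> the product is the norm of y and the sum the trace of y^s
  down to \<open>K 1\<close>. These are the coefficients of the logarithmic derivative of the series
  with coefficients \<open>c\<close>.\<close>

definition S :: "nat \<Rightarrow> complex" where
  "S j = (\<Sum>y\<in>K j. \<chi> (\<Prod>i<j. y ^ (Q ^ i)) * \<psi> (\<Sum>i<j. (y ^ (Q ^ i)) ^ s))"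

lemma lam_mult: "f \<in> Mon m \<Longrightarrow> g \<in> Mon n \<Longrightarrow> lam (f * g) = lam f * lam g"
  using prod_roots_K[of f m] prod_roots_K[of g n] power_sum_K[of f m s] power_sum_K[of g n s]
    MonD(4)[of f m] MonD(4)[of g n]
  by (simp add: lam_def proots_mult \<chi>_mult \<psi>_add del: One_nat_def)

lemma c_0: "c 0 = 1"
  by (simp add: c_def Mon_0 lam_def \<chi>_1 \<psi>_0)

lemma lam_orb: "lam (orb j y) = \<chi> (\<Prod>i<j. y ^ (Q ^ i)) * \<psi> (\<Sum>i<j. (y ^ (Q ^ i)) ^ s)"
  by (simp add: lam_def proots_orb prod_unfold_prod_mset sum_unfold_sum_mset multiset.map_comp o_def)

text \<open>Every polynomial of degree \<open>n\<close> has exactly \<open>n\<close> divisors of the form \<open>orb j y\<close>; this plays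
  the role of the von Mangoldt function and gives the logarithmic derivative of the \<open>L\<close>-function
  of \<open>lam\<close> without irreducible factorizations.\<close>

lemma c_recurrence: "of_nat n * c n = (\<Sum>j\<in>{1..n}. S j * c (n - j))"
proof -
  have "of_nat n * c n = (\<Sum>f\<in>Mon n. of_nat (\<Sum>j\<in>{1..n}. card {y\<in>K j. orb j y dvd f}) * lam f)"
    by (simp only: c_def sum_distrib_left card_factors cong: sum.cong)
  also have "\<dots> = (\<Sum>f\<in>Mon n. \<Sum>j\<in>{1..n}. \<Sum>y\<in>{y\<in>K j. orb j y dvd f}. lam f)"
    by (simp add: sum_distrib_right)
  also have "\<dots> = (\<Sum>j\<in>{1..n}. \<Sum>f\<in>Mon n. \<Sum>y\<in>{y\<in>K j. orb j y dvd f}. lam f)"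
    by (rule sum.swap)
  also have "\<dots> = (\<Sum>j\<in>{1..n}. S j * c (n - j))"
  proof (rule sum.cong[OF refl])
    fix j assume j: "j \<in> {1..n}"
    then have finK: "finite (K j)" by (intro finite_K) auto
    have "(\<Sum>f\<in>Mon n. \<Sum>y\<in>{y\<in>K j. orb j y dvd f}. lam f)
        = (\<Sum>y\<in>K j. \<Sum>f\<in>{f\<in>Mon n. orb j y dvd f}. lam f)"
      by (rule sum.swap_restrict[OF finite_Mon finK])
    also have "\<dots> = (\<Sum>y\<in>K j. lam (orb j y) * c (n - j))"
    proof (rule sum.cong[OF refl])
      fix y assume y: "y \<in> K j"
      note cpM = orb_Mon[OF y]
      have "(\<Sum>f\<in>{f\<in>Mon n. orb j y dvd f}. lam f) = (\<Sum>g\<in>Mon (n - j). lam (orb j y * g))"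
      proof (rule sum.reindex_bij_witness[of _ "\<lambda>g. orb j y * g" "\<lambda>f. f div orb j y"])
        fix f assume f: "f \<in> {f\<in>Mon n. orb j y dvd f}"
        then show "orb j y * (f div orb j y) = f" "lam (orb j y * (f div orb j y)) = lam f" by auto
        then show "f div orb j y \<in> Mon (n - j)" using Mon_cofactor[OF cpM] f j by simp
      next
        fix g assume g: "g \<in> Mon (n - j)"
        show "orb j y * g div orb j y = g" using MonD(4)[OF cpM] by simp
        show "orb j y * g \<in> {f\<in>Mon n. orb j y dvd f}" using Mon_mult[OF cpM g] j by simp
      qed
      also have "\<dots> = lam (orb j y) * c (n - j)"
        unfolding c_def sum_distrib_left by (intro sum.cong refl lam_mult[OF cpM])
      finally show "(\<Sum>f\<in>{f\<in>Mon n. orb j y dvd f}. lam f) = lam (orb j y) * c (n - j)" .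
    qed
    also have "\<dots> = S j * c (n - j)" by (simp add: S_def lam_orb sum_distrib_right)
    finally show "(\<Sum>f\<in>Mon n. \<Sum>y\<in>{y\<in>K j. orb j y dvd f}. lam f) = S j * c (n - j)" .
  qed
  finally show ?thesis .
qed

lemma S_eq_c:
  assumes "n > 0" "\<And>j. 0 < j \<Longrightarrow> j < n \<Longrightarrow> S j = 0"
  shows "S n = of_nat n * c n"
proof -
  have "(\<Sum>j\<in>{1..n}. S j * c (n - j)) = (\<Sum>j\<in>{n}. S j * c (n - j))"
    using assms by (intro sum.mono_neutral_right) auto
  then show ?thesis by (simp add: c_recurrence c_0)
qed

lemma norm_K: "y \<in> K j \<Longrightarrow> (\<Prod>i<j. y ^ (Q ^ i)) \<in> K 1"
  using prod_roots_K[OF orb_Mon] by (simp add: proots_orb prod_unfold_prod_mset del: One_nat_def)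

text \<open>Substituting z y for y leaves y^s unchanged and multiplies the norm by that of z, so the
  sum equals itself times a factor other than 1.\<close>

lemma S_eq_0:
  assumes z: "z \<in> K j" "z ^ s = 1" and ne: "\<chi> (\<Prod>i<j. z ^ (Q ^ i)) \<noteq> 1" and s: "s > 0"
  shows "S j = 0"
proof -
  have z0: "z \<noteq> 0" using z s by (auto simp: power_0_left)
  have "S j = (\<Sum>y\<in>K j. \<chi> (\<Prod>i<j. (z * y) ^ (Q ^ i)) * \<psi> (\<Sum>i<j. ((z * y) ^ (Q ^ i)) ^ s))"
    unfolding S_def
    by (rule sum.reindex_bij_witness[of _ "\<lambda>y. z * y" "\<lambda>y. y / z"])
       (use z z0 in \<open>auto simp: K_def power_divide power_mult_distrib\<close>)
  also have "\<dots> = (\<Sum>y\<in>K j. \<chi> (\<Prod>i<j. z ^ (Q ^ i)) * (\<chi> (\<Prod>i<j. y ^ (Q ^ i)) * \<psi> (\<Sum>i<j. (y ^ (Q ^ i)) ^ s)))"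
  proof (rule sum.cong[OF refl])
    fix y assume y: "y \<in> K j"
    have "(z ^ (Q ^ i)) ^ s = 1" for i using z(2) by (metis power_commutes power_mult power_one mult.commute)
    then have e: "((z * y) ^ (Q ^ i)) ^ s = (y ^ (Q ^ i)) ^ s" for i by (simp add: power_mult_distrib)
    have "(\<Prod>i<j. (z * y) ^ (Q ^ i)) = (\<Prod>i<j. z ^ (Q ^ i)) * (\<Prod>i<j. y ^ (Q ^ i))"
      by (simp add: power_mult_distrib prod.distrib)
    then show "\<chi> (\<Prod>i<j. (z * y) ^ (Q ^ i)) * \<psi> (\<Sum>i<j. ((z * y) ^ (Q ^ i)) ^ s) =
      \<chi> (\<Prod>i<j. z ^ (Q ^ i)) * (\<chi> (\<Prod>i<j. y ^ (Q ^ i)) * \<psi> (\<Sum>i<j. (y ^ (Q ^ i)) ^ s))"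
      by (simp only: e \<chi>_mult[OF norm_K[OF z(1)] norm_K[OF y]] mult.assoc)
  qed
  also have "\<dots> = \<chi> (\<Prod>i<j. z ^ (Q ^ i)) * S j" by (simp add: S_def sum_distrib_left)
  finally show ?thesis using ne by (metis mult_cancel_right1)
qed

text \<open>The part of \<open>c s\<close> that does not depend on \<open>\<chi>\<close>.\<close>

definition S0 :: complex where
  "S0 = (\<Sum>f\<in>{f\<in>Mon s. coeff f 0 = 0}. \<psi> (\<Sum>y\<in>#proots f. y ^ s))"

lemma prod_roots: "f \<in> Mon n \<Longrightarrow> coeff f 0 = (- 1) ^ n * \<Prod>\<^sub># (proots f)"
proof -
  assume f: "f \<in> Mon n"
  have *: "poly (\<Prod>x\<in>#A. [:- x, 1:]) 0 = (- 1) ^ size A * \<Prod>\<^sub># A" for A :: "'c multiset"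
    by (induction A) auto
  have "coeff f 0 = poly (\<Prod>x\<in>#proots f. [:- x, 1:]) 0"
    using monic_eq_prod_proots[OF MonD(1)[OF f]] by (simp add: poly_0_coeff_0)
  then show ?thesis using size_proots_monic[OF MonD(1)[OF f]] MonD(2)[OF f] by (simp add: *)
qed

text \<open>Every polynomial in \<open>Mon s\<close> is uniquely f - b with f of zero constant
  coefficient. As s is odd, the roots of f - b have product b, and their power sum is that of f plus
  s b. So the summand separates into a part in f and a part in b.\<close>

lemma c_factor:
  assumes s: "odd s"
  shows "c s = S0 * (\<Sum>b\<in>K 1. \<chi> b * \<psi> (of_nat s * b))"
proof -
  have s0: "s > 0" using s by (cases s) auto
  have shift: "f - [:b:] \<in> Mon s" if f: "f \<in> Mon s" and b: "b \<in> K 1" for f b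
  proof -
    have deg: "degree (f - [:b:]) = s"
      using MonD(2)[OF f] s0 by (subst diff_conv_add_uminus, subst degree_add_eq_left) auto
    have "coeff (f - [:b:]) s = 1"
      using MonD(1,2)[OF f] s0 by (auto simp: coeff_pCons split: nat.splits)
    then show ?thesis unfolding Mon_def
      using deg f b by (auto simp: Mon_def coeff_pCons simp del: One_nat_def split: nat.splits)
  qed
  have "S0 * (\<Sum>b\<in>K 1. \<chi> b * \<psi> (of_nat s * b)) =
     (\<Sum>(f,b)\<in>{f\<in>Mon s. coeff f 0 = 0} \<times> K 1. \<psi> (\<Sum>y\<in>#proots f. y ^ s) * (\<chi> b * \<psi> (of_nat s * b)))"
    by (simp add: S0_def sum_product sum.cartesian_product)
  also have "\<dots> = (\<Sum>f\<in>Mon s. lam f)"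
  proof (rule sum.reindex_bij_witness[of _ "\<lambda>f. (f - [:coeff f 0:], - coeff f 0)" "\<lambda>(f,b). f - [:b:]"])
    fix p assume "p \<in> {f\<in>Mon s. coeff f 0 = 0} \<times> K 1"
    then obtain f b where p: "p = (f, b)" and f: "f \<in> Mon s" and b: "b \<in> K 1" and f0: "coeff f 0 = 0"
      by auto
    show "((case p of (f, b) \<Rightarrow> f - [:b:]) - [:coeff (case p of (f, b) \<Rightarrow> f - [:b:]) 0:],
      - coeff (case p of (f, b) \<Rightarrow> f - [:b:]) 0) = p"
      using f0 by (simp add: p)
    have M: "f - [:b:] \<in> Mon s" by (rule shift[OF f b])
    then show "(case p of (f, b) \<Rightarrow> f - [:b:]) \<in> Mon s" by (simp add: p)
    have "\<Prod>\<^sub># (proots (f - [:b:])) = b" using prod_roots[OF M] s f0 by simp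
    moreover have "(\<Sum>y\<in>#proots (f - [:b:]). y ^ s) = (\<Sum>y\<in>#proots f. y ^ s) + of_nat s * b"
      using power_sum_const_coeff[OF MonD(1,2)[OF f] MonD(1,2)[OF M] _ s0] f0
      by (simp add: coeff_pCons diff_eq_eq split: nat.splits)
    ultimately show "lam (case p of (f, b) \<Rightarrow> f - [:b:]) =
      (case p of (f, b) \<Rightarrow> \<psi> (\<Sum>y\<in>#proots f. y ^ s) * (\<chi> b * \<psi> (of_nat s * b)))"
      using power_sum_K[OF f] b by (simp add: p lam_def \<psi>_add del: One_nat_def)
  next
    fix f assume f: "f \<in> Mon s"
    then have k: "coeff f 0 \<in> K 1" by (simp add: Mon_def)
    show "(case (f - [:coeff f 0:], - coeff f 0) of (f, b) \<Rightarrow> f - [:b:]) = f" by simp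
    show "(f - [:coeff f 0:], - coeff f 0) \<in> {f\<in>Mon s. coeff f 0 = 0} \<times> K 1"
      using shift[OF f k] k by simp
  qed
  finally show ?thesis by (simp add: c_def)
qed

text \<open>The involution taking f(X) to -f(-X) negates all roots. For odd s it preserves monic
  polynomials of degree s and negates the power sum, hence conjugates the summand.\<close>

lemma S0_real:
  assumes s: "odd s" and cnj: "\<And>x. x \<in> K 1 \<Longrightarrow> \<psi> (- x) = cnj (\<psi> x)"
  shows "cnj S0 = S0"
proof -
  define r where "r f = - (f \<circ>\<^sub>p [:0, - 1:])" for f :: "'c poly"
  have coeff_r: "coeff (r f) i = (- 1) ^ Suc i * coeff f i" for f i
    by (simp add: r_def coeff_pcompose_linear)
  have rr: "r (r f) = f" for f
    by (rule poly_eqI) (simp add: coeff_r)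
  have rM: "r f \<in> Mon s" if f: "f \<in> Mon s" for f
  proof -
    have "degree (r f) = s" using MonD(2)[OF f] by (simp add: r_def degree_pcompose)
    moreover have "coeff (r f) s = 1" using MonD(1,2)[OF f] s by (simp add: coeff_r)
    moreover have "coeff (r f) i \<in> K 1" for i
    proof -
      have "coeff f i \<in> K 1" using f by (simp add: Mon_def)
      then show ?thesis unfolding coeff_r by (cases "even i") simp_all
    qed
    ultimately show ?thesis by (auto simp: Mon_def)
  qed
  have P: "(\<Sum>y\<in>#proots (r f). y ^ s) = - (\<Sum>y\<in>#proots f. y ^ s)" if f: "f \<in> Mon s" for f
  proof -
    have *: "(\<Prod>x\<in>#A. [:- x, 1:]) \<circ>\<^sub>p [:0, - 1:] = (- 1) ^ size A * (\<Prod>x\<in>#A. [:- (- x), 1:])"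
      for A :: "'c multiset"
    proof (induction A)
      case (add x A)
      have "[:- x, 1:] \<circ>\<^sub>p [:0, - 1:] = - [:- (- x), 1::'c:]" by (simp add: pcompose_pCons)
      then have "(\<Prod>x\<in>#add_mset x A. [:- x, 1:]) \<circ>\<^sub>p [:0, - 1:] =
          - [:- (- x), 1:] * ((- 1) ^ size A * (\<Prod>x\<in>#A. [:- (- x), 1:]))"
        using add by (simp only: image_mset_add_mset prod_mset.add_mset pcompose_mult)
      also have "\<dots> = (- 1) ^ size (add_mset x A) * (\<Prod>x\<in>#add_mset x A. [:- (- x), 1:])"
        by (simp only: image_mset_add_mset prod_mset.add_mset size_add_mset power_Suc
            mult_minus_left mult_minus_right mult_1_left ac_simps)
      finally show ?case .
    qed (simp add: pcompose_1)
    have "size (proots f) = s" using size_proots_monic[OF MonD(1)[OF f]] MonD(2)[OF f] by simp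
    have "r f = - ((\<Prod>x\<in>#proots f. [:- x, 1:]) \<circ>\<^sub>p [:0, - 1:])"
      using monic_eq_prod_proots[OF MonD(1)[OF f]] by (simp add: r_def)
    also have "\<dots> = (\<Prod>x\<in>#proots f. [:- (- x), 1:])"
      unfolding * using \<open>size (proots f) = s\<close> s by simp
    also have "\<dots> = (\<Prod>x\<in>#image_mset uminus (proots f). [:- x, 1:])"
      by (simp add: multiset.map_comp o_def)
    finally have "proots (r f) = image_mset uminus (proots f)" by (metis proots_prod_linear)
    moreover have "(\<Sum>y\<in>#A. - (y ^ s)) = - (\<Sum>y\<in>#A. y ^ s)" for A :: "'c multiset"
      by (induction A) auto
    ultimately show ?thesis using s by (simp add: multiset.map_comp o_def)
  qed
  have "S0 = (\<Sum>f\<in>{f\<in>Mon s. coeff f 0 = 0}. cnj (\<psi> (\<Sum>y\<in>#proots f. y ^ s)))"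
    unfolding S0_def
  proof (rule sum.reindex_bij_witness[of _ r r])
    fix f assume "f \<in> {f\<in>Mon s. coeff f 0 = 0}"
    then have f: "f \<in> Mon s" "coeff f 0 = 0" by auto
    show "r f \<in> {f\<in>Mon s. coeff f 0 = 0}" using rM[OF f(1)] f(2) by (simp add: coeff_r)
    show "cnj (\<psi> (\<Sum>y\<in>#proots (r f). y ^ s)) = \<psi> (\<Sum>y\<in>#proots f. y ^ s)"
      unfolding P[OF f(1)] using cnj[OF power_sum_K[OF f(1), of s]] by simp
  qed (auto simp: rr rM coeff_r)
  then show ?thesis by (simp add: S0_def)
qed

end

section \<open>Gauss sums over finite fields\<close>

definition zeta :: "nat \<Rightarrow> int \<Rightarrow> complex" where "zeta N m = cis (2 * pi * of_int m / of_nat N)"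

lemma zeta_add: "zeta N (a + b) = zeta N a * zeta N b"
  by (simp add: zeta_def cis_mult add_divide_distrib distrib_left)

lemma zeta_0 [simp]: "zeta N 0 = 1"
  by (simp add: zeta_def)

lemma zeta_norm [simp]: "norm (zeta N a) = 1"
  by (simp add: zeta_def)

lemma zeta_neq_0 [simp]: "zeta N a \<noteq> 0"
  by (simp add: zeta_def)

lemma zeta_minus: "zeta N (- a) = cnj (zeta N a)"
  by (simp add: zeta_def cis_cnj)

lemma zeta_power: "zeta N a ^ k = zeta N (a * int k)"
  by (induction k) (auto simp: algebra_simps zeta_add)

lemma zeta_eq_1_iff: "N > 0 \<Longrightarrow> zeta N m = 1 \<longleftrightarrow> int N dvd m"
proof
  assume N: "N > 0" and "zeta N m = 1"
  then have "cos (2 * pi * of_int m / of_nat N) = 1" by (simp add: zeta_def complex_eq_iff)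
  then obtain l :: int where "2 * pi * of_int m / of_nat N = of_int l * 2 * pi"
    using cos_one_2pi_int by auto
  then have "real_of_int m = of_int (l * int N)" using N by (simp add: field_simps)
  then have "m = l * int N" using of_int_eq_iff by blast
  then show "int N dvd m" by simp
next
  assume N: "N > 0" and "int N dvd m"
  then obtain l where "m = int N * l" by (elim dvdE)
  then have "2 * pi * of_int m / of_nat N = 2 * pi * of_int l" using N by simp
  then show "zeta N m = 1" by (simp add: zeta_def cis_multiple_2pi)
qed

lemma zeta_cong: "N > 0 \<Longrightarrow> int N dvd a - b \<Longrightarrow> zeta N a = zeta N b"
  using zeta_eq_1_iff[of N "a - b"] zeta_add[of N "a - b" b] by simp

lemma zeta_cancel: "M > 0 \<Longrightarrow> zeta (N * M) (m * int M) = zeta N m"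
  by (simp add: zeta_def mult.assoc)

lemma zeta_2: "zeta 2 m = (if even m then 1 else - 1)"
proof (cases "even m")
  case True
  then show ?thesis using zeta_eq_1_iff[of 2 m] by simp
next
  case False
  have "zeta 2 1 = -1" by (simp add: zeta_def)
  moreover have "zeta 2 m = zeta 2 1" using False by (intro zeta_cong) auto
  ultimately show ?thesis using False by simp
qed

lemma zeta_sum: "N > 0 \<Longrightarrow> (\<Sum>t<N. zeta N (m * int t)) = (if int N dvd m then of_nat N else 0)"
proof (cases "int N dvd m")
  case True
  assume "N > 0"
  then have "zeta N (m * int t) = 1" for t using True zeta_eq_1_iff by simp
  then show ?thesis using True by simp
next
  case False
  assume N: "N > 0"
  have "(\<Sum>t<N. zeta N (m * int t)) = (\<Sum>t<N. zeta N m ^ t)" by (simp add: zeta_power)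
  moreover have "zeta N m \<noteq> 1" "zeta N m ^ N = 1"
    using False N zeta_eq_1_iff[of N m] zeta_eq_1_iff[of N "m * int N"] by (auto simp: zeta_power)
  ultimately show ?thesis using False by (simp add: geometric_sum)
qed

lemma finite_field_fermat:
  fixes x :: "'a::{field,finite}"
  assumes "x \<noteq> 0"
  shows "x ^ (CARD('a) - 1) = 1"
proof -
  let ?A = "UNIV - {0::'a}"
  have "(\<Prod>y\<in>?A. x * y) = \<Prod>?A"
    by (rule prod.reindex_bij_witness[of _ "\<lambda>y. y / x" "\<lambda>y. x * y"]) (use assms in auto)
  then have "x ^ card ?A * \<Prod>?A = 1 * \<Prod>?A" by (simp add: prod.distrib)
  moreover have "\<Prod>?A \<noteq> 0" by simp
  ultimately have "x ^ card ?A = 1" using mult_right_cancel by blast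
  then show ?thesis by simp
qed

lemma two_le_CARD_field: "CARD('a::{field,finite}) \<ge> 2"
  using card_mono[of UNIV "{0, 1 :: 'a}"] by simp

lemma primitive_element_bij:
  fixes g :: "'a::{field,finite}"
  assumes g: "primitive_element g"
  shows "bij_betw (\<lambda>t. g ^ t) {..<CARD('a) - 1} (UNIV - {0})" "g \<noteq> 0"
proof -
  define n where "n = CARD('a) - 1"
  have "CARD('a) \<ge> 2" by (rule two_le_CARD_field)
  then have n: "n > 0" by (simp add: n_def)
  have r: "range (\<lambda>t::int. g powi t) = UNIV - {0}"
    using g by (simp add: primitive_element_def mult_gen_def)
  show g0: "g \<noteq> 0"
  proof
    assume "g = 0"
    then have "g powi 1 = 0" by simp
    then show False using r by (metis DiffD2 rangeI singletonI)
  qed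
  have gn: "g ^ n = 1" using finite_field_fermat[OF g0] by (simp add: n_def)
  have im: "(\<lambda>t. g ^ t) ` {..<n} = UNIV - {0}"
  proof (intro equalityI subsetI)
    fix x assume "x \<in> UNIV - {0 :: 'a}"
    then obtain t :: int where t: "x = g powi t" using r by blast
    have "g powi t = g powi (int n * (t div int n) + t mod int n)" by simp
    also have "\<dots> = g powi (int n * (t div int n)) * g powi (t mod int n)"
      using g0 by (rule power_int_add[OF disjI1])
    also have "g powi (int n * (t div int n)) = 1"
      using gn by (simp add: power_int_mult)
    also have "g powi (t mod int n) = g ^ nat (t mod int n)"
      using n by (simp add: power_int_def)
    finally have "x = g ^ nat (t mod int n)" using t by simp
    moreover have "nat (t mod int n) < n" using n by (simp add: nat_less_iff)
    ultimately show "x \<in> (\<lambda>t. g ^ t) ` {..<n}" by blast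
  qed (use g0 in auto)
  moreover have "inj_on (\<lambda>t. g ^ t) {..<n}"
    by (rule eq_card_imp_inj_on) (simp_all add: im, simp add: n_def)
  ultimately show "bij_betw (\<lambda>t. g ^ t) {..<CARD('a) - 1} (UNIV - {0})"
    by (simp add: bij_betw_def n_def)
qed

locale primitive =
  fixes g :: "'a::{field,finite}" and n :: nat
  assumes g: "primitive_element g" and n: "n = CARD('a) - 1"
begin

lemma n_pos: "n > 0"
proof -
  have "CARD('a) \<ge> 2" by (rule two_le_CARD_field)
  then show ?thesis by (simp add: n)
qed

lemma g_neq_0 [simp]: "g \<noteq> 0"
  using primitive_element_bij[OF g] by simp

lemma g_n [simp]: "g ^ n = 1"
  using finite_field_fermat[of g] by (simp add: n)

lemma g_power_mod: "g ^ (a mod n) = g ^ a"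
proof -
  have "g ^ a = g ^ (n * (a div n) + a mod n)" by simp
  also have "\<dots> = g ^ (a mod n)" by (simp only: power_add power_mult g_n power_one mult_1)
  finally show ?thesis by simp
qed

lemma g_power_eq_iff: "g ^ a = g ^ b \<longleftrightarrow> a mod n = b mod n"
proof
  assume "g ^ a = g ^ b"
  then have "g ^ (a mod n) = g ^ (b mod n)" by (simp add: g_power_mod)
  then show "a mod n = b mod n"
    using primitive_element_bij(1)[OF g] n_pos by (auto simp: bij_betw_def inj_on_def n)
next
  assume "a mod n = b mod n"
  then show "g ^ a = g ^ b" by (metis g_power_mod)
qed

lemma g_power_eq_1_iff: "g ^ a = 1 \<longleftrightarrow> n dvd a"
  using g_power_eq_iff[of a 0] by (simp add: dvd_eq_mod_eq_0)

lemma ex_g_power: "x \<noteq> 0 \<Longrightarrow> \<exists>t<n. x = g ^ t"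
proof -
  assume "x \<noteq> 0"
  then have "x \<in> (\<lambda>t. g ^ t) ` {..<n}"
    using primitive_element_bij(1)[OF g] by (simp add: bij_betw_def n)
  then show ?thesis by blast
qed

definition dlog :: "'a \<Rightarrow> nat" where "dlog x = (SOME t. g ^ t = x)"

lemma g_dlog: "x \<noteq> 0 \<Longrightarrow> g ^ dlog x = x"
  unfolding dlog_def using ex_g_power by (metis (mono_tags) someI_ex)

lemma sum_nonzero: "(\<Sum>x\<in>UNIV - {0}. F x) = (\<Sum>t<n. F (g ^ t))"
  using sum.reindex_bij_betw[OF primitive_element_bij(1)[OF g], of F] by (simp add: n)

text \<open>The multiplicative character with value \<open>zeta N j\<close> at \<open>g\<close>; the
  choice made in \<open>dlog\<close> is harmless when N divides n. The value at 0 is 0 even for j =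
  0, which gives the trivial Gauss sum the value -1.\<close>

definition mchar :: "nat \<Rightarrow> int \<Rightarrow> 'a \<Rightarrow> complex" where
  "mchar N j x = (if x = 0 then 0 else zeta N (j * int (dlog x)))"

lemma mchar_0 [simp]: "mchar N j 0 = 0"
  by (simp add: mchar_def)

lemma mchar_g_power: "N dvd n \<Longrightarrow> mchar N j (g ^ t) = zeta N (j * int t)"
proof -
  assume N: "N dvd n"
  then have N0: "N > 0" using n_pos dvd_pos_nat by blast
  have "g ^ dlog (g ^ t) = g ^ t" by (simp add: g_dlog)
  then have "dlog (g ^ t) mod n = t mod n" by (simp add: g_power_eq_iff)
  then have "int n dvd int (dlog (g ^ t)) - int t"
    by (metis mod_eq_dvd_iff zmod_int)
  then have "int N dvd int (dlog (g ^ t)) - int t" using N by (meson dvd_trans int_dvd_int_iff)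
  then have "int N dvd j * int (dlog (g ^ t)) - j * int t"
    by (simp add: dvd_mult flip: right_diff_distrib)
  then show ?thesis using N0 by (simp add: mchar_def zeta_cong)
qed

lemma mchar_1 [simp]: "N dvd n \<Longrightarrow> mchar N j 1 = 1"
  using mchar_g_power[of N j 0] by simp

lemma mchar_mult:
  assumes "N dvd n"
  shows "mchar N j (x * y) = mchar N j x * mchar N j y"
proof (cases "x = 0 \<or> y = 0")
  case False
  then obtain a b where "x = g ^ a" "y = g ^ b" using ex_g_power by metis
  then show ?thesis using assms
    by (simp add: mchar_g_power zeta_add distrib_left flip: power_add)
qed auto

lemma norm_mchar: "x \<noteq> 0 \<Longrightarrow> norm (mchar N j x) = 1"
  by (simp add: mchar_def)

lemma mchar_minus: "mchar N (- j) x = cnj (mchar N j x)"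
  by (simp add: mchar_def flip: zeta_minus)

lemma mchar_cong: "N > 0 \<Longrightarrow> int N dvd i - j \<Longrightarrow> mchar N i x = mchar N j x"
proof -
  assume N: "N > 0" "int N dvd i - j"
  then have "int N dvd i * int (dlog x) - j * int (dlog x)"
    by (simp flip: left_diff_distrib)
  then show ?thesis using N by (simp add: mchar_def zeta_cong)
qed

lemma sum_mchar: 
  assumes N: "N dvd n" and j: "\<not> int N dvd j"
  shows "(\<Sum>x\<in>UNIV. mchar N j x) = 0"
proof -
  have N0: "N > 0" using N n_pos dvd_pos_nat by blast
  have "mchar N j g * (\<Sum>x\<in>UNIV. mchar N j x) = (\<Sum>x\<in>UNIV. mchar N j (g * x))"
    using N by (simp add: mchar_mult sum_distrib_left)
  also have "\<dots> = (\<Sum>x\<in>UNIV. mchar N j x)"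
    by (rule sum.reindex_bij_witness[of _ "\<lambda>x. x / g" "\<lambda>x. g * x"]) auto
  finally have "(mchar N j g - 1) * (\<Sum>x\<in>UNIV. mchar N j x) = 0" by (simp add: algebra_simps)
  moreover have "mchar N j g \<noteq> 1"
    using mchar_g_power[OF N, of j 1] zeta_eq_1_iff[OF N0, of j] j by simp
  ultimately show ?thesis by simp
qed

end

locale additive_char =
  fixes \<psi> :: "'a::{field,finite} \<Rightarrow> complex"
  assumes add: "\<psi> (x + y) = \<psi> x * \<psi> y" and at_0 [simp]: "\<psi> 0 = 1"
    and nontriv: "\<exists>x. \<psi> x \<noteq> 1"
begin

lemma \<psi>_of_nat_mult: "\<psi> (of_nat m * x) = \<psi> x ^ m"
  by (induction m) (auto simp: distrib_right add)

lemma norm_\<psi> [simp]: "norm (\<psi> x) = 1"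
proof -
  have "of_nat CARD('a) = (0 :: 'a)" by (simp add: of_nat_eq_0_iff_char_dvd CHAR_dvd_CARD)
  then have "\<psi> x ^ CARD('a) = 1" using \<psi>_of_nat_mult[of "CARD('a)" x] by simp
  then have "norm (\<psi> x) ^ CARD('a) = 1" by (metis norm_one norm_power)
  then show ?thesis using power_eq_1_iff[of "norm (\<psi> x)" "CARD('a)"] by simp
qed

lemma \<psi>_minus: "\<psi> (- x) = cnj (\<psi> x)"
proof -
  have "\<psi> (- x) = \<psi> (- x) * (\<psi> x * cnj (\<psi> x))" by (simp add: complex_norm_square[symmetric])
  also have "\<dots> = \<psi> (- x + x) * cnj (\<psi> x)" by (simp only: add mult.assoc)
  finally show ?thesis by simp
qed

lemma \<psi>_sum: "(\<Sum>x\<in>UNIV. \<psi> (c * x)) = (if c = 0 then of_nat CARD('a) else 0)"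
proof (cases "c = 0")
  case False
  obtain y where y: "\<psi> y \<noteq> 1" using nontriv by blast
  have "(\<Sum>x\<in>UNIV. \<psi> (c * x)) = (\<Sum>x\<in>UNIV. \<psi> x)"
    by (rule sum.reindex_bij_witness[of _ "\<lambda>x. x / c" "\<lambda>x. c * x"]) (use False in auto)
  moreover have "\<psi> y * (\<Sum>x\<in>UNIV. \<psi> x) = (\<Sum>x\<in>UNIV. \<psi> (y + x))"
    by (simp add: sum_distrib_left add)
  moreover have "\<dots> = (\<Sum>x\<in>UNIV. \<psi> x)"
    by (rule sum.reindex_bij_witness[of _ "\<lambda>x. x - y" "\<lambda>x. y + x"]) auto
  ultimately show ?thesis using y False by simp
qed simp

end

locale gauss_sums = primitive g n + additive_char \<psi>
  for g :: "'a::{field,finite}" and n and \<psi> :: "'a \<Rightarrow> complex"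
begin

definition gauss :: "nat \<Rightarrow> int \<Rightarrow> complex" where
  "gauss N j = (\<Sum>x\<in>UNIV. mchar N j x * \<psi> x)"

lemma sum_UNIV_nonzero: "(\<Sum>x\<in>UNIV. F x) = F 0 + (\<Sum>x\<in>UNIV - {0::'a}. F x)" for F :: "'a \<Rightarrow> complex"
  by (rule sum.remove) auto

lemma gauss_altdef: "N dvd n \<Longrightarrow> gauss N j = (\<Sum>t<n. zeta N (j * int t) * \<psi> (g ^ t))"
  by (simp add: gauss_def sum_UNIV_nonzero sum_nonzero mchar_g_power)

lemma gauss_cong: "N > 0 \<Longrightarrow> int N dvd i - j \<Longrightarrow> gauss N i = gauss N j"
  unfolding gauss_def using mchar_cong by simp

lemma gauss_0: "N dvd n \<Longrightarrow> gauss N 0 = - 1"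
proof -
  assume N: "N dvd n"
  have "1 + (\<Sum>t<n. \<psi> (g ^ t)) = 0"
    using \<psi>_sum[of 1] by (simp add: sum_UNIV_nonzero sum_nonzero)
  then have "(\<Sum>t<n. \<psi> (g ^ t)) = - 1" by (simp only: add_eq_0_iff)
  then show ?thesis using N by (simp add: gauss_altdef)
qed

text \<open>Put x = y z in the double sum: the summand becomes \<chi>(z) \<psi>((z - 1) y), and
  summing \<psi> over nonzero y gives |F| - 1 at z = 1 and -1 elsewhere. The terms -\<chi>(z) add up
  to 0 by \<open>sum_mchar\<close>.\<close>

lemma gauss_mult_cnj:
  assumes N: "N dvd n" and j: "\<not> int N dvd j"
  shows "gauss N j * cnj (gauss N j) = of_nat CARD('a)"
proof -
  have nz: "(\<Sum>y\<in>UNIV - {0}. \<psi> (c * y)) = (if c = 0 then of_nat CARD('a) else 0) - 1" for c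
  proof -
    have "1 + (\<Sum>y\<in>UNIV - {0}. \<psi> (c * y)) = (if c = 0 then of_nat CARD('a) else 0)"
      using \<psi>_sum[of c] sum_UNIV_nonzero[of "\<lambda>y. \<psi> (c * y)"] by simp
    then show ?thesis by (simp only: eq_diff_eq add.commute)
  qed
  have "gauss N j * cnj (gauss N j)
      = (\<Sum>y\<in>UNIV. \<Sum>x\<in>UNIV. mchar N j x * \<psi> x * (cnj (mchar N j y) * cnj (\<psi> y)))"
    by (subst sum.swap) (simp add: gauss_def sum_product)
  also have "\<dots> = (\<Sum>y\<in>UNIV - {0}. \<Sum>x\<in>UNIV. mchar N j x * \<psi> x * (cnj (mchar N j y) * cnj (\<psi> y)))"
    by (simp add: sum_UNIV_nonzero)
  also have "\<dots> = (\<Sum>y\<in>UNIV - {0}. \<Sum>z\<in>UNIV. mchar N j z * \<psi> ((z - 1) * y))"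
  proof (rule sum.cong[OF refl])
    fix y :: 'a assume y: "y \<in> UNIV - {0}"
    have "(\<Sum>x\<in>UNIV. mchar N j x * \<psi> x * (cnj (mchar N j y) * cnj (\<psi> y))) =
      (\<Sum>z\<in>UNIV. mchar N j (y * z) * \<psi> (y * z) * (cnj (mchar N j y) * cnj (\<psi> y)))"
      by (rule sum.reindex_bij_witness[of _ "\<lambda>x. y * x" "\<lambda>x. x / y"]) (use y in auto)
    also have "\<dots> = (\<Sum>z\<in>UNIV. mchar N j z * \<psi> ((z - 1) * y))"
    proof (rule sum.cong[OF refl])
      fix z
      have u: "mchar N j y * cnj (mchar N j y) = 1"
        using norm_mchar[of y N j] y by (simp add: complex_norm_square[symmetric])
      have "\<psi> ((z - 1) * y) = \<psi> (y * z + - y)" by (simp add: algebra_simps)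
      also have "\<dots> = \<psi> (y * z) * cnj (\<psi> y)" by (simp only: add \<psi>_minus)
      finally have p: "\<psi> ((z - 1) * y) = \<psi> (y * z) * cnj (\<psi> y)" .
      have "mchar N j (y * z) * \<psi> (y * z) * (cnj (mchar N j y) * cnj (\<psi> y))
        = (mchar N j y * cnj (mchar N j y)) * (mchar N j z * (\<psi> (y * z) * cnj (\<psi> y)))"
        by (simp add: mchar_mult[OF N])
      then show "mchar N j (y * z) * \<psi> (y * z) * (cnj (mchar N j y) * cnj (\<psi> y)) = mchar N j z * \<psi> ((z - 1) * y)"
        by (simp add: u p)
    qed
    finally show "(\<Sum>x\<in>UNIV. mchar N j x * \<psi> x * (cnj (mchar N j y) * cnj (\<psi> y))) =
      (\<Sum>z\<in>UNIV. mchar N j z * \<psi> ((z - 1) * y))" .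
  qed
  also have "\<dots> = (\<Sum>z\<in>UNIV. mchar N j z * (\<Sum>y\<in>UNIV - {0}. \<psi> ((z - 1) * y)))"
    by (subst sum.swap) (simp add: sum_distrib_left)
  also have "\<dots> = (\<Sum>z\<in>UNIV. (if z = 1 then of_nat CARD('a) else 0) - mchar N j z)"
    unfolding nz by (intro sum.cong refl) (auto simp: N)
  also have "\<dots> = of_nat CARD('a)"
    using sum_mchar[OF N j] by (simp add: sum_subtractf)
  finally show ?thesis .
qed

lemma norm_gauss:
  assumes N: "N dvd n" and j: "\<not> int N dvd j"
  shows "norm (gauss N j) ^ 2 = of_nat CARD('a)"
proof -
  have "of_real (norm (gauss N j) ^ 2) = (of_nat CARD('a) :: complex)"
    using gauss_mult_cnj[OF assms] by (simp only: complex_norm_square)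
  then show ?thesis by (metis of_real_of_nat_eq of_real_eq_iff)
qed

text \<open>A character with square 1 equals its conjugate, so conjugating the Gauss sum only
  replaces \<psi>(x) by \<psi>(-x), which costs the factor \<chi>(-1).\<close>

lemma gauss_quadratic:
  assumes N: "N dvd n" and j: "\<not> int N dvd j" and j2: "int N dvd 2 * j"
  shows "gauss N j ^ 2 = mchar N j (- 1) * of_nat CARD('a)"
proof -
  have N0: "N > 0" using N n_pos dvd_pos_nat by blast
  have "cnj (gauss N j) = (\<Sum>x\<in>UNIV. mchar N (- j) x * \<psi> (- x))"
    by (simp add: gauss_def mchar_minus \<psi>_minus)
  also have "\<dots> = (\<Sum>x\<in>UNIV. mchar N j x * \<psi> (- x))"
  proof -
    have "int N dvd - (2 * j)" using j2 by (simp only: dvd_minus_iff)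
    then have "int N dvd - j - j" by (simp only: mult_2 minus_add_distrib diff_conv_add_uminus)
    then have "mchar N (- j) x = mchar N j x" for x using mchar_cong[OF N0] by blast
    then show ?thesis by simp
  qed
  also have "\<dots> = (\<Sum>x\<in>UNIV. mchar N j (- x) * \<psi> x)"
    by (rule sum.reindex_bij_witness[of _ uminus uminus]) auto
  also have "\<dots> = mchar N j (- 1) * gauss N j"
    unfolding gauss_def sum_distrib_left
  proof (intro sum.cong refl)
    fix x :: 'a
    have "mchar N j (- x) = mchar N j (- 1) * mchar N j x" using mchar_mult[OF N, of j "- 1" x] by simp
    then show "mchar N j (- x) * \<psi> x = mchar N j (- 1) * (mchar N j x * \<psi> x)" by (simp only: mult.assoc)
  qed
  finally have c: "cnj (gauss N j) = mchar N j (- 1) * gauss N j" .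
  have "mchar N j (- 1) * mchar N j (- 1) = 1" using mchar_mult[OF N, of j "- 1" "- 1"] N by simp
  then have "gauss N j ^ 2 = mchar N j (- 1) * (gauss N j * cnj (gauss N j))"
    unfolding c by (simp add: power2_eq_square)
  then show ?thesis using gauss_mult_cnj[OF N j] by simp
qed

section \<open>Cyclotomic classes and their character sums\<close>

lemma g_power_in_class:
  assumes N: "N dvd n"
  shows "g ^ t \<in> cyclotomic_class N g i \<longleftrightarrow> int N dvd int t - int i"
proof
  have pint: "g powi l = g ^ nat (l mod int n)" for l
  proof -
    have "g powi l = g powi (int n * (l div int n) + l mod int n)" by simp
    also have "\<dots> = g powi (int n * (l div int n)) * g powi (l mod int n)"
      by (rule power_int_add) simp
    also have "g powi (int n * (l div int n)) = (g powi int n) powi (l div int n)"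
      by (rule power_int_mult)
    also have "g powi int n = 1" by simp
    also have "g powi (l mod int n) = g ^ nat (l mod int n)" using n_pos by (simp add: power_int_def)
    finally show ?thesis by simp
  qed
  assume "g ^ t \<in> cyclotomic_class N g i"
  then obtain l :: int where "g ^ t = g ^ i * (g ^ N) powi l"
    by (auto simp: cyclotomic_class_def mult_gen_def)
  also have "\<dots> = g powi (int i + int N * l)" by (simp add: power_int_add power_int_mult)
  finally have "g powi (int t - (int i + int N * l)) = 1" by (simp add: power_int_diff)
  then have "n dvd nat ((int t - (int i + int N * l)) mod int n)"
    unfolding pint g_power_eq_1_iff .
  then have "int n dvd (int t - (int i + int N * l)) mod int n"
    using n_pos by (metis int_dvd_int_iff nat_0_le pos_mod_sign of_nat_0_less_iff)
  then have "int n dvd int t - (int i + int N * l)" by (simp add: dvd_mod_iff)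
  then have "int N dvd int t - (int i + int N * l)" using N by (meson dvd_trans int_dvd_int_iff)
  then have "int N dvd int t - (int i + int N * l) + int N * l" by (rule dvd_add) simp
  then show "int N dvd int t - int i" by simp
next
  assume "int N dvd int t - int i"
  then obtain l where "int t - int i = int N * l" by (elim dvdE)
  then have l: "int t = int i + int N * l" by simp
  have "g ^ t = g powi int t" by simp
  also have "\<dots> = g ^ i * (g ^ N) powi l" unfolding l by (simp add: power_int_add power_int_mult)
  finally show "g ^ t \<in> cyclotomic_class N g i"
    unfolding cyclotomic_class_def mult_gen_def by blast
qed

lemma zero_not_in_class [simp]: "0 \<notin> cyclotomic_class N g i"
  by (auto simp: cyclotomic_class_def mult_gen_def)

lemma class_disjoint:
  assumes "N dvd n" "x \<in> cyclotomic_class N g i" "x \<in> cyclotomic_class N g i'"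
  shows "int N dvd int i - int i'"
proof -
  have "x \<noteq> 0" using assms(2) by (metis zero_not_in_class)
  then obtain t where "x = g ^ t" using ex_g_power by blast
  then have "int N dvd int t - int i" "int N dvd int t - int i'"
    using assms g_power_in_class by auto
  then have "int N dvd (int t - int i') - (int t - int i)" by (rule dvd_diff[rotated])
  then show ?thesis by simp
qed

text \<open>Orthogonality: the average over j of \<chi>^j(x) zeta^(-ij) is the indicator function of
  the class. \<open>F\<close> is general so that F = 1 also yields the cardinality.\<close>

lemma class_sum:
  assumes N: "N dvd n"
  shows "(\<Sum>x\<in>cyclotomic_class N g i. F x) =
    (\<Sum>j<N. zeta N (- (int j * int i)) * (\<Sum>x\<in>UNIV. mchar N (int j) x * F x)) / of_nat N"
proof -
  have N0: "N > 0" using N n_pos dvd_pos_nat by blast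
  have "(\<Sum>j<N. zeta N (- (int j * int i)) * (\<Sum>x\<in>UNIV. mchar N (int j) x * F x)) =
     (\<Sum>x\<in>UNIV. (\<Sum>j<N. zeta N (- (int j * int i)) * mchar N (int j) x) * F x)"
    unfolding sum_distrib_left sum_distrib_right by (subst sum.swap) (simp add: mult.assoc)
  also have "\<dots> = (\<Sum>x\<in>UNIV. if x \<in> cyclotomic_class N g i then of_nat N * F x else 0)"
  proof (rule sum.cong[OF refl])
    fix x
    show "(\<Sum>j<N. zeta N (- (int j * int i)) * mchar N (int j) x) * F x =
      (if x \<in> cyclotomic_class N g i then of_nat N * F x else 0)"
    proof (cases "x = 0")
      case False
      then obtain t where t: "x = g ^ t" using ex_g_power by blast
      have "(\<Sum>j<N. zeta N (- (int j * int i)) * mchar N (int j) x) = (\<Sum>j<N. zeta N ((int t - int i) * int j))"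
        unfolding t mchar_g_power[OF N] zeta_add[symmetric] by (simp add: algebra_simps)
      then show ?thesis using zeta_sum[OF N0] g_power_in_class[OF N] t by simp
    qed simp
  qed
  also have "\<dots> = of_nat N * (\<Sum>x\<in>cyclotomic_class N g i. F x)"
    by (simp add: sum.If_cases sum_distrib_left)
  finally show ?thesis using N0 by simp
qed

lemma class_char_sum:
  assumes N: "N dvd n"
  shows "(\<Sum>x\<in>cyclotomic_class N g i. \<psi> (g ^ a * x)) =
    (\<Sum>j<N. gauss N (int j) * zeta N (- (int j * (int a + int i)))) / of_nat N"
proof -
  have "(\<Sum>x\<in>UNIV. mchar N j x * \<psi> (g ^ a * x)) = gauss N j * zeta N (- (j * int a))" for j
  proof -
    have "(\<Sum>x\<in>UNIV. mchar N j x * \<psi> (g ^ a * x)) =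
       (\<Sum>x\<in>UNIV. mchar N j (g ^ a * x) * zeta N (- (j * int a)) * \<psi> (g ^ a * x))"
      using zeta_add[of N "- (j * int a)" "j * int a"]
      by (simp add: mchar_mult[OF N] mchar_g_power[OF N] mult_ac)
    also have "\<dots> = (\<Sum>x\<in>UNIV. mchar N j x * zeta N (- (j * int a)) * \<psi> x)"
      by (rule sum.reindex_bij_witness[of _ "\<lambda>x. x / g ^ a" "\<lambda>x. g ^ a * x"]) auto
    finally show ?thesis by (simp add: gauss_def sum_distrib_left mult_ac)
  qed
  then show ?thesis unfolding class_sum[OF N]
    by (simp add: zeta_add[symmetric] algebra_simps)
qed

lemma card_class:
  assumes N: "N dvd n"
  shows "N * card (cyclotomic_class N g i) = n"
proof -
  have N0: "N > 0" using N n_pos dvd_pos_nat by blast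
  have "(\<Sum>j<N. zeta N (- (int j * int i)) * (\<Sum>x\<in>UNIV. mchar N (int j) x)) =
     (\<Sum>j<N. if j = 0 then (\<Sum>x\<in>UNIV. mchar N 0 x) else 0)"
  proof (intro sum.cong refl)
    fix j assume "j \<in> {..<N}"
    then have "\<not> int N dvd int j" if "j \<noteq> 0" using that by (auto dest: dvd_imp_le)
    then show "zeta N (- (int j * int i)) * (\<Sum>x\<in>UNIV. mchar N (int j) x) =
      (if j = 0 then (\<Sum>x\<in>UNIV. mchar N 0 x) else 0)"
      using sum_mchar[OF N, of "int j"] by auto
  qed
  also have "\<dots> = of_nat n" using N0 by (simp add: sum_UNIV_nonzero sum_nonzero mchar_g_power[OF N])
  finally have "of_nat (card (cyclotomic_class N g i)) = (of_nat n / of_nat N :: complex)"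
    using class_sum[OF N, where i = i and F = "\<lambda>_. 1"] by simp
  then have "of_nat (N * card (cyclotomic_class N g i)) = (of_nat n :: complex)" using N0 by (simp add: field_simps)
  then show ?thesis by (simp only: of_nat_eq_iff)
qed

lemma union_class_sum:
  assumes N: "N dvd n" and I: "finite I" "inj_on (\<lambda>i. i mod N) I"
  shows "(\<Sum>x\<in>(\<Union>i\<in>I. cyclotomic_class N g i). F x) = (\<Sum>i\<in>I. \<Sum>x\<in>cyclotomic_class N g i. F x)"
proof (rule sum.UNION_disjoint)
  show "\<forall>i\<in>I. \<forall>j\<in>I. i \<noteq> j \<longrightarrow> cyclotomic_class N g i \<inter> cyclotomic_class N g j = {}"
  proof (intro ballI impI)
    fix i j assume ij: "i \<in> I" "j \<in> I" "i \<noteq> j"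
    then have "i mod N \<noteq> j mod N" using I by (auto simp: inj_on_def)
    then have "\<not> int N dvd int i - int j" by (metis mod_eq_dvd_iff of_nat_eq_iff zmod_int)
    then show "cyclotomic_class N g i \<inter> cyclotomic_class N g j = {}"
      using class_disjoint[OF N] by blast
  qed
qed (use I in auto)

end

section \<open>Difference sets and the Fourier transform\<close>

lemma complete_square: "((z :: complex) + 1 / 2) ^ 2 = z ^ 2 + z + 1 / 4"
  by (simp only: power2_sum) (simp add: power_divide)

context additive_char
begin

definition hat :: "'a set \<Rightarrow> 'a \<Rightarrow> complex" where "hat D c = (\<Sum>x\<in>D. \<psi> (c * x))"

definition diff_count :: "'a set \<Rightarrow> 'a \<Rightarrow> nat" where
  "diff_count D d = card {(x, y). x \<in> D \<and> y \<in> D \<and> x - y = d}"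

text \<open>Fourier inversion at y, where only frequency 0 survives.\<close>

lemma fourier_const:
  assumes "\<And>c. c \<noteq> 0 \<Longrightarrow> (\<Sum>x\<in>UNIV. F x * \<psi> (c * x)) = 0"
  shows "F y * of_nat CARD('a) = (\<Sum>x\<in>UNIV. F x)"
proof -
  have "F y * of_nat CARD('a) = (\<Sum>x\<in>UNIV. F x * (\<Sum>c\<in>UNIV. \<psi> ((x - y) * c)))"
    unfolding \<psi>_sum by (simp add: if_distrib cong: if_cong)
  also have "\<dots> = (\<Sum>c\<in>UNIV. \<Sum>x\<in>UNIV. F x * \<psi> ((x - y) * c))"
    by (subst sum.swap) (simp add: sum_distrib_left)
  also have "\<dots> = (\<Sum>c\<in>UNIV. \<psi> (- (y * c)) * (\<Sum>x\<in>UNIV. F x * \<psi> (c * x)))"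
  proof (rule sum.cong[OF refl])
    fix c
    have "\<psi> ((x - y) * c) = \<psi> (- (y * c)) * \<psi> (c * x)" for x
      using add[of "- (y * c)" "c * x"] by (simp add: algebra_simps)
    then show "(\<Sum>x\<in>UNIV. F x * \<psi> ((x - y) * c)) = \<psi> (- (y * c)) * (\<Sum>x\<in>UNIV. F x * \<psi> (c * x))"
      by (simp add: sum_distrib_left mult_ac)
  qed
  also have "\<dots> = (\<Sum>c\<in>(UNIV :: 'a set). if c = 0 then (\<Sum>x\<in>UNIV. F x) else 0)"
    by (intro sum.cong refl) (auto simp: assms)
  finally show ?thesis by simp
qed

lemma sum_ind: "(\<Sum>x\<in>UNIV. of_bool (x \<in> D) * \<psi> (c * x)) = hat D c"
  by (simp add: hat_def of_bool_def if_distrib[where f = "\<lambda>x. x * _"] sum.If_cases cong: if_cong)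

lemma sum_ind_minus: "(\<Sum>x\<in>UNIV. of_bool (- x \<in> D) * \<psi> (c * x)) = cnj (hat D c)"
proof -
  have "(\<Sum>x\<in>UNIV. of_bool (- x \<in> D) * \<psi> (c * x)) = (\<Sum>x\<in>UNIV. of_bool (x \<in> D) * \<psi> (- (c * x)))"
    by (rule sum.reindex_bij_witness[of _ uminus uminus]) auto
  also have "\<dots> = cnj (\<Sum>x\<in>UNIV. of_bool (x \<in> D) * \<psi> (c * x))"
    by (simp add: \<psi>_minus of_bool_def if_distrib[of cnj] cong: if_cong)
  finally show ?thesis by (simp add: sum_ind)
qed

lemma sum_ind_0: "(\<Sum>x\<in>UNIV. of_bool (x = 0) * \<psi> (c * x)) = 1"
proof -
  have "(\<Sum>x\<in>UNIV. of_bool (x = 0) * \<psi> (c * x)) = (\<Sum>x\<in>(UNIV :: 'a set). if x = 0 then 1 else 0)"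
    by (intro sum.cong) auto
  then show ?thesis by simp
qed

lemma diff_count_0: "diff_count D 0 = card D"
proof -
  have "{(x, y). x \<in> D \<and> y \<in> D \<and> x - y = 0} = (\<lambda>x. (x, x)) ` D" by auto
  then show ?thesis by (simp add: diff_count_def card_image inj_on_def)
qed

text \<open>The difference count is the autocorrelation of the indicator function, so its transform
  is the squared modulus of \<open>hat\<close>.\<close>

lemma sum_diff_count: "(\<Sum>d\<in>UNIV. of_nat (diff_count D d) * \<psi> (c * d)) = hat D c * cnj (hat D c)"
proof -
  have "(\<Sum>d\<in>UNIV. of_nat (diff_count D d) * \<psi> (c * d)) =
    (\<Sum>d\<in>UNIV. \<Sum>p\<in>{p \<in> D \<times> D. fst p - snd p = d}. \<psi> (c * (fst p - snd p)))"
  proof (rule sum.cong[OF refl])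
    fix d
    have "{(x, y). x \<in> D \<and> y \<in> D \<and> x - y = d} = {p \<in> D \<times> D. fst p - snd p = d}" by auto
    then show "of_nat (diff_count D d) * \<psi> (c * d) =
      (\<Sum>p\<in>{p \<in> D \<times> D. fst p - snd p = d}. \<psi> (c * (fst p - snd p)))"
      by (simp add: diff_count_def)
  qed
  also have "\<dots> = (\<Sum>p\<in>D \<times> D. \<psi> (c * (fst p - snd p)))"
    by (rule sum.group) auto
  also have "\<dots> = (\<Sum>x\<in>D. \<Sum>y\<in>D. \<psi> (c * x) * cnj (\<psi> (c * y)))"
  proof -
    have "\<psi> (c * (x - y)) = \<psi> (c * x) * cnj (\<psi> (c * y))" for x y
      using add[of "c * x" "- (c * y)"] by (simp add: \<psi>_minus algebra_simps)
    then show ?thesis by (simp add: sum.cartesian_product case_prod_beta)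
  qed
  also have "\<dots> = hat D c * cnj (hat D c)" by (simp add: hat_def sum_product)
  finally show ?thesis .
qed

lemma hat_0: "hat D 0 = of_nat (card D)"
  by (simp add: hat_def)

lemma skew_imp_card:
  fixes D :: "'a set"
  assumes "skew_hadamard_difference_set D"
  shows "2 * card D + 1 = CARD('a)"
proof -
  from assms have *: "D \<inter> uminus ` D = {}" "0 \<notin> D" "0 \<notin> uminus ` D" "D \<union> uminus ` D \<union> {0} = UNIV"
    by (auto simp: skew_hadamard_difference_set_def)
  have "CARD('a) = card (D \<union> uminus ` D \<union> {0})" using * by simp
  also have "\<dots> = card (D \<union> uminus ` D) + 1" using * by (subst card_Un_disjoint) auto
  also have "card (D \<union> uminus ` D) = card D + card (uminus ` D)" using * by (subst card_Un_disjoint) auto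
  also have "card (uminus ` D) = card D" by (intro card_image) auto
  finally show ?thesis by simp
qed

text \<open>The partition of the field makes \<open>hat D c\<close> + 1/2 purely imaginary, and the
  constant difference count l gives \<open>hat\<close> the squared modulus |D| - l. Frequency 0
  yields |D| = 2l + 1, hence |F| = 4l + 3 and the value -|F|/4.\<close>

lemma skew_imp_hat:
  assumes D: "skew_hadamard_difference_set D" and c: "c \<noteq> 0"
  shows "(hat D c + 1 / 2) ^ 2 = - of_nat CARD('a) / 4"
proof -
  have card: "2 * card D + 1 = CARD('a)" by (rule skew_imp_card[OF D])
  from D have *: "D \<inter> uminus ` D = {}" "0 \<notin> D" "0 \<notin> uminus ` D" "D \<union> uminus ` D \<union> {0} = UNIV"
    by (auto simp: skew_hadamard_difference_set_def)
  from D obtain l where l: "\<And>d. d \<noteq> 0 \<Longrightarrow> diff_count D d = l"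
    by (auto simp: skew_hadamard_difference_set_def difference_set_def diff_count_def)
  have l': "of_nat (diff_count D d) = (of_nat l + of_bool (d = 0) * (of_nat (card D) - of_nat l) :: complex)" for d
    by (cases "d = 0") (auto simp: l diff_count_0)
  have one: "of_bool (x \<in> D) + of_bool (- x \<in> D) + of_bool (x = 0) = (1 :: complex)" for x
  proof -
    have "x \<in> uminus ` D \<longleftrightarrow> - x \<in> D" by (metis image_iff minus_minus)
    then have "x \<in> D \<or> - x \<in> D \<or> x = 0" "\<not> (x \<in> D \<and> - x \<in> D)" "x = 0 \<longrightarrow> x \<notin> D \<and> - x \<notin> D"
      using * by auto
    then show ?thesis by auto
  qed
  have "hat D c + cnj (hat D c) + 1 =
    (\<Sum>x\<in>UNIV. (of_bool (x \<in> D) + of_bool (- x \<in> D) + of_bool (x = 0)) * \<psi> (c * x))"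
    unfolding distrib_right sum.distrib sum_ind sum_ind_minus sum_ind_0 by simp
  also have "\<dots> = 0" unfolding one using c by (simp add: \<psi>_sum)
  finally have re: "hat D c + cnj (hat D c) + 1 = 0" .
  have "hat D c' * cnj (hat D c') = of_nat l * (\<Sum>d\<in>UNIV. \<psi> (c' * d)) + (of_nat (card D) - of_nat l)" for c'
  proof -
    have "hat D c' * cnj (hat D c') = (\<Sum>d\<in>UNIV. of_nat l * \<psi> (c' * d) +
        (of_nat (card D) - of_nat l) * (of_bool (d = 0) * \<psi> (c' * d)))"
      unfolding sum_diff_count[symmetric] l' by (simp add: algebra_simps)
    also have "\<dots> = of_nat l * (\<Sum>d\<in>UNIV. \<psi> (c' * d)) + (of_nat (card D) - of_nat l)"
      by (simp only: sum.distrib sum_distrib_left[symmetric] sum_ind_0 mult_1_right)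
    finally show ?thesis .
  qed
  note sq = this
  have n: "hat D c * cnj (hat D c) = of_nat (card D) - of_nat l" using sq[of c] c by (simp add: \<psi>_sum)
  have "of_nat (card D) * of_nat (card D) = of_nat l * of_nat CARD('a) + (of_nat (card D) - of_nat l :: complex)"
    using sq[of 0] by (simp add: hat_0)
  then have "of_nat (card D * card D + l) = (of_nat (l * CARD('a) + card D) :: complex)" by simp
  then have "card D * card D + l = l * (2 * card D + 1) + card D"
    unfolding card of_nat_eq_iff .
  then have cc: "card D * card D = card D * (2 * l + 1)" by (simp add: algebra_simps)
  have "CARD('a) \<ge> 2" by (rule two_le_CARD_field)
  then have "card D \<noteq> 0" using card by auto
  then have cl: "card D = 2 * l + 1" using cc mult_left_cancel by blast
  have h2: "cnj (hat D c) = - 1 - hat D c" using re by (simp add: algebra_simps eq_neg_iff_add_eq_0)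
  have "hat D c ^ 2 + hat D c = - (of_nat (card D) - of_nat l)"
    using n unfolding h2 by (simp add: power2_eq_square algebra_simps)
  moreover have "of_nat CARD('a) = (4 * of_nat l + 3 :: complex)" unfolding card[symmetric] cl by simp
  ultimately show ?thesis unfolding complete_square using cl by simp
qed

text \<open>A negative real square forces \<open>hat D c\<close> + 1/2 to be purely imaginary, so
  the partition condition and the constancy of the difference count both hold on the Fourier side
  and follow by inversion.\<close>

lemma hat_imp_skew:
  assumes card: "2 * card D + 1 = CARD('a)"
    and h: "\<And>c. c \<noteq> 0 \<Longrightarrow> (hat D c + 1 / 2) ^ 2 = - of_nat CARD('a) / 4"
  shows "skew_hadamard_difference_set D"
proof -
  have re: "cnj (hat D c) = - 1 - hat D c" if "c \<noteq> 0" for c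
  proof -
    define z where "z = hat D c + 1 / 2"
    have "z ^ 2 = of_real (- real CARD('a) / 4)" using h[OF that] by (simp add: z_def)
    then have "Re z ^ 2 - Im z ^ 2 = - real CARD('a) / 4" "Re z * Im z = 0"
      by (auto simp: complex_eq_iff power2_eq_square)
    moreover have "Re z = 0" if "Im z = 0"
    proof -
      have "Re z ^ 2 \<le> 0" using calculation(1) of_nat_0_le_iff[of "CARD('a)", where 'a = real] unfolding that power_zero_numeral by linarith
      then show ?thesis by (simp add: power2_less_eq_zero_iff)
    qed
    ultimately have "Re z = 0" by auto
    then show ?thesis by (simp add: z_def complex_eq_iff)
  qed
  have F: "of_bool (x \<in> D) + of_bool (- x \<in> D) + of_bool (x = 0) = (1 :: complex)" for x
  proof -
    define F where "F = (\<lambda>x. of_bool (x \<in> D) + of_bool (- x \<in> D) + of_bool (x = 0) :: complex)"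
    have hF: "(\<Sum>x\<in>UNIV. F x * \<psi> (c * x)) = hat D c + cnj (hat D c) + 1" for c
      unfolding F_def distrib_right sum.distrib sum_ind sum_ind_minus sum_ind_0 ..
    have "F x * of_nat CARD('a) = (\<Sum>x\<in>UNIV. F x)"
      by (rule fourier_const) (simp add: hF re)
    also have "\<dots> = of_nat (2 * card D + 1)" using hF[of 0] by (simp add: hat_0)
    finally show ?thesis unfolding card by (simp add: F_def)
  qed
  have ex: "x \<in> D \<or> - x \<in> D \<or> x = 0" "\<not> (x \<in> D \<and> - x \<in> D)" "x = 0 \<longrightarrow> x \<notin> D \<and> - x \<notin> D" for x
    using F[of x] by (auto split: if_splits simp: of_bool_def)
  have img: "x \<in> uminus ` D \<longleftrightarrow> - x \<in> D" for x by (metis image_iff minus_minus)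
  have "difference_set D"
  proof -
    \<comment> \<open>(|F| + 1)/4 is the squared modulus of \<open>hat D c\<close> for every nonzero
      c; subtracting it at d = 0 leaves a function without nonzero frequencies.\<close>
    define m where "m = (of_nat CARD('a) + 1 :: complex) / 4"
    define F where "F d = of_nat (diff_count D d) - of_bool (d = 0) * m" for d
    have "(\<Sum>d\<in>UNIV. F d * \<psi> (c * d)) = 0" if c: "c \<noteq> 0" for c
    proof -
      have "(\<Sum>d\<in>UNIV. F d * \<psi> (c * d)) = hat D c * cnj (hat D c) - m * 1"
        unfolding sum_ind_0[of c, symmetric] sum_diff_count[symmetric] sum_distrib_left sum_subtractf[symmetric]
        by (simp add: F_def algebra_simps)
      also have "hat D c * cnj (hat D c) = - ((hat D c + 1 / 2) ^ 2) + 1 / 4"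
        unfolding re[OF c] complete_square by (simp add: power2_eq_square algebra_simps)
      finally show ?thesis unfolding h[OF c] by (simp add: m_def field_simps)
    qed
    then have "F d * of_nat CARD('a) = F d' * of_nat CARD('a)" for d d'
      using fourier_const[of F] by metis
    then have "F d = F d'" for d d' by simp
    then have "F d = F 1" for d by blast
    then have "diff_count D d = diff_count D 1" if "d \<noteq> 0" for d
    proof -
      have "F d = F 1" by fact
      then have "of_nat (diff_count D d) = (of_nat (diff_count D 1) :: complex)"
        using that by (simp add: F_def)
      then show ?thesis by (simp only: of_nat_eq_iff)
    qed
    then show ?thesis unfolding difference_set_def diff_count_def by blast
  qed
  moreover have "D \<inter> uminus ` D = {}" using ex(2) by (auto simp: img)
  moreover have "0 \<notin> D" "0 \<notin> uminus ` D" using ex(3)[of 0] by (auto simp: img)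
  moreover have "x \<in> D \<union> uminus ` D \<union> {0}" for x using ex(1)[of x] by (simp add: img) blast
  ultimately show ?thesis
    unfolding skew_hadamard_difference_set_def by blast
qed

lemma diff_count_adj: "card {z. cayley_adj D x z \<and> cayley_adj D y z} = diff_count D (x - y)"
  unfolding diff_count_def cayley_adj_def
  by (rule bij_betw_same_card[of "\<lambda>z. (x - z, y - z)"],
      rule bij_betw_byWitness[of _ "\<lambda>p. x - fst p"]) (auto simp: algebra_simps)

lemma card_adj: "card {z. cayley_adj D x z} = card D"
  unfolding cayley_adj_def
  by (rule bij_betw_same_card[of "\<lambda>z. x - z"], rule bij_betw_byWitness[of _ "\<lambda>p. x - p"]) auto

lemma paley_imp_card: "paley_type_pds (D :: 'a set) \<Longrightarrow> 2 * card D + 1 = CARD('a)"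
  by (auto simp: paley_type_pds_def strongly_regular_def card_adj)

lemma paley_imp_mod: "paley_type_pds (D :: 'a set) \<Longrightarrow> CARD('a) mod 4 = 1"
proof -
  assume "paley_type_pds D"
  then obtain m where "4 * m + 1 = CARD('a)" by (auto simp: paley_type_pds_def)
  then show ?thesis by presburger
qed

text \<open>Symmetry makes the transform real. With k = 2m and l = m - 1 the difference count is m -
  [d in D] + m [d = 0], whose transform gives hat^2 + hat = m; here |F| = 4m + 1.\<close>

lemma paley_imp_hat:
  assumes D: "paley_type_pds D" and c: "c \<noteq> 0"
  shows "(hat D c + 1 / 2) ^ 2 = of_nat CARD('a) / 4"
proof -
  from D obtain k l m where *: "0 \<notin> D" "uminus ` D = D" "strongly_regular (cayley_adj D) CARD('a) k l m"
    "2 * k + 1 = CARD('a)" "4 * l + 5 = CARD('a)" "4 * m + 1 = CARD('a)"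
    by (auto simp: paley_type_pds_def)
  then have m: "m = l + 1" "k = 2 * m" by auto
  have k: "k = card D" using * by (auto simp: strongly_regular_def card_adj)
  have R: "diff_count D d = (if d = 0 then k else if d \<in> D then l else m)" for d
  proof -
    have "cayley_adj D d 0 \<longleftrightarrow> d \<in> D" by (simp add: cayley_adj_def)
    then show ?thesis
      using *(3) diff_count_adj[of D d 0] diff_count_0[of D] k
      by (auto simp: strongly_regular_def)
  qed
  have R': "of_nat (diff_count D d) = (of_nat m - of_bool (d \<in> D) + of_bool (d = 0) * of_nat m :: complex)" for d
    using *(1) m by (auto simp: R)
  have img: "- x \<in> D \<longleftrightarrow> x \<in> D" for x using *(2) by (metis image_iff minus_minus)
  have real: "cnj (hat D c) = hat D c"
    using sum_ind_minus[of D c] sum_ind[of D c] by (simp only: img)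
  have "hat D c * cnj (hat D c) = (\<Sum>d\<in>UNIV. of_nat m * \<psi> (c * d) - of_bool (d \<in> D) * \<psi> (c * d)
      + of_nat m * (of_bool (d = 0) * \<psi> (c * d)))"
    unfolding sum_diff_count[symmetric] R' by (simp add: algebra_simps)
  also have "\<dots> = - hat D c + of_nat m"
    using c by (simp only: sum.distrib sum_subtractf sum_distrib_left[symmetric] sum_ind_0 sum_ind \<psi>_sum) simp
  finally have "hat D c ^ 2 + hat D c = of_nat m" unfolding real by (simp add: power2_eq_square)
  moreover have "of_nat CARD('a) = (4 * of_nat m + 1 :: complex)" unfolding *(6)[symmetric] by simp
  ultimately show ?thesis unfolding complete_square by simp
qed

text \<open>A positive square forces the transform to be real, hence D symmetric. The congruence
  modulo 4 supplies natural numbers as parameters.\<close>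

lemma hat_imp_paley:
  assumes card: "2 * card D + 1 = CARD('a)" and mod: "CARD('a) mod 4 = 1" and D0: "0 \<notin> D"
    and h: "\<And>c. c \<noteq> 0 \<Longrightarrow> (hat D c + 1 / 2) ^ 2 = of_nat CARD('a) / 4"
  shows "paley_type_pds D"
proof -
  have "CARD('a) \<ge> 2" by (rule two_le_CARD_field)
  with mod have "\<exists>m. CARD('a) = 4 * m + 5" by presburger
  then obtain l where l: "CARD('a) = 4 * l + 5" by blast
  define m where "m = l + 1"
  have k: "card D = 2 * m" using card l by (simp add: m_def)
  have re: "cnj (hat D c) = hat D c" if "c \<noteq> 0" for c
  proof -
    define z where "z = hat D c + 1 / 2"
    have "z ^ 2 = of_real (real CARD('a) / 4)" using h[OF that] by (simp add: z_def)
    then have "Re z ^ 2 - Im z ^ 2 = real CARD('a) / 4" "Re z * Im z = 0"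
      by (auto simp: complex_eq_iff power2_eq_square)
    moreover have "Im z = 0" if "Re z = 0"
    proof -
      have "Im z ^ 2 \<le> 0" using calculation(1) of_nat_0_le_iff[of "CARD('a)", where 'a = real] unfolding that power_zero_numeral by linarith
      then show ?thesis by (simp add: power2_less_eq_zero_iff)
    qed
    ultimately have "Im z = 0" by auto
    then show ?thesis by (simp add: z_def complex_eq_iff)
  qed
  have F: "of_bool (x \<in> D) = (of_bool (- x \<in> D) :: complex)" for x
  proof -
    define F where "F = (\<lambda>x. of_bool (x \<in> D) - of_bool (- x \<in> D) :: complex)"
    have hF: "(\<Sum>x\<in>UNIV. F x * \<psi> (c * x)) = hat D c - cnj (hat D c)" for c
      unfolding F_def left_diff_distrib sum_subtractf sum_ind sum_ind_minus ..
    have "F x * of_nat CARD('a) = (\<Sum>x\<in>UNIV. F x)"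
      by (rule fourier_const) (simp add: hF re)
    also have "\<dots> = 0" using hF[of 0] by (simp add: hat_0)
    finally show ?thesis by (simp add: F_def)
  qed
  have sym: "- x \<in> D \<longleftrightarrow> x \<in> D" for x using F[of x] by (auto simp: of_bool_def split: if_splits)
  then have img: "uminus ` D = D" by (auto simp: image_iff) (metis minus_minus)
  \<comment> \<open>Chosen to be constant with value m: at 0 the count should be |D| = 2m, on D it
    should be m - 1, elsewhere m.\<close>
  define F where "F d = of_nat (diff_count D d) + of_bool (d \<in> D) - of_bool (d = 0) * (of_nat m :: complex)" for d
  have hF: "(\<Sum>d\<in>UNIV. F d * \<psi> (c * d)) = hat D c * cnj (hat D c) + hat D c - of_nat m * 1" for c
  proof -
    have "F d * \<psi> (c * d) = of_nat (diff_count D d) * \<psi> (c * d) + of_bool (d \<in> D) * \<psi> (c * d)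
        - of_nat m * (of_bool (d = 0) * \<psi> (c * d))" for d
      by (simp add: F_def algebra_simps)
    then show ?thesis
      by (simp only: sum.distrib sum_subtractf sum_distrib_left[symmetric] sum_ind_0 sum_ind sum_diff_count)
  qed
  have Fsum: "F d * of_nat CARD('a) = (\<Sum>x\<in>UNIV. F x)" for d
  proof (rule fourier_const)
    fix c :: 'a assume c: "c \<noteq> 0"
    have "hat D c * cnj (hat D c) + hat D c - of_nat m * 1 = (hat D c + 1 / 2) ^ 2 - 1 / 4 - of_nat m"
      unfolding re[OF c] complete_square by (simp only: power2_eq_square mult_1_right add_diff_cancel_right')
    then show "(\<Sum>x\<in>UNIV. F x * \<psi> (c * x)) = 0"
      unfolding hF h[OF c] by (simp add: l m_def add_divide_distrib)
  qed
  have "(\<Sum>x\<in>UNIV. F x) = of_nat m * of_nat CARD('a)"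
    using hF[of 0] by (simp add: hat_0 k l m_def algebra_simps)
  then have Fm: "F d = of_nat m" for d using Fsum[of d] by simp
  then have R: "of_nat (diff_count D d) + of_bool (d \<in> D) = (of_nat m :: complex)" if "d \<noteq> 0" for d
  proof -
    have "F d = of_nat (diff_count D d) + of_bool (d \<in> D)" using that by (simp add: F_def)
    then show ?thesis using Fm[of d] by simp
  qed
  have R1: "diff_count D d = l" if "d \<in> D" for d
  proof -
    have "of_nat (diff_count D d) = (of_nat l :: complex)" using R[of d] that D0 by (auto simp: m_def)
    then show ?thesis by (simp only: of_nat_eq_iff)
  qed
  have R2: "diff_count D d = m" if "d \<notin> D" "d \<noteq> 0" for d
  proof -
    have "of_nat (diff_count D d) = (of_nat m :: complex)" using R[of d] that by auto
    then show ?thesis by (simp only: of_nat_eq_iff)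
  qed
  have "card D > 0" using k by (simp add: m_def)
  then obtain a where a: "a \<in> D" by (auto simp: card_gt_0_iff)
  have "\<exists>b. b \<noteq> 0 \<and> b \<notin> D"
  proof (rule ccontr)
    assume "\<not> ?thesis"
    then have "D = UNIV - {0}" using D0 by auto
    then have "card D = CARD('a) - 1" by simp
    then show False using k l by (simp add: m_def)
  qed
  then obtain b where b: "b \<noteq> 0" "b \<notin> D" by blast
  have "strongly_regular (cayley_adj D) CARD('a) (card D) l m"
    unfolding strongly_regular_def
  proof (intro conjI allI impI refl)
    show "\<not> cayley_adj D x x" for x using D0 by (simp add: cayley_adj_def)
    show "cayley_adj D y x" if "cayley_adj D x y" for x y
      using that sym[of "x - y"] by (simp add: cayley_adj_def)
    show "\<exists>x y. cayley_adj D x y" using a by (intro exI[of _ a] exI[of _ 0]) (simp add: cayley_adj_def)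
    show "\<exists>x y. x \<noteq> y \<and> \<not> cayley_adj D x y"
      using b by (intro exI[of _ b] exI[of _ 0]) (simp add: cayley_adj_def)
    show "card {z. cayley_adj D x z} = card D" for x by (rule card_adj)
    show "card {z. cayley_adj D x z \<and> cayley_adj D y z} = l" if "cayley_adj D x y" for x y
      unfolding diff_count_adj by (rule R1) (use that in \<open>simp add: cayley_adj_def\<close>)
    show "card {z. cayley_adj D x z \<and> cayley_adj D y z} = m" if "x \<noteq> y \<and> \<not> cayley_adj D x y" for x y
      unfolding diff_count_adj by (rule R2) (use that in \<open>simp_all add: cayley_adj_def\<close>)
  qed
  then show ?thesis unfolding paley_type_pds_def
    using D0 img card l by (intro conjI exI[of _ "card D"] exI[of _ l] exI[of _ m]) (auto simp: m_def)
qed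

end

section \<open>Additive characters from the absolute trace\<close>

definition prime_char :: "'a::field \<Rightarrow> complex" where
  "prime_char y = zeta CHAR('a) (int (SOME m. of_nat m = y))"

definition abs_trace :: "nat \<Rightarrow> 'a::field \<Rightarrow> 'a" where
  "abs_trace m x = (\<Sum>i<m. x ^ (CHAR('a) ^ i))"

text \<open>The degree m is a parameter, so one formula serves both finite fields and their images
  in the algebraic closure. It is meaningful where the trace lands in the prime field, on which
  \<open>prime_char\<close> does not depend on the chosen representative.\<close>

definition add_char :: "nat \<Rightarrow> 'a::field \<Rightarrow> complex" where
  "add_char m x = prime_char (abs_trace m x)"

context
  assumes char: "prime CHAR('a::field)"
begin

lemma prime_char_of_nat: "prime_char (of_nat m :: 'a) = zeta CHAR('a) (int m)"
proof -
  define k where "k = (SOME k. of_nat k = (of_nat m :: 'a))"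
  have "of_nat k = (of_nat m :: 'a)" unfolding k_def by (rule someI) simp
  then have "[k = m] (mod CHAR('a))" by (simp add: of_nat_eq_iff_cong_CHAR)
  then have "int CHAR('a) dvd int k - int m" by (metis cong_iff_dvd_diff cong_int_iff)
  then show ?thesis using prime_gt_0_nat[OF char] by (simp add: prime_char_def k_def zeta_cong)
qed

lemma prime_char_add:
  assumes "x \<in> range of_nat" "y \<in> range (of_nat :: nat \<Rightarrow> 'a)"
  shows "prime_char (x + y) = prime_char x * prime_char y"
proof -
  obtain a b where "x = of_nat a" "y = of_nat b" using assms by auto
  then show ?thesis
    using prime_char_of_nat[of "a + b"] by (simp add: prime_char_of_nat zeta_add)
qed

text \<open>X^p - X has at most p roots, and the p residues of integers are already roots.\<close>

lemma prime_subfield: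
  assumes "(y :: 'a) ^ CHAR('a) = y"
  shows "y \<in> range of_nat"
proof -
  define p where "p = CHAR('a)"
  have p: "p > 1" using prime_gt_1_nat[OF char] by (simp add: p_def)
  define P where "P = Polynomial.monom 1 p - [:0, 1 :: 'a:]"
  have deg: "degree P = p"
    unfolding P_def using p
    by (subst diff_conv_add_uminus, subst degree_add_eq_left) (auto simp: degree_monom_eq)
  then have P: "P \<noteq> 0" using p by auto
  have root: "poly P x = 0 \<longleftrightarrow> x ^ p = x" for x by (simp add: P_def poly_monom)
  have "of_nat ` {..<p} \<subseteq> {x. poly P x = 0}"
  proof
    fix x :: 'a assume "x \<in> of_nat ` {..<p}"
    then obtain m where m: "x = of_nat m" by auto
    have "(of_nat m :: 'a) ^ p = of_nat m"
    proof (induction m)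
      case 0
      then show ?case using p by simp
    next
      case (Suc m)
      then show ?case
        using freshmans_dream[OF char, of p 1 "of_nat m"] by (simp add: p_def)
    qed
    then show "x \<in> {x. poly P x = 0}" by (simp add: root m)
  qed
  moreover have "card (of_nat ` {..<p} :: 'a set) = p"
    by (subst card_image) (auto simp: inj_on_def of_nat_eq_iff_cong_CHAR cong_def p_def)
  moreover have "card {x. poly P x = 0} \<le> p"
    using card_poly_roots_bound[OF P] deg by simp
  moreover have "finite {x. poly P x = 0}" using P by (rule poly_roots_finite)
  ultimately have "of_nat ` {..<p} = {x. poly P x = 0}" by (intro card_seteq) auto
  moreover have "y \<in> {x. poly P x = 0}" using assms by (simp add: root p_def)
  ultimately show ?thesis by blast
qed

lemma power_CHAR_add: "((x :: 'a) + y) ^ (CHAR('a) ^ m) = x ^ (CHAR('a) ^ m) + y ^ (CHAR('a) ^ m)"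
  by (rule freshmans_dream'[OF char]) simp

lemma abs_trace_add: "abs_trace m (x + y :: 'a) = abs_trace m x + abs_trace m y"
  by (simp add: abs_trace_def power_CHAR_add sum.distrib)

lemma abs_trace_power:
  assumes "(x :: 'a) ^ (CHAR('a) ^ m) = x"
  shows "abs_trace m (x ^ CHAR('a)) = abs_trace m x" "abs_trace m x ^ CHAR('a) = abs_trace m x"
proof -
  have *: "(\<Sum>i<m. x ^ (CHAR('a) ^ Suc i)) = abs_trace m x"
  proof (cases m)
    case (Suc k)
    then have "(\<Sum>i<m. x ^ (CHAR('a) ^ Suc i)) = (\<Sum>i<k. x ^ (CHAR('a) ^ Suc i)) + x"
      using assms by simp
    also have "\<dots> = abs_trace m x"
      unfolding abs_trace_def Suc sum.lessThan_Suc_shift by simp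
    finally show ?thesis .
  qed (simp add: abs_trace_def)
  show "abs_trace m (x ^ CHAR('a)) = abs_trace m x"
    using * by (simp add: abs_trace_def flip: power_mult)
  have "abs_trace m x ^ CHAR('a) = (\<Sum>i<m. (x ^ (CHAR('a) ^ i)) ^ CHAR('a))"
    unfolding abs_trace_def by (rule freshmans_dream_sum[OF char]) simp
  then show "abs_trace m x ^ CHAR('a) = abs_trace m x"
    using * by (simp add: mult.commute flip: power_mult)
qed

lemma abs_trace_in: "(x :: 'a) ^ (CHAR('a) ^ m) = x \<Longrightarrow> abs_trace m x \<in> range of_nat"
  using abs_trace_power(2) prime_subfield by blast

lemma add_char_add:
  "(x :: 'a) ^ (CHAR('a) ^ m) = x \<Longrightarrow> y ^ (CHAR('a) ^ m) = y \<Longrightarrow>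
    add_char m (x + y) = add_char m x * add_char m y"
  by (simp add: add_char_def abs_trace_add prime_char_add abs_trace_in)

lemma add_char_0: "add_char m (0 :: 'a) = 1"
proof -
  have "abs_trace m (0 :: 'a) = of_nat 0"
    using prime_gt_0_nat[OF char] by (simp add: abs_trace_def power_0_left)
  then show ?thesis unfolding add_char_def by (simp only: prime_char_of_nat) simp
qed

lemma add_char_power: "(x :: 'a) ^ (CHAR('a) ^ m) = x \<Longrightarrow> add_char m (x ^ CHAR('a)) = add_char m x"
  by (simp add: add_char_def abs_trace_power)

text \<open>Transitivity of the trace, by writing the exponents below d r as i d + l.\<close>

lemma add_char_tower: "add_char (d * r) (x :: 'a) = add_char d (\<Sum>i<r. x ^ ((CHAR('a) ^ d) ^ i))"
proof -
  have "abs_trace d (\<Sum>i<r. x ^ ((CHAR('a) ^ d) ^ i)) = (\<Sum>l<d. \<Sum>i<r. x ^ (CHAR('a) ^ (i * d + l)))"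
  proof -
    have "(\<Sum>i<r. x ^ ((CHAR('a) ^ d) ^ i)) ^ (CHAR('a) ^ l) = (\<Sum>i<r. x ^ (CHAR('a) ^ (i * d + l)))" for l
      by (subst freshmans_dream_sum'[OF char])
         (auto simp: power_add mult.commute simp flip: power_mult)
    then show ?thesis by (simp add: abs_trace_def)
  qed
  also have "\<dots> = (\<Sum>i<r. \<Sum>l<d. x ^ (CHAR('a) ^ (i * d + l)))" by (rule sum.swap)
  also have "\<dots> = (\<Sum>i<r. sum (\<lambda>j. x ^ (CHAR('a) ^ j)) {i * d..<i * d + d})"
  proof (rule sum.cong[OF refl])
    fix i
    show "(\<Sum>l<d. x ^ (CHAR('a) ^ (i * d + l))) = sum (\<lambda>j. x ^ (CHAR('a) ^ j)) {i * d..<i * d + d}"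
      by (rule sum.reindex_bij_witness[of _ "\<lambda>j. j - i * d" "\<lambda>l. i * d + l"]) auto
  qed
  also have "\<dots> = abs_trace (d * r) x"
    unfolding abs_trace_def sum.nat_group by (simp add: mult.commute)
  finally show ?thesis by (simp add: add_char_def)
qed

end

text \<open>Nontrivial because the trace is a nonzero polynomial of degree at most p^(m-1), so it
  cannot vanish at all p^m elements.\<close>

lemma additive_char_add_char:
  fixes ty :: "'a::{field,finite} itself"
  assumes char: "prime CHAR('a)" and card: "CARD('a) = CHAR('a) ^ m"
  shows "additive_char (add_char m :: 'a \<Rightarrow> complex)"
proof
  have pw: "x ^ (CHAR('a) ^ m) = x" for x :: 'a
  proof (cases "x = 0")
    case True
    then show ?thesis using prime_gt_0_nat[OF char] by simp
  next
    case False
    have "x ^ CARD('a) = x * x ^ (CARD('a) - 1)" by (simp flip: power_Suc)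
    then show ?thesis using finite_field_fermat[OF False] by (simp add: card)
  qed
  show "add_char m (x + y :: 'a) = add_char m x * add_char m y" for x y
    using add_char_add[OF char] pw by blast
  show "add_char m (0 :: 'a) = 1" by (rule add_char_0[OF char])
  define p where "p = CHAR('a)"
  have p: "p > 1" using prime_gt_1_nat[OF char] by (simp add: p_def)
  have "CARD('a) \<ge> 2" by (rule two_le_CARD_field)
  then have "CARD('a) \<noteq> 1" by simp
  then have "m \<noteq> 0" using card by (cases "m = 0") simp_all
  define P where "P = (\<Sum>i<m. Polynomial.monom (1 :: 'a) (p ^ i))"
  have "coeff P 1 = (\<Sum>i<m. if i = 0 then 1 else 0)"
    unfolding P_def coeff_sum coeff_monom using p
    by (intro sum.cong refl) (auto simp: power_eq_1_iff)
  also have "\<dots> = 1" using \<open>m \<noteq> 0\<close> by simp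
  finally have P0: "P \<noteq> 0" by auto
  have "degree P \<le> p ^ (m - 1)"
    unfolding P_def using p
    by (intro degree_sum_le) (auto intro!: order.trans[OF degree_monom_le] power_increasing)
  then have "card {x. poly P x = 0} \<le> p ^ (m - 1)"
    using card_poly_roots_bound[OF P0] by linarith
  also have "\<dots> < p ^ m" using p \<open>m \<noteq> 0\<close> by simp
  finally have "{x. poly P x = 0} \<noteq> UNIV" using card by (auto simp: p_def)
  then obtain x where "poly P x \<noteq> 0" by auto
  then have "abs_trace m x \<noteq> 0" by (simp add: P_def abs_trace_def poly_sum poly_monom p_def)
  moreover obtain r where r: "abs_trace m x = of_nat r" using abs_trace_in[OF char pw] by auto
  ultimately have "\<not> p dvd r" by (simp add: of_nat_eq_0_iff_char_dvd p_def)
  then have "add_char m x \<noteq> 1"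
    using p by (simp add: add_char_def r prime_char_of_nat[OF char] zeta_eq_1_iff p_def)
  then show "\<exists>x :: 'a. add_char m x \<noteq> 1" ..
qed

locale field_hom =
  fixes emb :: "'a::field \<Rightarrow> 'b::field"
  assumes hom_add: "emb (x + y) = emb x + emb y" and hom_mult: "emb (x * y) = emb x * emb y"
    and hom_1: "emb 1 = 1"
begin

lemma hom_0: "emb 0 = 0"
  using hom_add[of 0 0] by (simp only: add_0_right add_cancel_right_right)

lemma hom_of_nat: "emb (of_nat m) = of_nat m"
  by (induction m) (auto simp: hom_0 hom_1 hom_add)

lemma hom_eq_0: "emb x = 0 \<longleftrightarrow> x = 0"
proof
  assume "emb x = 0"
  show "x = 0"
  proof (rule ccontr)
    assume "x \<noteq> 0"
    then have "emb (x * inverse x) = 1" by (simp add: hom_1)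
    then show False using \<open>emb x = 0\<close> unfolding hom_mult by simp
  qed
qed (simp add: hom_0)

lemma hom_minus: "emb (- x) = - emb x"
  using hom_add[of x "- x"] by (simp add: hom_0 eq_neg_iff_add_eq_0 add.commute)

lemma hom_eq: "emb x = emb y \<longleftrightarrow> x = y"
proof -
  have "emb x = emb y \<longleftrightarrow> emb (x - y) = 0"
    using hom_add[of x "- y"] by (simp add: hom_minus)
  then show ?thesis by (simp add: hom_eq_0)
qed

lemma hom_power: "emb (x ^ m) = emb x ^ m"
  by (induction m) (auto simp: hom_1 hom_mult)

lemma hom_sum: "emb (sum f A) = (\<Sum>x\<in>A. emb (f x))"
  by (induction A rule: infinite_finite_induct) (auto simp: hom_0 hom_add)

lemma hom_CHAR: "CHAR('b) = CHAR('a)"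
proof -
  have "CHAR('b) dvd m \<longleftrightarrow> CHAR('a) dvd m" for m
    using hom_eq_0[of "of_nat m"] by (simp add: hom_of_nat of_nat_eq_0_iff_char_dvd)
  then show ?thesis by (metis dvd_antisym dvd_refl)
qed

lemma hom_add_char:
  assumes char: "prime CHAR('a)" and x: "x ^ (CHAR('a) ^ m) = x"
  shows "add_char m (emb x) = add_char m x"
proof -
  obtain r where r: "abs_trace m x = of_nat r" using abs_trace_in[OF char x] by auto
  have "abs_trace m (emb x) = emb (abs_trace m x)"
    by (simp add: abs_trace_def hom_sum hom_power hom_CHAR)
  also have "\<dots> = of_nat r" by (simp add: r hom_of_nat)
  finally show ?thesis
    using char by (simp add: add_char_def r prime_char_of_nat hom_CHAR)
qed

end

section \<open>Orders of $p$ modulo prime powers\<close>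

text \<open>Lagrange's theorem for the subgroup generated by a; it turns the index hypotheses into
  statements about multiplicative orders.\<close>

lemma unit_index_mult_ord:
  assumes n: "n > 1" and a: "coprime a n"
  shows "unit_index n a * ord n a = totient n"
proof -
  interpret residues "int n" "residue_ring (int n)"
    using n by unfold_locales auto
  define G where "G = units_of (residue_ring (int n))"
  define b where "b = int a mod int n"
  have grp: "group G" unfolding G_def by (rule units_group)
  interpret G: group G by (rule grp)
  have fin: "finite (carrier G)" by (simp add: G_def units_of_carrier)
  have "coprime (int a) (int n)" using a by simp
  then have b: "b \<in> Units (residue_ring (int n))" using n by (simp add: b_def)
  then have bG: "b \<in> carrier G" by (simp add: G_def units_of_carrier)
  have "b [^]\<^bsub>G\<^esub> k = int a ^ k mod int n" for k :: nat
    using b pow_cong[of "int a" k] by (simp add: G_def units_of_pow b_def)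
  then have "b [^]\<^bsub>G\<^esub> k = \<one>\<^bsub>G\<^esub> \<longleftrightarrow> [a ^ k = 1] (mod n)" for k :: nat
    using n by (simp add: G_def units_of_one res_one_eq cong_def flip: of_nat_power of_nat_mod)
  then have "G.ord b dvd k \<longleftrightarrow> ord n a dvd k" for k
    using G.pow_eq_id[OF bG] ord_divides by metis
  then have "G.ord b = ord n a" by (meson dvd_antisym dvd_refl)
  then have "card (generate G {b}) = ord n a" using G.generate_pow_card[OF bG] by simp
  moreover have "subgroup (generate G {b}) G" using bG by (intro G.generate_is_subgroup) auto
  then have "card (rcosets\<^bsub>G\<^esub> (generate G {b})) * card (generate G {b}) = Coset.order G"
    by (rule G.lagrange)
  moreover have "Coset.order G = totient n"
    using totient_eq by (simp add: Coset.order_def G_def units_of_carrier)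
  ultimately show ?thesis by (simp add: unit_index_def G_def b_def Let_def)
qed

lemma ord_double:
  assumes "odd n" "odd a"
  shows "ord (2 * n) a = ord n (a :: nat)"
proof -
  have "[a ^ k = 1] (mod 2 * n) \<longleftrightarrow> [a ^ k = 1] (mod n)" for k
  proof
    assume "[a ^ k = 1] (mod n)"
    moreover have "[a ^ k = 1] (mod 2)" using assms by (simp add: cong_def mod2_eq_if)
    ultimately show "[a ^ k = 1] (mod 2 * n)"
      using assms by (simp add: coprime_cong_mult_nat)
  qed (rule cong_modulus_mult_nat[of _ _ n 2, unfolded mult.commute[of n 2]])
  then show ?thesis by (metis dvd_antisym dvd_refl ord_divides)
qed

text \<open>The assumption \<open>ord\<close> is the form in which the index hypothesis is used. The
  number s is at once k / h and the degree of the larger field over the smaller one.\<close>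

locale tower_orders =
  fixes p p1 d e1 s h k :: nat
  assumes p: "prime p" "odd p" and p1: "prime p1" "odd p1" and ne: "p \<noteq> p1"
    and e1: "e1 \<ge> 1" and s: "s = p1 ^ (e1 - 1)" and h: "h = 2 * p1" and k: "k = 2 * p1 ^ e1"
    and ord: "\<And>x. x \<ge> 1 \<Longrightarrow> ord (p1 ^ x) p = d * p1 ^ (x - 1)"
begin

lemma k_eq: "k = h * s"
  using e1 by (cases e1) (auto simp: k h s)

lemma pos: "s > 0" "h > 0" "k > 0" "p > 1" "p1 > 1"
  using prime_gt_1_nat[OF p1(1)] prime_gt_1_nat[OF p(1)] by (auto simp: s h k)

lemma odd_s: "odd s"
  using p1(2) by (simp add: s)

lemma cong_1_iff: "x \<ge> 1 \<Longrightarrow> [p ^ m = 1] (mod p1 ^ x) \<longleftrightarrow> d * p1 ^ (x - 1) dvd m"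
  using ord[of x] by (simp only: ord_divides)

lemma d_pos: "d > 0"
proof -
  have "coprime p p1" using p(1) p1(1) ne by (simp add: primes_coprime)
  then have "ord p1 p \<noteq> 0" by (simp add: ord_eq_0 coprime_commute)
  moreover have "ord p1 p = d" using ord[of 1] by simp
  ultimately show ?thesis by (metis gr0I)
qed

lemma cong_k_iff: "[p ^ m = 1] (mod k) \<longleftrightarrow> d * s dvd m"
  unfolding ord_divides using ord_double[of "p1 ^ e1" p] ord[OF e1] p(2) p1(2) by (simp add: k s)

lemma cong_h_iff: "[p ^ m = 1] (mod h) \<longleftrightarrow> d dvd m"
  unfolding ord_divides using ord_double[of p1 p] ord[of 1] p(2) p1(2) by (simp add: h)

lemma dvd_minus_1_iff: "x > 0 \<Longrightarrow> N dvd x - 1 \<longleftrightarrow> [x = 1] (mod N)" for x N :: nat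
  using cong_altdef_nat[of 1 x N] by (simp add: cong_sym_eq)

lemma h_dvd: "h dvd p ^ d - 1"
  using dvd_minus_1_iff[of "p ^ d" h] cong_h_iff pos by simp

lemma k_dvd: "k dvd p ^ (d * s) - 1"
  using dvd_minus_1_iff[of "p ^ (d * s)" k] cong_k_iff pos by simp

lemma p1_dvd: "p1 dvd p ^ d - 1"
  using h_dvd by (simp add: h) (metis dvd_mult_right)

text \<open>The order of p modulo p1^2 is d p1, which does not divide d.\<close>

lemma p1_sq_not_dvd: "\<not> p1 ^ 2 dvd p ^ d - 1"
proof -
  have "\<not> d * p1 dvd d" using d_pos pos by simp
  then show ?thesis using dvd_minus_1_iff[of "p ^ d" "p1 ^ 2"] cong_1_iff[of 2 d] pos by simp
qed

text \<open>The products j p^(d i) with i < s are congruent to j modulo h and distinct modulo k,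
  because p^d has order s modulo k; and there are only s such residues.\<close>

lemma residue_orbit:
  assumes j: "coprime j k"
  shows "\<exists>i. [j + h * m = j * (p ^ d) ^ i] (mod k)"
proof -
  define A where "A = {x. x < k \<and> x mod h = j mod h}"
  define F where "F i = j * (p ^ d) ^ i mod k" for i
  have "A = {x. x < h * s \<and> x mod h = j mod h}" by (simp add: A_def k_eq)
  then have cA: "card A = s" using card_residues_below[of h "j mod h" s] pos by simp
  have fA: "finite A" by (simp add: A_def)
  have "[(p ^ d) ^ i = 1] (mod h)" for i using cong_h_iff[of "d * i"] by (simp add: power_mult)
  then have "[j * (p ^ d) ^ i = j * 1] (mod h)" for i by (intro cong_mult cong_refl)
  then have FA: "F ` {..<s} \<subseteq> A"
    using pos by (auto simp: F_def A_def cong_def k_eq mod_mod_cancel)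
  have "inj_on F {..<s}"
  proof (rule linorder_inj_onI)
    fix i i' assume ii: "i < i'" "i \<in> {..<s}" "i' \<in> {..<s}"
    show "F i \<noteq> F i'"
    proof
      assume "F i = F i'"
      then have "[j * (p ^ d) ^ i' = j * (p ^ d) ^ i] (mod k)" by (simp add: F_def cong_def)
      then have "[(p ^ d) ^ i' = (p ^ d) ^ i] (mod k)" using j cong_mult_lcancel_nat by blast
      moreover have "(p ^ d) ^ i' = (p ^ d) ^ i * (p ^ d) ^ (i' - i)" using ii by (simp flip: power_add)
      moreover have "coprime ((p ^ d) ^ i) k"
      proof -
        have "coprime p k" unfolding k using p p1 ne by (auto simp: primes_coprime)
        then show ?thesis by simp
      qed
      ultimately have "[(p ^ d) ^ (i' - i) = 1] (mod k)"
        by (metis cong_mult_lcancel_nat mult.right_neutral)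
      then have "d * s dvd d * (i' - i)" unfolding cong_k_iff[symmetric] power_mult .
      then have "s dvd i' - i" using d_pos by simp
      then show False using ii by (auto dest: dvd_imp_le)
    qed
  qed auto
  then have "F ` {..<s} = A" using FA fA cA by (intro card_subset_eq) (auto simp: card_image)
  moreover have "(j + h * m) mod k \<in> A"
    using pos by (simp add: A_def k_eq mod_mod_cancel)
  ultimately obtain i where "(j + h * m) mod k = F i" by (metis image_iff)
  then show ?thesis by (auto simp: F_def cong_def)
qed

end

section \<open>Gauss sums in a tower of finite fields\<close>

lemma CHAR_finite_field:
  assumes "CARD('a::{field,finite}) = p ^ m" "prime p"
  shows "CHAR('a) = p"
proof -
  have "CHAR('a) > 0" by (rule finite_imp_CHAR_pos) simp
  then have pr: "prime CHAR('a)" by (rule prime_CHAR_semidom)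
  have "CHAR('a) dvd p ^ m" using CHAR_dvd_CARD[where 'a = 'a] assms(1) by simp
  then have "CHAR('a) dvd p" using pr prime_dvd_power by blast
  then show ?thesis using pr assms(2) primes_dvd_imp_eq by blast
qed

lemma field_power_card:
  fixes x :: "'a::{field,finite}"
  shows "x ^ CARD('a) = x"
proof (cases "x = 0")
  case False
  have "x ^ CARD('a) = x * x ^ (CARD('a) - 1)" by (simp flip: power_Suc)
  then show ?thesis using finite_field_fermat[OF False] by simp
qed simp

lemma geometric_sum_nat:
  fixes x :: nat
  assumes "x > 0"
  shows "(x - 1) * (\<Sum>i<n. x ^ i) = x ^ n - 1"
proof -
  obtain y where y: "x = Suc y" using assms gr0_conv_Suc by blast
  have "y * (\<Sum>i<n. Suc y ^ i) + 1 = Suc y ^ n"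
    by (induction n) (auto simp: algebra_simps)
  then show ?thesis by (simp add: y)
qed

text \<open>Modulo n, the map t -> s t hits each multiple of s exactly s times.\<close>

lemma sum_periodic_multiples:
  fixes F :: "nat \<Rightarrow> complex"
  assumes n: "n = s * n'" and s: "s > 0" and per: "\<And>t. F (t + n) = F t"
  shows "(\<Sum>t<n. F (s * t)) = of_nat s * (\<Sum>t<n. if s dvd t then F t else 0)"
proof -
  have per': "F (t + a * n) = F t" for t a
  proof (induction a)
    case (Suc a)
    have "t + Suc a * n = (t + a * n) + n" by simp
    then show ?case by (simp only: per Suc)
  qed simp
  have "(\<Sum>t<n. F (s * t)) = (\<Sum>a<s. \<Sum>t\<in>{a * n'..<a * n' + n'}. F (s * t))"
    unfolding n by (rule sum.nat_group[symmetric])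
  also have "\<dots> = (\<Sum>a<s. \<Sum>t<n'. F (s * t))"
  proof (rule sum.cong[OF refl])
    fix a
    have "(\<Sum>t\<in>{a * n'..<a * n' + n'}. F (s * t)) = (\<Sum>t<n'. F (s * (a * n' + t)))"
      by (rule sum.reindex_bij_witness[of _ "\<lambda>t. a * n' + t" "\<lambda>t. t - a * n'"]) auto
    also have "\<dots> = (\<Sum>t<n'. F (s * t))"
    proof (rule sum.cong[OF refl])
      fix t
      have "s * (a * n' + t) = s * t + a * n" by (simp add: n algebra_simps)
      then show "F (s * (a * n' + t)) = F (s * t)" by (simp only: per')
    qed
    finally show "(\<Sum>t\<in>{a * n'..<a * n' + n'}. F (s * t)) = (\<Sum>t<n'. F (s * t))" .
  qed
  also have "\<dots> = of_nat s * (\<Sum>t<n'. F (s * t))" by simp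
  also have "(\<Sum>t<n'. F (s * t)) = (\<Sum>t\<in>{t\<in>{..<n}. s dvd t}. F t)"
    by (rule sum.reindex_bij_witness[of _ "\<lambda>t. t div s" "\<lambda>t. s * t"])
       (use s n in \<open>auto elim!: dvdE\<close>)
  also have "\<dots> = (\<Sum>t<n. if s dvd t then F t else 0)" by (rule sum.inter_filter) simp
  finally show ?thesis .
qed

locale field_tower = tower_orders p p1 d e1 s h k + field_hom emb
  for p p1 d e1 s h k :: nat and emb :: "'a::{field,finite} \<Rightarrow> 'b::{field,finite}" +
  fixes g1 :: 'a and g :: 'b
  assumes cardA: "CARD('a) = p ^ d" and cardB: "CARD('b) = p ^ (d * s)"
    and g1: "primitive_element g1" and g: "primitive_element g"
    and compat: "emb g1 = g ^ ((CARD('b) - 1) div (CARD('a) - 1))"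
    and coprime_p1: "coprime p1 (p - 1)"
begin

lemma charA: "CHAR('a) = p" and charB: "CHAR('b) = p"
  using CHAR_finite_field[OF cardA p(1)] CHAR_finite_field[OF cardB p(1)] .

sublocale A: gauss_sums g1 "CARD('a) - 1" "add_char d"
proof -
  interpret additive_char "add_char d :: 'a \<Rightarrow> complex"
    by (rule additive_char_add_char) (simp_all add: charA p cardA)
  show "gauss_sums g1 (CARD('a) - 1) (add_char d)"
    by unfold_locales (simp_all add: g1)
qed

sublocale B: gauss_sums g "CARD('b) - 1" "add_char (d * s)"
proof -
  interpret additive_char "add_char (d * s) :: 'b \<Rightarrow> complex"
    by (rule additive_char_add_char) (simp_all add: charB p cardB)
  show "gauss_sums g (CARD('b) - 1) (add_char (d * s))"
    by unfold_locales (simp_all add: g)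
qed

sublocale Om: frobenius_closure "p ^ d" d "TYPE('b alg_closure)"
  by unfold_locales (simp_all add: charB p d_pos)

lemma h_dvd_A: "h dvd CARD('a) - 1" and k_dvd_B: "k dvd CARD('b) - 1"
  using h_dvd k_dvd by (simp_all add: cardA cardB)

text \<open>Raising to this power is the norm from \<open>'b\<close> down to the embedded copy of
  \<open>'a\<close>.\<close>

definition norm_exp :: nat where "norm_exp = (\<Sum>i<s. (p ^ d) ^ i)"

lemma norm_exp_mult: "(CARD('a) - 1) * norm_exp = CARD('b) - 1"
  using geometric_sum_nat[of "p ^ d" s] pos by (simp add: norm_exp_def cardA cardB power_mult)

lemma compat': "emb g1 = g ^ norm_exp"
proof -
  have "CARD('a) - 1 > 0" by (rule A.n_pos)
  then have "(CARD('b) - 1) div (CARD('a) - 1) = norm_exp"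
    unfolding norm_exp_mult[symmetric] by (metis nonzero_mult_div_cancel_left less_irrefl)
  then show ?thesis by (simp add: compat)
qed

definition eta :: "'a \<Rightarrow> 'b alg_closure" where "eta x = to_ac (emb x)"

lemma eta_hom: "field_hom eta"
  by unfold_locales (simp_all add: eta_def hom_add hom_mult hom_1)

sublocale Eta: field_hom eta by (rule eta_hom)

sublocale Ac: field_hom "to_ac :: 'b \<Rightarrow> 'b alg_closure"
  by unfold_locales simp_all

lemma K1: "Om.K 1 = range eta"
proof -
  have "range eta \<subseteq> Om.K 1"
    using field_power_card[where 'a = 'a] by (auto simp: Om.K_def cardA simp flip: Eta.hom_power)
  moreover have "card (range eta) = p ^ d"
    using cardA by (subst card_image) (auto simp: inj_def Eta.hom_eq)
  moreover have "card (Om.K 1) \<le> p ^ d" "finite (Om.K 1)"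
    using Om.card_K_le[of 1] Om.finite_K[of 1] by auto
  ultimately show ?thesis by (metis card_seteq)
qed

lemma Ks: "Om.K s = range to_ac"
proof -
  have "range to_ac \<subseteq> Om.K s"
    using field_power_card[where 'a = 'b]
    by (auto simp: Om.K_def cardB simp flip: power_mult to_ac_power)
  moreover have "card (range (to_ac :: 'b \<Rightarrow> _)) = p ^ (d * s)"
    using cardB by (subst card_image) (auto simp: inj_def)
  moreover have "card (Om.K s) \<le> p ^ (d * s)" "finite (Om.K s)"
    using Om.card_K_le[of s] Om.finite_K[of s] pos by (auto simp: power_mult)
  ultimately show ?thesis by (metis card_seteq)
qed

text \<open>The constant \<open>S0\<close> of \<open>frobenius_characters\<close>, spelled out
  without a multiplicative character so that visibly one number serves all j.\<close>

definition S0 :: complex where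
  "S0 = (\<Sum>f\<in>{f\<in>Om.Mon s. coeff f 0 = 0}. add_char d (\<Sum>y\<in>#proots f. y ^ s))"

text \<open>The character of \<open>'a\<close> moved to the closure along \<open>eta\<close>; it is
  meaningful only on \<open>K 1\<close>.\<close>

definition chi :: "int \<Rightarrow> 'b alg_closure \<Rightarrow> complex" where
  "chi j y = A.mchar h j (inv_into UNIV eta y)"

lemma chi_eta: "chi j (eta x) = A.mchar h j x"
  by (simp add: chi_def inv_f_f inj_def Eta.hom_eq)

lemma prime_Om: "prime CHAR('b alg_closure)"
  by (simp add: charB p)

lemma characters: "frobenius_characters (p ^ d) d (chi j) (add_char d)"
proof unfold_locales
  fix x y assume xy: "x \<in> Om.K 1" "y \<in> Om.K 1"
  then obtain a b where ab: "x = eta a" "y = eta b" unfolding K1 by blast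
  show "chi j (x * y) = chi j x * chi j y"
    unfolding ab Eta.hom_mult[symmetric] chi_eta by (rule A.mchar_mult[OF h_dvd_A])
  show "add_char d (x + y) = add_char d x * add_char d y"
    using add_char_add[OF prime_Om] xy by (simp add: Om.K_def charB)
next
  show "chi j 1 = 1" using chi_eta[of j 1] h_dvd_A by (simp add: Eta.hom_1)
  show "add_char d (0 :: 'b alg_closure) = 1" by (rule add_char_0[OF prime_Om])
qed

lemma add_char_eta: "add_char d (eta x) = add_char d x"
  using field_power_card[of x] cardA
  by (intro Eta.hom_add_char) (simp_all add: charA p)

lemma S0_real: "cnj S0 = S0"
proof -
  interpret X: frobenius_characters "p ^ d" d "TYPE('b alg_closure)" "chi 0" "add_char d" s
    by (rule characters)
  have "cnj X.S0 = X.S0"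
  proof (rule X.S0_real[OF odd_s])
    fix x assume "x \<in> Om.K 1"
    then obtain a where a: "x = eta a" unfolding K1 by blast
    show "add_char d (- x) = cnj (add_char d x)"
      unfolding a Eta.hom_minus[symmetric] add_char_eta by (rule A.\<psi>_minus)
  qed
  then show ?thesis by (simp only: S0_def X.S0_def)
qed

text \<open>Write q1 - 1 = p1 m with m prime to p1. If p1 divided t, then (g1^t)^m = 1; since the
  order of g1^t is also a power of p1, it would be 1.\<close>

lemma not_p1_dvd_dlog:
  assumes t: "(g1 ^ t) ^ (s * p1) = 1" "g1 ^ t \<noteq> 1"
  shows "\<not> p1 dvd t"
proof
  assume "p1 dvd t"
  then obtain t' where t': "t = p1 * t'" by (elim dvdE)
  obtain m where m: "p ^ d - 1 = p1 * m" using p1_dvd by (elim dvdE)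
  have "\<not> p1 dvd m" using p1_sq_not_dvd m by (auto simp: power2_eq_square)
  then have "coprime m p1" using prime_imp_coprime[OF p1(1)] coprime_commute by blast
  then have cop: "coprime m (s * p1)" by (simp add: s)
  have "p1 * m dvd p1 * (t' * (s * p1))"
    using t(1)[folded power_mult, unfolded A.g_power_eq_1_iff] by (simp only: cardA m t' mult.assoc)
  then have "m dvd t'" using cop pos by (simp add: coprime_dvd_mult_left_iff)
  then have "CARD('a) - 1 dvd t" using t' m by (simp add: cardA)
  then show False using t(2) A.g_power_eq_1_iff by simp
qed

text \<open>Scale by a root of unity of order \<open>p1 ^ (a + 1)\<close>, where \<open>p1 ^ a\<close> is the exact power of \<open>p1\<close>
  in \<open>i\<close>: it lies in the extension of degree \<open>i\<close> and its norm has order \<open>p1\<close>.\<close>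

lemma S_vanishes:
  assumes j: "coprime j (int h)" and i: "0 < i" "i < s"
  shows "frobenius_characters.S (p ^ d) (chi j) (add_char d :: 'b alg_closure \<Rightarrow> _) s i = 0"
proof -
  interpret X: frobenius_characters "p ^ d" d "TYPE('b alg_closure)" "chi j" "add_char d" s
    by (rule characters)
  define a where "a = multiplicity p1 i"
  have a1: "p1 ^ a dvd i" "\<not> p1 ^ Suc a dvd i"
    using i pos power_dvd_iff_le_multiplicity[of i p1 "Suc a"] unfolding a_def
    by (simp_all add: multiplicity_dvd del: power_Suc)
  \<comment> \<open>Since i < s, even p1^(a+1) divides s: the root of unity z exists in
    \<open>'b\<close>, and its s-th power is 1.\<close>
  have "p1 ^ a < p1 ^ (e1 - 1)" using dvd_imp_le[OF a1(1)] i by (simp add: s)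
  then have "a < e1 - 1" using pos by (simp add: power_strict_increasing_iff)
  then have as: "p1 ^ Suc a dvd s" unfolding s by (intro le_imp_power_dvd) simp
  have "s dvd CARD('b) - 1" using k_dvd_B k_eq by (metis dvd_mult_right)
  then obtain M where M: "CARD('b) - 1 = p1 ^ Suc a * M" using as by (meson dvd_trans dvdE)
  then have M0: "M > 0" using B.n_pos by (cases "M = 0") auto
  have one: "g ^ (M * l) = 1 \<longleftrightarrow> p1 ^ Suc a dvd l" for l
  proof -
    have "g ^ (M * l) = 1 \<longleftrightarrow> M * p1 ^ Suc a dvd M * l"
      unfolding B.g_power_eq_1_iff M by (simp only: mult.commute)
    then show ?thesis using M0 by (simp del: power_Suc)
  qed
  define w where "w = g ^ M"
  define z where "z = (to_ac w :: 'b alg_closure)"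
  have "d * p1 ^ a dvd d * i" using a1(1) by simp
  then have "[p ^ (d * i) = 1] (mod p1 ^ Suc a)" using cong_1_iff[of "Suc a" "d * i"] by simp
  then have dv: "p1 ^ Suc a dvd (p ^ d) ^ i - 1"
    using dvd_minus_1_iff[of "p ^ (d * i)" "p1 ^ Suc a"] pos by (simp add: power_mult)
  have "w ^ ((p ^ d) ^ i) = w"
  proof -
    have "w ^ ((p ^ d) ^ i) = w ^ ((p ^ d) ^ i - 1) * w"
      by (rule power_minus_mult[symmetric]) (use pos in simp)
    then show ?thesis using one[of "(p ^ d) ^ i - 1"] dv by (simp add: w_def flip: power_mult)
  qed
  then have zK: "z \<in> Om.K i" by (simp add: z_def Om.K_def flip: to_ac_power)
  have zs: "z ^ s = 1" using one[of s] as by (simp add: z_def w_def flip: to_ac_power power_mult)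
  define R where "R = (\<Sum>l<i. (p ^ d) ^ l)"
  have "(p ^ d - 1) * R = (p ^ d) ^ i - 1"
    unfolding R_def using pos by (intro geometric_sum_nat) simp
  moreover have "\<not> p1 ^ Suc (Suc a) dvd (p ^ d) ^ i - 1"
  proof
    assume "p1 ^ Suc (Suc a) dvd (p ^ d) ^ i - 1"
    then have "[p ^ (d * i) = 1] (mod p1 ^ Suc (Suc a))"
      using dvd_minus_1_iff[of "p ^ (d * i)" "p1 ^ Suc (Suc a)"] pos by (simp add: power_mult)
    then have "d * p1 ^ Suc a dvd d * i" using cong_1_iff[of "Suc (Suc a)" "d * i"] by simp
    then show False using a1(2) d_pos by (simp del: power_Suc)
  qed
  \<comment> \<open>q1^i - 1 is not divisible by p1^(a+2) and q1 - 1 already absorbs one factor p1,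
    so p1^(a+1) does not divide R and the norm z^R differs from 1.\<close>
  ultimately have nR: "\<not> p1 ^ Suc a dvd R"
    using p1_dvd mult_dvd_mono[of p1 "p ^ d - 1" "p1 ^ Suc a" R] by auto
  have norm: "(\<Prod>l<i. z ^ ((p ^ d) ^ l)) = z ^ R" by (simp add: R_def power_sum)
  then have "z ^ R \<in> range eta" using X.norm_K[OF zK] K1 by simp
  then obtain y where y: "z ^ R = eta y" by auto
  have y_ne: "y \<noteq> 1" using one[of R] nR
    by (metis Eta.hom_1 to_ac_1 to_ac_eq_iff to_ac_power power_mult w_def y z_def)
  have "(z ^ R) ^ s = (z ^ s) ^ R" by (simp add: mult.commute flip: power_mult)
  then have "eta (y ^ s) = 1" using zs by (simp add: Eta.hom_power y)
  then have ys: "y ^ s = 1" by (metis Eta.hom_1 Eta.hom_eq)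
  then have "y \<noteq> 0" using pos by (auto simp: power_0_left)
  then obtain t where t: "y = g1 ^ t" using A.ex_g_power by blast
  have "\<not> p1 dvd t" using not_p1_dvd_dlog[of t] ys y_ne t by (simp add: power_mult)
  have "\<not> int h dvd j * int t"
  proof
    assume "int h dvd j * int t"
    then have "int h dvd int t" using j by (simp add: coprime_dvd_mult_right_iff coprime_commute)
    then have "h dvd t" by (simp only: int_dvd_int_iff)
    then show False using \<open>\<not> p1 dvd t\<close> unfolding h by (blast dest: dvd_mult_right)
  qed
  then have "A.mchar h j y \<noteq> 1" using pos by (simp add: t A.mchar_g_power[OF h_dvd_A] zeta_eq_1_iff)
  then show ?thesis
    using pos by (intro X.S_eq_0[OF zK zs]) (simp_all add: norm y chi_eta)
qed

text \<open>The left side is \<open>S s\<close> written on powers of g: by compatibility the norm of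
  g^t is g1^t, so the character becomes \<open>zeta h (j * int t)\<close>. The right side comes from
  \<open>S_eq_c\<close> and \<open>c_factor\<close>.\<close>

lemma twisted_power_sum:
  assumes j: "coprime j (int h)"
  shows "(\<Sum>t<CARD('b) - 1. zeta h (j * int t) * add_char (d * s) (g ^ (s * t))) =
    of_nat s * (S0 * (\<Sum>x\<in>UNIV. A.mchar h j x * add_char d (of_nat s * x)))"
proof -
  interpret X: frobenius_characters "p ^ d" d "TYPE('b alg_closure)" "chi j" "add_char d" s
    by (rule characters)
  have "X.S s = of_nat s * X.c s"
    using pos S_vanishes[OF j] by (intro X.S_eq_c) auto
  also have "X.c s = S0 * (\<Sum>b\<in>Om.K 1. chi j b * add_char d (of_nat s * b))"
    using X.c_factor[OF odd_s] by (simp add: S0_def X.S0_def)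
  also have "(\<Sum>b\<in>Om.K 1. chi j b * add_char d (of_nat s * b)) =
      (\<Sum>x\<in>UNIV. A.mchar h j x * add_char d (of_nat s * x))"
    unfolding K1
    by (subst sum.reindex)
       (simp_all add: inj_def Eta.hom_eq chi_eta add_char_eta flip: Eta.hom_of_nat Eta.hom_mult)
  also have "X.S s = (\<Sum>y\<in>UNIV. chi j (to_ac (y ^ norm_exp)) * add_char (d * s) (y ^ s))"
  proof -
    have "(\<Prod>i<s. to_ac y ^ ((p ^ d) ^ i)) = (to_ac (y ^ norm_exp) :: 'b alg_closure)" for y :: 'b
      by (simp add: norm_exp_def power_sum to_ac_prod)
    moreover have "add_char d (\<Sum>i<s. (to_ac y ^ ((p ^ d) ^ i)) ^ s :: 'b alg_closure) = add_char (d * s) (y ^ s)" for y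
    proof -
      have "add_char d (\<Sum>i<s. (to_ac y ^ ((p ^ d) ^ i)) ^ s :: 'b alg_closure) =
        add_char d (\<Sum>i<s. (to_ac (y ^ s)) ^ ((p ^ d) ^ i) :: 'b alg_closure)"
        by (simp add: mult.commute flip: power_mult)
      also have "\<dots> = add_char (d * s) (to_ac (y ^ s) :: 'b alg_closure)"
        using add_char_tower[OF prime_Om, of d s "to_ac (y ^ s)"] by (simp add: charB)
      also have "\<dots> = add_char (d * s) (y ^ s)"
        using field_power_card[of "y ^ s"] cardB
        by (intro Ac.hom_add_char) (simp_all add: charB p)
      finally show ?thesis .
    qed
    ultimately show ?thesis
      unfolding X.S_def Ks by (subst sum.reindex) (simp_all add: inj_def)
  qed
  also have "\<dots> = (\<Sum>t<CARD('b) - 1. zeta h (j * int t) * add_char (d * s) (g ^ (s * t)))"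
  proof -
    have r0: "norm_exp > 0" using norm_exp_mult B.n_pos by (cases "norm_exp = 0") auto
    have "chi j 0 = 0" using chi_eta[of j 0] by (simp add: Eta.hom_0)
    then have "(\<Sum>y\<in>UNIV. chi j (to_ac (y ^ norm_exp)) * add_char (d * s) (y ^ s)) =
      (\<Sum>t<CARD('b) - 1. chi j (to_ac ((g ^ t) ^ norm_exp)) * add_char (d * s) ((g ^ t) ^ s))"
      using r0 by (simp add: B.sum_UNIV_nonzero B.sum_nonzero power_0_left)
    moreover have "to_ac ((g ^ t) ^ norm_exp) = eta (g1 ^ t)" for t
      by (simp add: eta_def hom_power compat' mult.commute flip: power_mult)
    ultimately show ?thesis
      by (simp add: chi_eta A.mchar_g_power[OF h_dvd_A] mult.commute[of s] power_mult)
  qed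
  finally show ?thesis .
qed

end

section \<open>Cyclotomic integers\<close>

text \<open>The ring of integer combinations of powers of \<open>zeta M 1\<close>. Purely additive
  generation makes linear functionals easy to control; closure under products is
  \<open>cyc_mult\<close>.\<close>

inductive_set cyc :: "nat \<Rightarrow> complex set" for M :: nat where
  gen: "of_int n * zeta M a \<in> cyc M"
| add: "x \<in> cyc M \<Longrightarrow> y \<in> cyc M \<Longrightarrow> x + y \<in> cyc M"

lemma cyc_int: "of_int n \<in> cyc M"
  using cyc.gen[of n M 0] by simp

lemma cyc_zeta: "zeta M a \<in> cyc M"
  using cyc.gen[of 1 M a] by simp

lemma cyc_0: "0 \<in> cyc M" and cyc_1: "1 \<in> cyc M"
  using cyc_int[of 0 M] cyc_int[of 1 M] by simp_all

lemma cyc_mult: "x \<in> cyc M \<Longrightarrow> y \<in> cyc M \<Longrightarrow> x * y \<in> cyc M"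
proof (induction arbitrary: y rule: cyc.induct)
  case (gen n a)
  from gen show ?case
  proof (induction rule: cyc.induct)
    case (gen m b)
    have "of_int n * zeta M a * (of_int m * zeta M b) = of_int (n * m) * zeta M (a + b)"
      by (simp add: zeta_add)
    then show ?case by (metis cyc.gen)
  qed (auto simp: distrib_left intro: cyc.add)
qed (auto simp: distrib_right intro: cyc.add)

lemma cyc_minus: "x \<in> cyc M \<Longrightarrow> - x \<in> cyc M"
  using cyc_mult[OF cyc_int[of "- 1"], of x M] by simp

lemma cyc_diff: "x \<in> cyc M \<Longrightarrow> y \<in> cyc M \<Longrightarrow> x - y \<in> cyc M"
  using cyc.add[OF _ cyc_minus, of x M y] by simp

lemma cyc_power: "x \<in> cyc M \<Longrightarrow> x ^ n \<in> cyc M"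
  by (induction n) (auto intro: cyc_1 cyc_mult)

lemma cyc_sum: "(\<And>i. i \<in> A \<Longrightarrow> f i \<in> cyc M) \<Longrightarrow> sum f A \<in> cyc M"
  by (induction A rule: infinite_finite_induct) (auto intro: cyc_0 cyc.add)

lemma cyc_prod: "(\<And>i. i \<in> A \<Longrightarrow> f i \<in> cyc M) \<Longrightarrow> prod f A \<in> cyc M"
  by (induction A rule: infinite_finite_induct) (auto intro: cyc_1 cyc_mult)

lemma cyc_zeta_dvd: "N dvd M \<Longrightarrow> M > 0 \<Longrightarrow> zeta N a \<in> cyc M"
proof -
  assume "N dvd M" "M > 0"
  then obtain L where "M = N * L" "L > 0" by (auto elim!: dvdE)
  then show ?thesis using cyc_zeta[of M "a * int L"] by (simp add: zeta_cancel)
qed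

text \<open>Extend {1} to a basis of the complex numbers over the rationals. The functional replaces
  any knowledge of the degree of the cyclotomic field.\<close>

lemma rat_functional: "\<exists>T :: complex \<Rightarrow> rat. (\<forall>x y. T (x + y) = T x + T y) \<and>
  (\<forall>q x. T (of_rat q * x) = q * T x) \<and> T 1 = 1"
proof -
  interpret V: vector_space_pair "\<lambda>(q :: rat) (x :: complex). of_rat q * x" "\<lambda>(q :: rat) (x :: rat). q * x"
    by unfold_locales (simp_all add: algebra_simps of_rat_add of_rat_mult)
  have "V.vs1.independent {1 :: complex}"
    by (subst V.vs1.independent_insert) (simp add: V.vs1.independent_empty)
  from V.linear_independent_extend[OF this, of "\<lambda>_. 1"]
  obtain T where "Vector_Spaces.linear (\<lambda>q x. of_rat q * x) (\<lambda>q x. q * x) T" "T (1 :: complex) = (1 :: rat)"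
    by auto
  then show ?thesis
    by (intro exI[of _ T]) (auto simp: V.linear_add V.linear_scale)
qed

text \<open>A rational number all of whose powers lie in the lattice of cyclotomic integers is an
  integer, since a rational linear functional has bounded denominators on the lattice.\<close>

lemma int_dvd_of_cyc:
  assumes M: "M > 0" and q: "prime q" and eq: "of_int n = of_nat q * b" and b: "b \<in> cyc M"
  shows "int q dvd n"
proof (rule ccontr)
  assume nd: "\<not> int q dvd n"
  obtain T :: "complex \<Rightarrow> rat" where T: "\<And>x y. T (x + y) = T x + T y"
    "\<And>q x. T (of_rat q * x) = q * T x" "T 1 = 1"
    using rat_functional by blast
  have q0: "q > 0" using q prime_gt_0_nat by blast
  define den where "den i = snd (quotient_of (T (zeta M (int i))))" for i :: nat
  define N where "N = (\<Prod>i<M. den i)"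
  have den: "den i > 0" for i unfolding den_def by (rule quotient_of_denom_pos')
  then have N: "N > 0" unfolding N_def by (simp add: prod_pos)
  have NT: "of_int N * T (zeta M a) \<in> \<int>" for a
  proof -
    define i where "i = nat (a mod int M)"
    have i: "i < M" "zeta M a = zeta M (int i)"
      using M by (auto simp: i_def nat_less_iff intro!: zeta_cong)
    have "den i dvd N" unfolding N_def using i by (intro dvd_prodI) auto
    then obtain l where l: "N = den i * l" by (elim dvdE)
    have "T (zeta M a) = of_int (fst (quotient_of (T (zeta M a)))) / of_int (den i)"
      using quotient_of_div[of "T (zeta M a)"] by (simp add: i den_def prod_eq_iff)
    then have "of_int N * T (zeta M a) = of_int (l * fst (quotient_of (T (zeta M a))))"
      using den[of i] by (simp add: l field_simps)
    then show ?thesis by simp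
  qed
  have int: "of_int N * T x \<in> \<int>" if "x \<in> cyc M" for x
    using that
  proof induction
    case (gen n a)
    have "T (of_int n * zeta M a) = of_int n * T (zeta M a)"
      using T(2)[of "of_int n" "zeta M a"] by simp
    then have eq: "of_int N * T (of_int n * zeta M a) = of_int n * (of_int N * T (zeta M a))" by simp
    show ?case unfolding eq by (intro Ints_mult Ints_of_int NT)
  qed (simp add: T(1) distrib_left)
  have dv: "int q ^ m dvd N * n ^ m" for m
  proof -
    have "b = of_rat (of_int n / of_nat q)" using eq q0 by (simp add: of_rat_divide field_simps)
    then have "b ^ m = of_rat ((of_int n / of_nat q) ^ m) * 1" by (simp add: of_rat_power)
    then have "T (b ^ m) = (of_int n / of_nat q) ^ m" by (simp only: T(2,3))
    moreover have "of_int N * T (b ^ m) \<in> \<int>" using int cyc_power[OF b] by blast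
    ultimately obtain z :: int where "of_int N * (of_int n / of_nat q) ^ m = (of_int z :: rat)"
      by (auto elim: Ints_cases)
    then have "(of_int (N * n ^ m) :: rat) = of_int (z * int q ^ m)"
      using q0 by (simp add: power_divide field_simps)
    then have "N * n ^ m = z * int q ^ m" by (simp only: of_int_eq_iff)
    then show ?thesis by simp
  qed
  have "coprime (int q) n" using q nd by (simp add: prime_imp_coprime)
  then have "int q ^ m dvd N" for m using dv[of m] by (simp add: coprime_dvd_mult_left_iff)
  then have "int q ^ nat N \<le> N" using N zdvd_imp_le by blast
  moreover have "N < int q ^ nat N"
  proof -
    have "nat N < 2 ^ nat N" by simp
    also have "\<dots> \<le> q ^ nat N" using prime_ge_2_nat[OF q] by (simp add: power_mono)
    finally show ?thesis using N by (simp add: nat_less_iff)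
  qed
  ultimately show False by simp
qed

text \<open>The binomial theorem modulo q, iterated e times; oddness of q keeps the sign of
  -x.\<close>

lemma one_minus_power_prime:
  assumes q: "prime q" "odd q" and x: "x \<in> cyc M"
  shows "\<exists>w\<in>cyc M. (1 - x) ^ (q ^ e) = 1 - x ^ (q ^ e) + of_nat q * w"
proof (induction e)
  case 0
  then show ?case using cyc_0 by (intro bexI[of _ 0]) auto
next
  case (Suc e)
  then obtain w where w: "w \<in> cyc M" "(1 - x) ^ (q ^ e) = 1 - x ^ (q ^ e) + of_nat q * w" by blast
  define y where "y = 1 - x ^ (q ^ e)"
  have y: "y \<in> cyc M" unfolding y_def by (intro cyc_diff cyc_1 cyc_power x)
  have q0: "q > 0" using q prime_gt_0_nat by blast
  have binom: "\<exists>v\<in>cyc M. (a + b) ^ q = a ^ q + b ^ q + of_nat q * v" if "a \<in> cyc M" "b \<in> cyc M" for a b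
  proof -
    have "(a + b) ^ q = (\<Sum>i\<le>q. of_nat (q choose i) * a ^ i * b ^ (q - i))" by (rule binomial_ring)
    also have "{..q} = insert 0 (insert q {1..<q})" using q0 by auto
    also have "(\<Sum>i\<in>insert 0 (insert q {1..<q}). of_nat (q choose i) * a ^ i * b ^ (q - i)) =
       b ^ q + (a ^ q + (\<Sum>i\<in>{1..<q}. of_nat (q choose i) * a ^ i * b ^ (q - i)))"
      using q0 by simp
    also have "(\<Sum>i\<in>{1..<q}. of_nat (q choose i) * a ^ i * b ^ (q - i)) =
       of_nat q * (\<Sum>i\<in>{1..<q}. of_int (int ((q choose i) div q)) * (a ^ i * b ^ (q - i)))"
      unfolding sum_distrib_left
    proof (rule sum.cong[OF refl])
      fix i assume "i \<in> {1..<q}"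
      then have "q dvd (q choose i)" using q by (intro dvd_choose_prime) auto
      then have "(of_nat (q choose i) :: complex) = of_nat q * of_nat ((q choose i) div q)"
        by (metis dvd_mult_div_cancel of_nat_mult)
      then show "of_nat (q choose i) * a ^ i * b ^ (q - i) =
        of_nat q * (of_int (int ((q choose i) div q)) * (a ^ i * b ^ (q - i)))" by simp
    qed
    finally have "(a + b) ^ q = a ^ q + b ^ q + of_nat q *
      (\<Sum>i\<in>{1..<q}. of_int (int ((q choose i) div q)) * (a ^ i * b ^ (q - i)))" by simp
    moreover have "(\<Sum>i\<in>{1..<q}. of_int (int ((q choose i) div q)) * (a ^ i * b ^ (q - i))) \<in> cyc M"
      using that by (intro cyc_sum cyc_mult cyc_int cyc_power)
    ultimately show ?thesis by blast
  qed
  have qc: "of_nat q \<in> cyc M" using cyc_int[of "int q" M] by simp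
  obtain u where u: "u \<in> cyc M" "(y + of_nat q * w) ^ q = y ^ q + (of_nat q * w) ^ q + of_nat q * u"
    using binom[OF y cyc_mult[OF qc w(1)]] by blast
  have xq: "- (x ^ (q ^ e)) \<in> cyc M" using cyc_minus[OF cyc_power[OF x]] .
  obtain v where v: "v \<in> cyc M" "(1 + - (x ^ (q ^ e))) ^ q = 1 ^ q + (- (x ^ (q ^ e))) ^ q + of_nat q * v"
    using binom[OF cyc_1 xq] by blast
  have "(of_nat q * w) ^ q = of_nat q * (w * (of_nat q * w) ^ (q - 1))"
    using q0 by (metis mult.assoc power_eq_if gr_implies_not0)
  moreover have "(1 - x) ^ (q ^ Suc e) = ((1 - x) ^ (q ^ e)) ^ q" by (simp add: mult.commute flip: power_mult)
  ultimately have "(1 - x) ^ (q ^ Suc e) = 1 - x ^ (q ^ Suc e) + of_nat q * (v + w * (of_nat q * w) ^ (q - 1) + u)"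
    using u(2) v(2) q(2) unfolding w(2) y_def[symmetric]
    by (simp add: y_def distrib_left mult.commute flip: power_mult)
  moreover have "v + w * (of_nat q * w) ^ (q - 1) + u \<in> cyc M"
    by (intro cyc.add cyc_mult cyc_power v w u qc)
  ultimately show ?case by blast
qed

text \<open>Raising the equation to the power q^e turns 1 - x into a multiple of q in the ring, as
  x^(q^e) = 1. This stands in for working with a prime ideal above q.\<close>

lemma int_dvd_of_one_minus:
  assumes M: "M > 0" and q: "prime q" "odd q" and x: "x \<in> cyc M" "x ^ (q ^ e) = 1"
    and eq: "of_int n = (1 - x) * b" and b: "b \<in> cyc M"
  shows "int q dvd n"
proof -
  obtain w where w: "w \<in> cyc M" "(1 - x) ^ (q ^ e) = 1 - x ^ (q ^ e) + of_nat q * w"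
    using one_minus_power_prime[OF q x(1)] by blast
  have "of_int (n ^ (q ^ e)) = (1 - x) ^ (q ^ e) * b ^ (q ^ e)"
    by (simp add: eq power_mult_distrib)
  also have "\<dots> = of_nat q * (w * b ^ (q ^ e))" using w(2) x(2) by simp
  finally have "int q dvd n ^ (q ^ e)"
    by (rule int_dvd_of_cyc[OF M q(1)]) (intro cyc_mult w cyc_power b)
  moreover have "prime (int q)" using q(1) by simp
  ultimately show ?thesis using prime_dvd_power by metis
qed

text \<open>1 + X + ... + X^(q-1) and the product of the X - zeta^i are monic of degree q - 1 with q
  - 1 common roots, hence equal; evaluate at 1.\<close>

lemma prod_one_minus_roots:
  assumes q: "prime q"
  shows "(\<Prod>i\<in>{1..<q}. 1 - zeta q (int i)) = of_nat q"
proof -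
  have q1: "q > 1" using q prime_gt_1_nat by blast
  define F where "F = (\<Sum>i<q. Polynomial.monom (1 :: complex) i)"
  define G where "G = (\<Prod>i\<in>{1..<q}. [:- zeta q (int i), 1:])"
  have cF: "coeff F i = (if i < q then 1 else 0)" for i
    by (simp add: F_def coeff_sum)
  have G': "G = (\<Prod>x\<in>#image_mset (\<lambda>i. zeta q (int i)) (mset_set {1..<q}). [:- x, 1:])"
    unfolding G_def prod_unfold_prod_mset by (simp add: multiset.map_comp o_def)
  have "degree G = q - 1" unfolding G' degree_prod_linear by simp
  moreover have "lead_coeff G = 1" unfolding G' by (rule monic_prod_linear)
  ultimately have degG: "degree G = q - 1" "coeff G (q - 1) = 1" by simp_all
  have "F - G = 0"
  proof (rule ccontr)
    assume nz: "F - G \<noteq> 0"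
    have "degree (F - G) \<le> q - 1"
    proof (rule degree_diff_le)
      show "degree F \<le> q - 1" by (intro degree_le) (auto simp: cF)
      show "degree G \<le> q - 1" using degG by simp
    qed
    moreover have "coeff (F - G) (q - 1) = 0" using degG q1 by (simp add: cF)
    ultimately have "degree (F - G) < q - 1" using nz by (metis leading_coeff_0_iff le_neq_implies_less)
    moreover have "(\<lambda>i. zeta q (int i)) ` {1..<q} \<subseteq> {x. poly (F - G) x = 0}"
    proof
      fix x assume "x \<in> (\<lambda>i. zeta q (int i)) ` {1..<q}"
      then obtain i where i: "x = zeta q (int i)" "i \<in> {1..<q}" by blast
      have "\<not> q dvd i" using i(2) by (auto dest: dvd_imp_le)
      then have "poly F x = 0"
        using zeta_sum[of q "int i"] q1 by (simp add: F_def poly_sum poly_monom i(1) zeta_power)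
      moreover have "poly G x = 0" using i by (auto simp: G_def poly_prod)
      ultimately show "x \<in> {x. poly (F - G) x = 0}" by simp
    qed
    then have "card ((\<lambda>i. zeta q (int i)) ` {1..<q}) \<le> card {x. poly (F - G) x = 0}"
      using poly_roots_finite[OF nz] by (intro card_mono)
    moreover have "card ((\<lambda>i. zeta q (int i)) ` {1..<q}) = q - 1"
    proof (subst card_image)
      show "inj_on (\<lambda>i. zeta q (int i)) {1..<q}"
      proof (rule inj_onI)
        fix a b assume ab: "a \<in> {1..<q}" "b \<in> {1..<q}" "zeta q (int a) = zeta q (int b)"
        have "zeta q (int a) = zeta q (int a - int b) * zeta q (int b)" by (simp flip: zeta_add)
        then have "zeta q (int a - int b) = 1" using ab(3) by simp
        then have "int q dvd int a - int b" using q1 by (simp add: zeta_eq_1_iff)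
        then have "a mod q = b mod q" by (metis mod_eq_dvd_iff of_nat_eq_iff zmod_int)
        then show "a = b" using ab by simp
      qed
    qed simp
    ultimately show False using card_poly_roots_bound[OF nz] by linarith
  qed
  then have "poly F 1 = poly G 1" by simp
  then show ?thesis by (simp add: F_def G_def poly_sum poly_monom poly_prod)
qed

section \<open>Linear independence of the powers of a root of unity of prime order\<close>

definition ipoly :: "int poly \<Rightarrow> complex \<Rightarrow> complex" where
  "ipoly B z = poly (map_poly of_int B) z"

lemma ipoly_add: "ipoly (A + B) z = ipoly A z + ipoly B z"
proof -
  have "map_poly of_int (A + B) = (map_poly of_int A + map_poly of_int B :: complex poly)"
    by (intro poly_eqI) (simp add: coeff_map_poly)
  then show ?thesis by (simp add: ipoly_def)
qed

lemma ipoly_0 [simp]: "ipoly 0 z = 0"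
  by (simp add: ipoly_def)

lemma ipoly_pCons: "ipoly (pCons a B) z = of_int a + z * ipoly B z"
  by (cases "pCons a B = 0") (simp_all add: ipoly_def map_poly_pCons)

lemma ipoly_smult: "ipoly (smult a B) z = of_int a * ipoly B z"
proof -
  have "map_poly of_int (smult a B) = (smult (of_int a) (map_poly of_int B) :: complex poly)"
    by (intro poly_eqI) (simp add: coeff_map_poly)
  then show ?thesis by (simp add: ipoly_def)
qed

lemma ipoly_cyc: "z \<in> cyc M \<Longrightarrow> ipoly B z \<in> cyc M"
  by (induction B) (auto simp: ipoly_pCons intro!: cyc.add cyc_int cyc_mult cyc_0)

text \<open>Divide B by X - 1. The remainder B(1) is divisible by 1 - zeta, hence by q, hence by (1
  - zeta)^(q-1); so the quotient at zeta is divisible by (1 - zeta)^(m-1) and induction applies. The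
  disjunct \<open>B = 0\<close> covers m = 0.\<close>

lemma eisenstein_step:
  assumes q: "prime q" "odd q" and m: "m \<le> q - 1" and B: "degree B < m \<or> B = 0"
    and eq: "ipoly B (zeta q 1) = (1 - zeta q 1) ^ m * b" and b: "b \<in> cyc q"
  shows "int q dvd coeff B i"
  using m B eq b
proof (induction m arbitrary: B b i)
  case (Suc m)
  have q1: "q > 1" using q prime_gt_1_nat by blast
  define z where "z = zeta q 1"
  have z: "z \<in> cyc q" "z ^ (q ^ 1) = 1" "z \<noteq> 1"
    using q1 zeta_eq_1_iff[of q 1] zeta_eq_1_iff[of q "int q"] by (auto simp: z_def cyc_zeta zeta_power)
  define B1 where "B1 = synthetic_div B 1"
  have "B + B1 = pCons (poly B 1) B1" using synthetic_div_correct[of B 1] by (simp add: B1_def)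
  then have B_eq: "ipoly B z + ipoly B1 z = of_int (poly B 1) + z * ipoly B1 z"
    and cB: "coeff B i = coeff (pCons (poly B 1) B1) i - coeff B1 i" for i
    by (metis ipoly_add ipoly_pCons, metis add_diff_cancel_right' coeff_add)
  have eqB: "ipoly B z = (1 - z) ^ Suc m * b" using Suc.prems(3) by (simp add: z_def)
  have "of_int (poly B 1) = ipoly B z + ipoly B1 z - z * ipoly B1 z" unfolding B_eq by simp
  also have "\<dots> = (1 - z) * ((1 - z) ^ m * b + ipoly B1 z)"
    unfolding eqB by (simp add: algebra_simps)
  finally have "of_int (poly B 1) = (1 - z) * ((1 - z) ^ m * b + ipoly B1 z)" .
  moreover have "(1 - z) ^ m * b + ipoly B1 z \<in> cyc q"
    by (intro cyc.add cyc_mult cyc_power cyc_diff cyc_1 ipoly_cyc z Suc.prems)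
  ultimately have qB: "int q dvd poly B 1"
    using int_dvd_of_one_minus[of q q z 1] q q1 z by auto
  then obtain c where c: "poly B 1 = int q * c" by (elim dvdE)
  define u where "u = (\<Prod>i\<in>{1..<q}. \<Sum>l<i. z ^ l)"
  have "(\<Prod>i\<in>{1..<q}. 1 - zeta q (int i)) = (\<Prod>i\<in>{1..<q}. (1 - z) * (\<Sum>l<i. z ^ l))"
  proof (intro prod.cong refl)
    fix i
    have "1 - zeta q (int i) = 1 - z ^ i" by (simp add: z_def zeta_power)
    then show "1 - zeta q (int i) = (1 - z) * (\<Sum>l<i. z ^ l)" by (simp only: one_diff_power_eq)
  qed
  then have pq: "of_nat q = (1 - z) ^ (q - 1) * u"
    unfolding prod_one_minus_roots[OF q(1)] by (simp add: prod.distrib u_def)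
  have u: "u \<in> cyc q" unfolding u_def by (intro cyc_prod cyc_sum cyc_power z)
  \<comment> \<open>The exponent q - 2 - m is what remains of q - 1 after removing m + 1 factors 1 -
    z; the first summand comes from B(1) = q c.\<close>
  define b1 where "b1 = (1 - z) ^ (q - 2 - m) * u * of_int c - b"
  have "(1 - z) * ipoly B1 z = of_int (poly B 1) - ipoly B z" using B_eq by (simp add: algebra_simps)
  also have "\<dots> = (1 - z) * ((1 - z) ^ m * b1)"
  proof -
    have "q - 1 = Suc m + (q - 2 - m)" using Suc.prems(1) by simp
    then have "of_nat q = (1 - z) ^ Suc m * (1 - z) ^ (q - 2 - m) * u" using pq by (metis power_add)
    then have "of_int (poly B 1) = (1 - z) ^ Suc m * (1 - z) ^ (q - 2 - m) * u * of_int c"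
      by (simp add: c)
    then show ?thesis unfolding eqB b1_def by (simp add: algebra_simps)
  qed
  finally have "ipoly B1 z = (1 - z) ^ m * b1" using z(3) by simp
  moreover have "b1 \<in> cyc q" unfolding b1_def
    by (intro cyc_diff cyc_mult cyc_power cyc_1 cyc_int z u Suc.prems)
  moreover have "degree B1 < m \<or> B1 = 0"
    using Suc.prems(2) by (auto simp: B1_def degree_synthetic_div synthetic_div_eq_0_iff)
  ultimately have IH: "int q dvd coeff B1 i" for i
    using Suc.IH[of B1 b1 i] Suc.prems(1) by (simp add: z_def)
  show ?case unfolding cB using IH qB by (auto simp: coeff_pCons split: nat.splits)
qed simp

text \<open>Zero is divisible by every power of 1 - zeta, so q divides all coefficients of B;
  dividing by q gives an infinite descent on the leading coefficient.\<close>

lemma cyclotomic_independent: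
  assumes q: "prime q" "odd q" and B: "degree B < q - 1" "ipoly B (zeta q 1) = 0"
  shows "B = 0"
  using B
proof (induction "nat \<bar>lead_coeff B\<bar>" arbitrary: B rule: less_induct)
  case less
  have q1: "q > 1" using q prime_gt_1_nat by blast
  have "int q dvd coeff B i" for i
    using eisenstein_step[OF q, of "q - 1" B 0 i] less.prems cyc_0 by simp
  then have "[:int q:] dvd B" by (simp add: const_poly_dvd_iff)
  then obtain B' where B': "B = smult (int q) B'" by (auto elim!: dvdE)
  show ?case
  proof (rule ccontr)
    assume nz: "B \<noteq> 0"
    then have "lead_coeff B' \<noteq> 0" using B' by auto
    then have "\<bar>lead_coeff B'\<bar> < \<bar>lead_coeff B\<bar>" using q1 by (simp add: B' abs_mult)
    then have "nat \<bar>lead_coeff B'\<bar> < nat \<bar>lead_coeff B\<bar>" by linarith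
    moreover have "degree B' < q - 1" using less.prems(1) q1 by (simp add: B')
    moreover have "ipoly B' (zeta q 1) = 0" using less.prems(2) q1 by (simp add: B' ipoly_smult)
    ultimately have "B' = 0" using less.hyps by blast
    then show False using nz B' by simp
  qed
qed

text \<open>By independence a vanishing sum of q-th roots of unity uses every residue modulo q
  equally often, and then its conjugates vanish as well.\<close>

lemma vanishing_sum_conjugate:
  fixes H :: "nat set"
  assumes q: "prime q" "odd q" and H: "finite H" "(\<Sum>i\<in>H. zeta q (int i)) = 0" and j: "\<not> int q dvd j"
  shows "(\<Sum>i\<in>H. zeta q (j * int i)) = 0"
proof -
  have q1: "q > 1" using q prime_gt_1_nat by blast
  define c where "c r = card {i\<in>H. i mod q = r}" for r
  have grp: "(\<Sum>i\<in>H. zeta q (l * int i)) = (\<Sum>r<q. of_nat (c r) * zeta q (l * int r))" for l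
  proof -
    have "(\<Sum>i\<in>H. zeta q (l * int i)) = (\<Sum>r<q. \<Sum>i\<in>{i\<in>H. i mod q = r}. zeta q (l * int i))"
      using H(1) q1 by (intro sum.group[symmetric]) auto
    also have "\<dots> = (\<Sum>r<q. of_nat (c r) * zeta q (l * int r))"
    proof (rule sum.cong[OF refl])
      fix r
      have "zeta q (l * int i) = zeta q (l * int r)" if "i mod q = r" for i
      proof (rule zeta_cong)
        have "int q dvd int i - int r" using that by (metis mod_eq_dvd_iff mod_mod_trivial zmod_int)
        then show "int q dvd l * int i - l * int r" by (simp flip: right_diff_distrib)
      qed (use q1 in simp)
      then show "(\<Sum>i\<in>{i\<in>H. i mod q = r}. zeta q (l * int i)) = of_nat (c r) * zeta q (l * int r)"
        by (simp add: c_def)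
    qed
    finally show ?thesis .
  qed
  \<comment> \<open>Subtracting the multiplicity of the residue q - 1 from all of them does not
    change the sum, as 1 + ... + zeta^(q-1) = 0, and brings the degree below q - 1.\<close>
  define B where "B = (\<Sum>r<q - 1. Polynomial.monom (int (c r) - int (c (q - 1))) r)"
  have cB: "coeff B r = (if r < q - 1 then int (c r) - int (c (q - 1)) else 0)" for r
    by (simp add: B_def coeff_sum)
  have "ipoly B z = (\<Sum>r<q - 1. of_int (int (c r) - int (c (q - 1))) * z ^ r)" for z
  proof -
    have "ipoly (\<Sum>r<n. Polynomial.monom (a r) r) z = (\<Sum>r<n. of_int (a r) * z ^ r)" for n a
      by (induction n) (auto simp: ipoly_add, simp add: ipoly_def map_poly_monom poly_monom)
    then show ?thesis by (simp add: B_def)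
  qed
  then have "ipoly B (zeta q 1) = (\<Sum>r<q - 1. (of_nat (c r) - of_nat (c (q - 1))) * zeta q (int r))"
    by (simp add: zeta_power)
  also have "\<dots> = (\<Sum>r<q. (of_nat (c r) - of_nat (c (q - 1))) * zeta q (int r))"
    using q1 by (cases q) auto
  also have "\<dots> = (\<Sum>r<q. of_nat (c r) * zeta q (1 * int r)) - of_nat (c (q - 1)) * (\<Sum>r<q. zeta q (1 * int r))"
    by (simp add: left_diff_distrib sum_subtractf sum_distrib_left)
  also have "\<dots> = 0" unfolding grp[symmetric] using H(2) zeta_sum[of q 1] q1 by simp
  finally have ev: "ipoly B (zeta q 1) = 0" .
  have "degree B \<le> q - 2" by (intro degree_le) (auto simp: cB)
  moreover have "q \<noteq> 2" using q(2) by auto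
  ultimately have "B = 0" using cyclotomic_independent[OF q _ ev] q1 by simp
  then have c: "c r = c (q - 1)" if "r < q" for r
  proof (cases "r = q - 1")
    case False
    then have "r < q - 1" using that by simp
    then show ?thesis using cB[of r] \<open>B = 0\<close> by (simp del: One_nat_def)
  qed simp
  have "(\<Sum>i\<in>H. zeta q (j * int i)) = of_nat (c (q - 1)) * (\<Sum>r<q. zeta q (j * int r))"
    unfolding grp sum_distrib_left
  proof (rule sum.cong[OF refl])
    fix r assume "r \<in> {..<q}"
    then have "c r = c (q - 1)" by (intro c) simp
    then show "of_nat (c r) * zeta q (j * int r) = of_nat (c (q - 1)) * zeta q (j * int r)" by (simp only:)
  qed
  then show ?thesis using zeta_sum[of q j] j q1 by simp
qed

section \<open>The ratio of the Gauss sums\<close>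

lemma add_char_cyc:
  assumes "CHAR('a::field) dvd M" "M > 0"
  shows "add_char m (x :: 'a) \<in> cyc M"
  unfolding add_char_def prime_char_def using assms by (rule cyc_zeta_dvd)

lemma one_minus_zeta_even:
  assumes "even a"
  shows "\<exists>w\<in>cyc N. 1 - zeta N (int a) = (1 - zeta N 2) * w"
proof -
  obtain l where l: "a = 2 * l" using assms by (elim evenE)
  have "1 - zeta N (int a) = 1 - zeta N 2 ^ l" by (simp add: l zeta_power)
  also have "\<dots> = (1 - zeta N 2) * (\<Sum>i<l. zeta N 2 ^ i)" by (rule one_diff_power_eq)
  finally show ?thesis by (blast intro: cyc_sum cyc_power cyc_zeta)
qed

text \<open>For odd c the exponents t and c t differ by an even number. With N = k the root
  \<open>zeta N 2\<close> has p1-power order, so 1 - \<open>zeta N 2\<close> is a modulus to which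
  \<open>int_dvd_of_one_minus\<close> applies.\<close>

lemma zeta_diff:
  assumes "odd c"
  shows "\<exists>w\<in>cyc N. zeta N (int t) - zeta N (int c * int t) = (1 - zeta N 2) * w"
proof -
  have "even ((c - 1) * t)" using assms by simp
  from one_minus_zeta_even[OF this, of N] obtain w where
    w: "w \<in> cyc N" "1 - zeta N (int ((c - 1) * t)) = (1 - zeta N 2) * w" by blast
  have "int c * int t = int t + int ((c - 1) * t)"
    using assms by (cases c) (auto simp: algebra_simps)
  then have "zeta N (int t) - zeta N (int c * int t) = zeta N (int t) * (1 - zeta N (int ((c - 1) * t)))"
    by (simp only: zeta_add) (simp add: algebra_simps)
  also have "\<dots> = (1 - zeta N 2) * (zeta N (int t) * w)" unfolding w(2) by (simp only: mult_ac)
  finally show ?thesis using cyc_mult[OF cyc_zeta w(1)] by blast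
qed

lemma cyc_mono: "x \<in> cyc N \<Longrightarrow> N dvd M \<Longrightarrow> M > 0 \<Longrightarrow> x \<in> cyc M"
  by (induction rule: cyc.induct) (auto intro: cyc.add cyc_mult cyc_int cyc_zeta_dvd)

context field_tower
begin

text \<open>The map x -> x^p permutes the field and preserves the absolute trace, while it
  multiplies the index of the multiplicative character by p.\<close>

lemma gauss_frobenius: "B.gauss k (j * int p) = B.gauss k j"
proof -
  have ds: "d * s > 0" using d_pos pos by simp
  have pw: "x ^ (p ^ (d * s)) = x" for x :: 'b using field_power_card[of x] cardB by simp
  have p_eq: "p * p ^ (d * s - 1) = p ^ (d * s)" using ds by (simp flip: power_Suc)
  have inv: "(x ^ p) ^ (p ^ (d * s - 1)) = x" "(x ^ (p ^ (d * s - 1))) ^ p = x" for x :: 'b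
    by (simp_all only: power_mult[symmetric] mult.commute[of _ p] p_eq pw)
  have "B.mchar k (j * int p) x = B.mchar k j (x ^ p)" for x
  proof (cases "x = 0")
    case False
    then obtain t where t: "x = g ^ t" using B.ex_g_power by blast
    have "x ^ p = g ^ (t * p)" by (simp add: t power_mult)
    then show ?thesis unfolding t
      by (simp add: B.mchar_g_power[OF k_dvd_B] mult_ac flip: power_mult)
  qed (use pos in \<open>simp add: power_0_left\<close>)
  moreover have "add_char (d * s) (x ^ p) = add_char (d * s) x" for x :: 'b
    using add_char_power[of x "d * s"] pw[of x] by (simp add: charB p)
  ultimately have "B.gauss k (j * int p) = (\<Sum>x\<in>UNIV. B.mchar k j (x ^ p) * add_char (d * s) (x ^ p))"
    by (simp add: B.gauss_def)
  also have "\<dots> = B.gauss k j"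
    unfolding B.gauss_def
    by (rule sum.reindex_bij_witness[of _ "\<lambda>x. x ^ (p ^ (d * s - 1))" "\<lambda>x. x ^ p"])
       (simp_all only: inv UNIV_I)
  finally show ?thesis .
qed

lemma gauss_orbit:
  assumes j: "coprime j k"
  shows "B.gauss k (int (j + h * m)) = B.gauss k (int j)"
proof -
  obtain i where "[j + h * m = j * (p ^ d) ^ i] (mod k)" using residue_orbit[OF j] by blast
  then have "int k dvd int (j + h * m) - int (j * p ^ (d * i))"
    by (metis cong_iff_dvd_diff cong_int_iff power_mult)
  then have "B.gauss k (int (j + h * m)) = B.gauss k (int (j * p ^ (d * i)))"
    using pos B.gauss_cong by blast
  also have "B.gauss k (int (j * p ^ l)) = B.gauss k (int j)" for l
  proof (induction l)
    case (Suc l)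
    have "int (j * p ^ Suc l) = int (j * p ^ l) * int p" by simp
    then show ?case by (simp only: gauss_frobenius Suc)
  qed simp
  finally show ?thesis .
qed

text \<open>The Gauss sums at j + h m with m < s agree by \<open>gauss_orbit\<close>; their sum
  detects the exponents divisible by s, and each of these is reached s times by t -> s t.\<close>

lemma gauss_power_sum:
  assumes j: "coprime j k"
  shows "of_nat s * B.gauss k (int j) =
    (\<Sum>t<CARD('b) - 1. zeta h (int j * int t) * add_char (d * s) (g ^ (s * t)))"
proof -
  define F where "F t = zeta k (int j * int t) * add_char (d * s) (g ^ t)" for t
  obtain n' where n': "CARD('b) - 1 = s * n'"
    using k_dvd_B k_eq by (metis dvd_mult_right dvdE)
  have per: "F (t + (CARD('b) - 1)) = F t" for t
  proof -
    have "int k dvd int (CARD('b) - 1)" using k_dvd_B by (simp only: int_dvd_int_iff)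
    then have "int k dvd int j * int (t + (CARD('b) - 1)) - int j * int t"
      unfolding of_nat_add distrib_left by simp
    then have "zeta k (int j * int (t + (CARD('b) - 1))) = zeta k (int j * int t)"
      using pos by (intro zeta_cong)
    then show ?thesis by (simp only: F_def power_add B.g_n mult_1_right)
  qed
  have "of_nat s * B.gauss k (int j) = (\<Sum>m<s. B.gauss k (int (j + h * m)))"
    by (simp only: gauss_orbit[OF j] sum_constant card_lessThan)
  also have "\<dots> = (\<Sum>t<CARD('b) - 1. \<Sum>m<s. zeta k (int (j + h * m) * int t) * add_char (d * s) (g ^ t))"
    unfolding B.gauss_altdef[OF k_dvd_B] by (rule sum.swap)
  also have "\<dots> = (\<Sum>t<CARD('b) - 1. of_nat s * (if s dvd t then F t else 0))"
  proof (rule sum.cong[OF refl])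
    fix t
    have "zeta k (int (j + h * m) * int t) = zeta k (int j * int t) * zeta s (int t * int m)" for m
    proof -
      have "zeta s (int t * int m) = zeta k (int t * int m * int h)"
        using zeta_cancel[of h s "int t * int m"] pos by (simp add: k_eq mult.commute[of h])
      then show ?thesis by (simp add: algebra_simps flip: zeta_add)
    qed
    then have "(\<Sum>m<s. zeta k (int (j + h * m) * int t) * add_char (d * s) (g ^ t)) =
      F t * (\<Sum>m<s. zeta s (int t * int m))"
      by (simp add: F_def sum_distrib_left sum_distrib_right mult_ac)
    then show "(\<Sum>m<s. zeta k (int (j + h * m) * int t) * add_char (d * s) (g ^ t)) =
      of_nat s * (if s dvd t then F t else 0)"
      using zeta_sum[of s "int t"] pos by simp
  qed
  also have "\<dots> = (\<Sum>t<CARD('b) - 1. F (s * t))"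
    unfolding sum_distrib_left[symmetric] using sum_periodic_multiples[where F = F, OF n' pos(1) per] by simp
  also have "\<dots> = (\<Sum>t<CARD('b) - 1. zeta h (int j * int t) * add_char (d * s) (g ^ (s * t)))"
  proof (rule sum.cong[OF refl])
    fix t
    have "zeta k (int j * int (s * t)) = zeta h (int j * int t)"
      using zeta_cancel[of s h "int j * int t"] pos by (simp add: k_eq mult_ac)
    then show "F (s * t) = zeta h (int j * int t) * add_char (d * s) (g ^ (s * t))" by (simp add: F_def)
  qed
  finally show ?thesis .
qed

lemma s_neq_0: "(of_nat s :: 'a) \<noteq> 0"
proof
  assume "(of_nat s :: 'a) = 0"
  then have "p dvd p1 ^ (e1 - 1)" by (simp only: of_nat_eq_0_iff_char_dvd charA s)
  then have "p dvd p1" using p(1) prime_dvd_power by blast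
  then show False using p(1) p1(1) ne primes_dvd_imp_eq by blast
qed

text \<open>The quadratic character at s: the cost of replacing \<psi>(s b), as Newton's identities
  produce it, by \<psi>(b).\<close>

definition sign_s :: complex where "sign_s = A.mchar h (int p1) (of_nat s)"

text \<open>As \<open>gcd(p1, p - 1) = 1\<close>, characters of order \<open>p1\<close> are trivial on the prime field.\<close>

lemma mchar_s: "odd j \<Longrightarrow> A.mchar h j (of_nat s) = sign_s" and sign_s_cases: "sign_s = 1 \<or> sign_s = - 1"
proof -
  obtain t where t: "of_nat s = g1 ^ t" using A.ex_g_power[OF s_neq_0] by blast
  have "\<not> p dvd s" using s_neq_0 by (simp add: of_nat_eq_0_iff_char_dvd charA)
  then have "[s ^ (p - 1) = 1] (mod p)" using p(1) by (intro fermat_theorem) auto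
  then have "(of_nat (s ^ (p - 1)) :: 'a) = of_nat 1" by (simp only: of_nat_eq_iff_cong_CHAR charA)
  then have "g1 ^ (t * (p - 1)) = 1" by (simp add: t power_mult)
  then have "p ^ d - 1 dvd t * (p - 1)" by (simp add: A.g_power_eq_1_iff cardA)
  then have "p1 dvd t * (p - 1)" using p1_dvd dvd_trans by blast
  then have "p1 dvd t" using coprime_p1 by (simp add: coprime_dvd_mult_left_iff)
  then obtain t' where t': "t = p1 * t'" by (elim dvdE)
  have m: "A.mchar h j (of_nat s) = zeta 2 (j * int t')" for j
  proof -
    have "zeta 2 (j * int t') = zeta h (j * int t' * int p1)"
      unfolding h using pos zeta_cancel[of p1 2 "j * int t'"] by simp
    then show ?thesis by (simp add: t t' A.mchar_g_power[OF h_dvd_A] mult_ac)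
  qed
  show "odd j \<Longrightarrow> A.mchar h j (of_nat s) = sign_s" using p1(2) by (simp add: sign_s_def m zeta_2)
  show "sign_s = 1 \<or> sign_s = - 1" by (simp add: sign_s_def m zeta_2)
qed

text \<open>The constant C of the overview.\<close>

definition ratio :: complex where "ratio = S0 * sign_s"

lemma ratio_real: "cnj ratio = ratio"
  using sign_s_cases S0_real by (auto simp: ratio_def)

lemma coprime_k_h: "coprime j k \<Longrightarrow> coprime (int j) (int h)"
  by (simp add: k_eq)

lemma coprime_k_odd: "coprime j k \<Longrightarrow> odd j"
  unfolding k by auto

text \<open>Equate the two evaluations of the twisted power sum; the factor s cancels, and rescaling
  x by s turns the remaining sum into a Gauss sum.\<close>

lemma gauss_lift:
  assumes j: "coprime j k"
  shows "B.gauss k (int j) = ratio * A.gauss h (int j)"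
proof -
  have "(\<Sum>x\<in>UNIV. A.mchar h (int j) x * add_char d (of_nat s * x)) = sign_s * A.gauss h (int j)"
  proof -
    have sg2: "sign_s * sign_s = 1" using sign_s_cases by auto
    have "A.mchar h (int j) x = sign_s * A.mchar h (int j) (of_nat s * x)" for x
      unfolding A.mchar_mult[OF h_dvd_A] using mchar_s[of "int j"] coprime_k_odd[OF j] sg2
      by (simp add: mult.assoc[symmetric])
    then have "(\<Sum>x\<in>UNIV. A.mchar h (int j) x * add_char d (of_nat s * x)) =
      (\<Sum>x\<in>UNIV. sign_s * A.mchar h (int j) (of_nat s * x) * add_char d (of_nat s * x))"
      by (metis (no_types, lifting))
    also have "\<dots> = (\<Sum>x\<in>UNIV. sign_s * A.mchar h (int j) x * add_char d x)"
      by (rule sum.reindex_bij_witness[of _ "\<lambda>x. x / of_nat s" "\<lambda>x. of_nat s * x"])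
         (simp_all add: s_neq_0)
    finally show ?thesis by (simp add: A.gauss_def sum_distrib_left mult.assoc)
  qed
  then have "of_nat s * B.gauss k (int j) = of_nat s * (S0 * (sign_s * A.gauss h (int j)))"
    using gauss_power_sum[OF j] twisted_power_sum[OF coprime_k_h[OF j]] by simp
  then show ?thesis using pos by (simp add: ratio_def)
qed

text \<open>Compare moduli in \<open>gauss_lift\<close> at j = 1; as \<open>ratio\<close> is real,
  its square is its squared modulus.\<close>

lemma ratio_square: "ratio ^ 2 * of_nat CARD('a) = of_nat CARD('b)"
proof -
  have "even h" "even k" by (simp_all add: h k)
  then have "h \<noteq> 1" "k \<noteq> 1" by (metis odd_one)+
  then have "\<not> int k dvd 1" "\<not> int h dvd 1" by simp_all
  then have "norm (B.gauss k 1) ^ 2 = of_nat CARD('b)" "norm (A.gauss h 1) ^ 2 = of_nat CARD('a)"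
    using B.norm_gauss[OF k_dvd_B] A.norm_gauss[OF h_dvd_A] by auto
  moreover have "B.gauss k 1 = ratio * A.gauss h 1" using gauss_lift[of 1] by simp
  ultimately have n: "norm ratio ^ 2 * of_nat CARD('a) = (of_nat CARD('b) :: real)"
    by (simp add: norm_mult power_mult_distrib)
  have "of_real (norm ratio ^ 2) = ratio ^ 2"
    using complex_norm_square[of ratio] by (simp add: ratio_real power2_eq_square)
  then have "ratio ^ 2 * of_nat CARD('a) = of_real (norm ratio ^ 2 * of_nat CARD('a))" by simp
  then show ?thesis unfolding n by simp
qed

lemma odd_norm_exp: "odd norm_exp"
proof -
  have "odd (\<Sum>i<n. (p ^ d) ^ i) \<longleftrightarrow> odd n" for n using p(2) by (induction n) auto
  then show ?thesis using odd_s by (simp add: norm_exp_def)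
qed

text \<open>The sign is determined by the congruence of Gauss sums modulo \<open>1 - \<zeta>\<close> for a root of
  unity \<open>\<zeta>\<close> of order a power of \<open>p1\<close>, which identifies a character with its quadratic part.\<close>

lemma gauss_lift_quad: "B.gauss k (int (p1 * s)) = ratio * A.gauss h (int p1)"
proof -
  define GB where "GB = B.gauss k (int (p1 * s))"
  define GA where "GA = A.gauss h (int p1)"
  have k2: "k = 2 * (p1 * s)" by (simp add: k_eq h)
  have nk: "\<not> int k dvd int (p1 * s)" "int k dvd 2 * int (p1 * s)"
    using pos unfolding k2 int_dvd_int_iff by (auto dest: dvd_imp_le)
  have nh: "\<not> int h dvd int p1" "int h dvd 2 * int p1"
    using pos unfolding h int_dvd_int_iff by (auto dest: dvd_imp_le)
  \<comment> \<open>The element -1 has logarithm t over the small field and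
    \<open>norm_exp * t\<close> over the large one. As \<open>norm_exp\<close> is odd, the quadratic
    characters agree at -1, which leaves only the sign of \<open>GB\<close> open.\<close>
  obtain t where t: "- 1 = g1 ^ t" using A.ex_g_power[of "- 1"] by auto
  have "(- 1 :: 'b) = emb (- 1)" by (simp add: hom_minus hom_1)
  also have "\<dots> = g ^ (norm_exp * t)" by (simp add: t hom_power compat' power_mult)
  finally have t2: "- 1 = g ^ (norm_exp * t)" .
  have mA: "A.mchar h (int p1) (- 1) = zeta 2 (int t)"
    unfolding t A.mchar_g_power[OF h_dvd_A] using zeta_cancel[of p1 2 "int t"] pos by (simp add: h mult_ac)
  have "B.mchar k (int (p1 * s)) (- 1) = zeta 2 (int (norm_exp * t))"
    unfolding t2 B.mchar_g_power[OF k_dvd_B] using zeta_cancel[of "p1 * s" 2 "int (norm_exp * t)"] pos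
    by (simp add: k2 mult_ac)
  then have mB: "B.mchar k (int (p1 * s)) (- 1) = zeta 2 (int t)" using odd_norm_exp by (simp add: zeta_2)
  have GB2: "GB ^ 2 = zeta 2 (int t) * of_nat CARD('b)"
    unfolding GB_def using B.gauss_quadratic[OF k_dvd_B nk] mB by simp
  have GA2: "GA ^ 2 = zeta 2 (int t) * of_nat CARD('a)"
    unfolding GA_def using A.gauss_quadratic[OF h_dvd_A nh] mA by simp
  have "GB ^ 2 = (ratio * GA) ^ 2"
    by (simp add: GB2 GA2 power_mult_distrib ratio_square[symmetric] mult_ac)
  then have cases: "GB = ratio * GA \<or> GB = - (ratio * GA)" by (simp only: power2_eq_iff)
  moreover have "GB \<noteq> - (ratio * GA)"
  proof
    assume neg: "GB = - (ratio * GA)"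
    \<comment> \<open>Level k p contains the values of the multiplicative and additive characters of
      both fields.\<close>
    define M where "M = k * p"
    have M: "M > 0" "k dvd M" "p dvd M" "h dvd M" using pos by (simp_all add: M_def k_eq)
    define \<pi> where "\<pi> = 1 - zeta k 2"
    have \<psi>A: "add_char d x \<in> cyc M" for x :: 'a using M by (intro add_char_cyc) (simp_all add: charA)
    have \<psi>B: "add_char (d * s) x \<in> cyc M" for x :: 'b using M by (intro add_char_cyc) (simp_all add: charB)
    have \<psi>O: "add_char d x \<in> cyc M" for x :: "'b alg_closure"
      using M by (intro add_char_cyc) (simp_all add: charB)
    have Ek: "zeta k a \<in> cyc M" "zeta h a \<in> cyc M" for a using M by (auto intro: cyc_zeta_dvd)
    have ratio_cyc: "ratio \<in> cyc M"
    proof -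
      have "sign_s \<in> cyc M" using sign_s_cases cyc_1 cyc_minus[OF cyc_1] by auto
      then show ?thesis unfolding ratio_def S0_def by (intro cyc_mult cyc_sum \<psi>O)
    qed
    have GA_cyc: "GA \<in> cyc M"
      unfolding GA_def A.gauss_altdef[OF h_dvd_A] by (intro cyc_sum cyc_mult Ek \<psi>A)
    have "odd (p1 * s)" using p1(2) odd_s by simp
    from zeta_diff[OF this, of k]
    have "\<exists>w\<in>cyc M. zeta k (int t) - zeta k (int (p1 * s) * int t) = \<pi> * w" for t
      unfolding \<pi>_def using cyc_mono[OF _ M(2,1)] by blast
    then obtain w where w: "\<And>t. w t \<in> cyc M" "\<And>t. zeta k (int t) - zeta k (int (p1 * s) * int t) = \<pi> * w t"
      by metis
    have "\<exists>v\<in>cyc M. zeta h (int t) - zeta h (int p1 * int t) = \<pi> * v" for t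
    proof -
      have "zeta h a = zeta k (a * int s)" for a using zeta_cancel[of s h a] pos by (simp add: k_eq)
      then have "zeta h (int t) - zeta h (int p1 * int t) =
          zeta k (int (t * s)) - zeta k (int p1 * int (t * s))"
        by (simp add: mult.assoc)
      then show ?thesis
        unfolding \<pi>_def using zeta_diff[OF p1(2), of k "t * s"] cyc_mono[OF _ M(2,1)] by metis
    qed
    then obtain v where v: "\<And>t. v t \<in> cyc M" "\<And>t. zeta h (int t) - zeta h (int p1 * int t) = \<pi> * v t"
      by metis
    define W where "W = (\<Sum>t<CARD('b) - 1. w t * add_char (d * s) (g ^ t))"
    define V where "V = (\<Sum>t<CARD('a) - 1. v t * add_char d (g1 ^ t))"
    have WV: "W \<in> cyc M" "V \<in> cyc M" unfolding W_def V_def by (intro cyc_sum cyc_mult w v \<psi>A \<psi>B)+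
    have B1: "B.gauss k 1 - GB = \<pi> * W"
      unfolding GB_def B.gauss_altdef[OF k_dvd_B] W_def sum_distrib_left sum_subtractf[symmetric]
      by (intro sum.cong refl) (simp add: w(2)[symmetric] left_diff_distrib mult.assoc[symmetric])
    have A1: "A.gauss h 1 - GA = \<pi> * V"
      unfolding GA_def A.gauss_altdef[OF h_dvd_A] V_def sum_distrib_left sum_subtractf[symmetric]
      by (intro sum.cong refl) (simp add: v(2)[symmetric] left_diff_distrib mult.assoc[symmetric])
    have lift1: "B.gauss k 1 = ratio * A.gauss h 1" using gauss_lift[of 1] by simp
    have e: "2 * (ratio * GA) = \<pi> * W - ratio * (\<pi> * V)"
      unfolding B1[symmetric] A1[symmetric] lift1 neg by (simp add: algebra_simps)
    \<comment> \<open>With the wrong sign, 2 C \<open>GA\<close> is a multiple of 1 -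
      \<open>zeta k 2\<close>; one more factor C \<open>GA\<close> makes it the rational integer 2q
      or -2q, which p1 does not divide.\<close>
    have "2 * (ratio ^ 2 * GA ^ 2) = 2 * (ratio * GA) * (ratio * GA)"
      by (simp add: power2_eq_square mult_ac)
    also have "\<dots> = \<pi> * ((W - ratio * V) * (ratio * GA))"
      unfolding e by (simp add: algebra_simps)
    finally have "2 * (ratio ^ 2 * GA ^ 2) = \<pi> * ((W - ratio * V) * (ratio * GA))" .
    moreover have "2 * (ratio ^ 2 * GA ^ 2) = of_int ((if even t then 1 else - 1) * 2 * int (p ^ (d * s)))"
    proof -
      have "ratio ^ 2 * GA ^ 2 = zeta 2 (int t) * of_nat CARD('b)"
        unfolding GA2 ratio_square[symmetric] by (simp add: mult_ac)
      then show ?thesis by (simp add: zeta_2 cardB)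
    qed
    ultimately have eq: "of_int ((if even t then 1 else - 1) * 2 * int (p ^ (d * s))) =
      (1 - zeta k 2) * ((W - ratio * V) * (ratio * GA))" by (simp only: \<pi>_def)
    have "zeta k 2 ^ (p1 ^ e1) = 1" using zeta_eq_1_iff[of k "2 * int (p1 ^ e1)"] pos by (simp add: zeta_power k)
    then have "int p1 dvd (if even t then 1 else - 1) * 2 * int (p ^ (d * s))"
      by (rule int_dvd_of_one_minus[OF M(1) p1 Ek(1) _ eq])
         (intro cyc_mult cyc_diff WV ratio_cyc GA_cyc)
    then have "int p1 dvd int (2 * p ^ (d * s))" by (auto split: if_splits)
    then have "p1 dvd 2 * p ^ (d * s)" by (simp only: int_dvd_int_iff)
    then have "p1 dvd 2 \<or> p1 dvd p" using p1(1) prime_dvd_mult_iff prime_dvd_power by blast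
    then show False using p1 p ne by (metis primes_dvd_imp_eq two_is_prime_nat even_numeral)
  qed
  ultimately show ?thesis by (simp add: GA_def GB_def)
qed

end

section \<open>Lifting difference sets\<close>

lemma sum_lessThan_mult:
  fixes F :: "nat \<Rightarrow> complex"
  shows "(\<Sum>j<h * s. F j) = (\<Sum>r<h. \<Sum>m<s. F (r + h * m))"
proof -
  have "(\<Sum>j<s * h. F j) = (\<Sum>m<s. sum F {m * h..<m * h + h})"
    by (rule sum.nat_group[symmetric])
  also have "\<dots> = (\<Sum>m<s. \<Sum>r<h. F (r + h * m))"
  proof (rule sum.cong[OF refl])
    fix m
    show "sum F {m * h..<m * h + h} = (\<Sum>r<h. F (r + h * m))"
      by (rule sum.reindex_bij_witness[of _ "\<lambda>r. r + h * m" "\<lambda>j. j - h * m"]) (auto simp: mult.commute)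
  qed
  also have "\<dots> = (\<Sum>r<h. \<Sum>m<s. F (r + h * m))" by (rule sum.swap)
  finally show ?thesis by (simp add: mult.commute)
qed

context field_tower
begin

text \<open>As s is odd, 2 is invertible modulo s, so exactly one of the shifts 2 i makes the
  exponent divisible by s. The quotient b gives the frequency over the small field that matches
  g^a.\<close>

lemma ex_shift: "\<exists>i b. i < s \<and> a + 2 * i = s * b \<and> (\<forall>i'<s. s dvd a + 2 * i' \<longleftrightarrow> i' = i)"
proof -
  obtain n where n: "s = 2 * n + 1" using odd_s by (elim oddE)
  \<comment> \<open>u = (s + 1)/2 inverts 2 modulo s, and s - 1 below stands for -1 among the
    natural numbers.\<close>
  define u where "u = n + 1"
  have "2 * u = s + 1" by (simp add: u_def n)
  then have u: "[2 * u = 1] (mod s)" by (simp only: cong_def mod_add_self1)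
  define i where "i = (u * (a * (s - 1))) mod s"
  have i: "i < s" using pos by (simp add: i_def)
  have "[a + 2 * i = a + 2 * (u * (a * (s - 1)))] (mod s)"
    by (intro cong_add cong_mult cong_refl) (simp add: i_def cong_def)
  also have "a + 2 * (u * (a * (s - 1))) = a + (2 * u) * (a * (s - 1))" by simp
  also have "[a + (2 * u) * (a * (s - 1)) = a + 1 * (a * (s - 1))] (mod s)"
    by (intro cong_add cong_mult cong_refl u)
  also have "a + 1 * (a * (s - 1)) = a * s" using pos by (cases s) auto
  also have "[a * s = 0] (mod s)" by (simp add: cong_def)
  finally have dv: "s dvd a + 2 * i" by (simp add: cong_0_iff)
  then obtain b where b: "a + 2 * i = s * b" by (elim dvdE)
  have "i' = i" if "i' < s" "s dvd a + 2 * i'" for i'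
  proof -
    have "[a + 2 * i' = a + 2 * i] (mod s)" using that dv by (simp add: cong_def dvd_eq_mod_eq_0)
    then have "[i' = i] (mod s)" using odd_s by (simp add: cong_add_lcancel_nat cong_mult_lcancel_nat)
    then show ?thesis using that i by (simp add: cong_def)
  qed
  then show ?thesis using i b dv by blast
qed

text \<open>The contribution to the Fourier transform of the lifted set of the characters whose index is
  congruent to \<open>j\<close> modulo \<open>h\<close>.\<close>

definition fibre :: "nat \<Rightarrow> nat \<Rightarrow> complex" where
  "fibre a j = (\<Sum>m<s. \<Sum>i<s. B.gauss k (int (j + h * m)) * zeta k (- (int (j + h * m) * int (a + 2 * i))))"

text \<open>The Gauss sum is constant on the class of j modulo h, so the sum over m is a full sum of
  s-th roots of unity and selects the one shift i with s dividing a + 2 i.\<close>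

lemma fibre_coprime:
  assumes j: "coprime j h" and i: "i < s" "a + 2 * i = s * b" "\<forall>i'<s. s dvd a + 2 * i' \<longleftrightarrow> i' = i"
  shows "fibre a j = of_nat s * ratio * A.gauss h (int j) * zeta h (- (int j * int b))"
proof -
  have cop: "coprime (j + h * m) k" for m
  proof -
    have ch: "coprime (j + h * m) h" using j by (metis coprime_iff_gcd_eq_1 gcd_add_mult gcd.commute mult.commute add.commute)
    then have "coprime (j + h * m) p1" by (simp add: h)
    then have "coprime (j + h * m) s" by (simp add: s)
    with ch show ?thesis by (simp add: k_eq)
  qed
  have G: "B.gauss k (int (j + h * m)) = ratio * A.gauss h (int j)" for m
    using gauss_lift[OF cop, of m] A.gauss_cong[of h "int (j + h * m)" "int j"] pos by simp
  have Ek: "zeta k (- (int (j + h * m) * int c)) = zeta k (- (int j * int c)) * zeta s (- int c * int m)" for m c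
  proof -
    have "zeta s (- int c * int m) = zeta k (- int c * int m * int h)"
      using zeta_cancel[of h s "- int c * int m"] pos by (simp add: k_eq mult.commute[of h])
    then show ?thesis by (simp add: algebra_simps flip: zeta_add)
  qed
  have "fibre a j = (\<Sum>i<s. \<Sum>m<s. ratio * A.gauss h (int j) * zeta k (- (int (j + h * m) * int (a + 2 * i))))"
    unfolding fibre_def G by (rule sum.swap)
  also have "\<dots> = (\<Sum>i'<s. ratio * A.gauss h (int j) * zeta k (- (int j * int (a + 2 * i'))) *
       (\<Sum>m<s. zeta s (- int (a + 2 * i') * int m)))"
    unfolding Ek sum_distrib_left by (simp only: mult.assoc)
  also have "\<dots> = (\<Sum>i'<s. if i' = i then of_nat s * ratio * A.gauss h (int j) * zeta k (- (int j * int (a + 2 * i))) else 0)"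
  proof (rule sum.cong[OF refl])
    fix i' assume i': "i' \<in> {..<s}"
    have "int s dvd - int (a + 2 * i') \<longleftrightarrow> i' = i"
      unfolding dvd_minus_iff int_dvd_int_iff using i(3) i' by simp
    then show "ratio * A.gauss h (int j) * zeta k (- (int j * int (a + 2 * i'))) *
       (\<Sum>m<s. zeta s (- int (a + 2 * i') * int m)) =
      (if i' = i then of_nat s * ratio * A.gauss h (int j) * zeta k (- (int j * int (a + 2 * i))) else 0)"
      using zeta_sum[of s "- int (a + 2 * i')"] pos by simp
  qed
  also have "\<dots> = of_nat s * ratio * A.gauss h (int j) * zeta k (- (int j * int (a + 2 * i)))"
    using i(1) by simp
  also have "zeta k (- (int j * int (a + 2 * i))) = zeta h (- (int j * int b))"
    using zeta_cancel[of s h "- (int j * int b)"] pos unfolding i(2) by (simp add: k_eq mult_ac)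
  finally show ?thesis .
qed

text \<open>Summing over the shifts 2 i removes the characters of index p1 l with s not dividing l.
  This leaves the trivial character in the class 0 modulo h and the quadratic one in the class
  p1.\<close>

lemma fibre_p1_multiple:
  "(\<Sum>i<s. zeta k (- (int (p1 * l) * int (a + 2 * i)))) =
    (if s dvd l then of_nat s * zeta (2 * s) (- (int l * int a)) else 0)"
proof -
  have k2: "k = (2 * s) * p1" by (simp add: k_eq h)
  have "zeta k (- (int (p1 * l) * int (a + 2 * i))) = zeta (2 * s) (- (int l * int a)) * zeta s (- int l * int i)" for i
  proof -
    have "zeta k (- (int (p1 * l) * int (a + 2 * i))) = zeta (2 * s) (- (int l * int (a + 2 * i)))"
      using zeta_cancel[of p1 "2 * s" "- (int l * int (a + 2 * i))"] pos by (simp add: k2 mult_ac)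
    also have "zeta s (- int l * int i) = zeta (2 * s) (- int l * int i * 2)"
      using zeta_cancel[of 2 s "- int l * int i"] by (simp add: mult.commute)
    then have "zeta (2 * s) (- (int l * int (a + 2 * i))) = zeta (2 * s) (- (int l * int a)) * zeta s (- int l * int i)"
      by (simp add: algebra_simps flip: zeta_add)
    finally show ?thesis .
  qed
  then show ?thesis
    using zeta_sum[of s "- int l"] pos by (simp flip: sum_distrib_left)
qed

lemma fibre_0: "fibre a 0 = - of_nat s"
proof -
  have hm: "0 + h * m = p1 * (2 * m)" for m by (simp add: h)
  have dv: "s dvd 2 * m \<longleftrightarrow> m = 0" if "m < s" for m
  proof -
    have "s dvd 2 * m \<longleftrightarrow> s dvd m" using odd_s by (simp add: coprime_dvd_mult_right_iff)
    then show ?thesis using that by (auto dest: dvd_imp_le)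
  qed
  have "fibre a 0 = (\<Sum>m<s. B.gauss k (int (p1 * (2 * m))) *
     (if s dvd 2 * m then of_nat s * zeta (2 * s) (- (int (2 * m) * int a)) else 0))"
    unfolding fibre_def hm sum_distrib_left[symmetric] fibre_p1_multiple ..
  also have "\<dots> = (\<Sum>m<s. if m = 0 then B.gauss k 0 * of_nat s else 0)"
    by (intro sum.cong refl) (use dv in auto)
  also have "\<dots> = - of_nat s" using pos B.gauss_0[OF k_dvd_B] by simp
  finally show ?thesis .
qed

text \<open>The only survivor is m = (s - 1)/2, of index p1 s = k/2. Its root of unity depends on a
  parity alone, and a and b have the same parity because a + 2 i = s b with s odd.\<close>

lemma fibre_p1:
  assumes i: "a + 2 * i = s * b"
  shows "fibre a p1 = of_nat s * ratio * A.gauss h (int p1) * zeta h (- (int p1 * int b))"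
proof -
  obtain n where n: "s = 2 * n + 1" using odd_s by (elim oddE)
  have hm: "p1 + h * m = p1 * (2 * m + 1)" for m by (simp add: h)
  have dv: "s dvd 2 * m + 1 \<longleftrightarrow> m = n" if "m < s" for m
  proof
    assume "s dvd 2 * m + 1"
    then obtain l where l: "2 * m + 1 = s * l" by (elim dvdE)
    have "s * l < s * 2" unfolding l[symmetric] using that by simp
    then have "l < 2" by simp
    moreover have "l \<noteq> 0" using l by (cases "l = 0") simp_all
    ultimately have "l = 1" by simp
    then show "m = n" using l n by simp
  qed (simp add: n)
  have "fibre a p1 = (\<Sum>m<s. B.gauss k (int (p1 * (2 * m + 1))) *
     (if s dvd 2 * m + 1 then of_nat s * zeta (2 * s) (- (int (2 * m + 1) * int a)) else 0))"
    unfolding fibre_def hm sum_distrib_left[symmetric] fibre_p1_multiple ..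
  also have "\<dots> = (\<Sum>m<s. if m = n then B.gauss k (int (p1 * s)) * (of_nat s * zeta (2 * s) (- (int s * int a))) else 0)"
  proof (rule sum.cong[OF refl])
    fix m assume m: "m \<in> {..<s}"
    have ns: "2 * n + 1 = s" using n by simp
    show "B.gauss k (int (p1 * (2 * m + 1))) *
        (if s dvd 2 * m + 1 then of_nat s * zeta (2 * s) (- (int (2 * m + 1) * int a)) else 0) =
      (if m = n then B.gauss k (int (p1 * s)) * (of_nat s * zeta (2 * s) (- (int s * int a))) else 0)"
    proof (cases "m = n")
      case True
      then show ?thesis by (simp only: ns if_True dvd_refl refl)
    next
      case False
      then show ?thesis using dv[of m] m by (simp del: of_nat_mult of_nat_add)
    qed
  qed
  also have "\<dots> = B.gauss k (int (p1 * s)) * (of_nat s * zeta (2 * s) (- (int s * int a)))"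
  proof -
    have "n \<in> {..<s}" using n by simp
    then show ?thesis by (simp only: sum.delta[OF finite_lessThan] if_True)
  qed
  also have "zeta (2 * s) (- (int s * int a)) = zeta 2 (- int a)"
    using zeta_cancel[of s 2 "- int a"] pos by (simp add: mult_ac)
  also have "\<dots> = zeta 2 (- int b)"
  proof -
    have "even (a + 2 * i) \<longleftrightarrow> even (s * b)" using i by simp
    then have "even a \<longleftrightarrow> even b" using odd_s by simp
    then show ?thesis by (simp add: zeta_2)
  qed
  also have "\<dots> = zeta h (- (int p1 * int b))"
    using zeta_cancel[of p1 2 "- int b"] pos by (simp add: h mult_ac)
  finally show ?thesis unfolding gauss_lift_quad by (simp add: mult_ac)
qed

text \<open>For even j the roots of unity involved are p1-th ones, and the sum is a Galois conjugate
  of the assumed relation.\<close>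

lemma vanishing_even:
  assumes H: "finite H" "(\<Sum>i\<in>H. zeta p1 (int i)) = 0" and j: "even j" "\<not> p1 dvd j"
  shows "(\<Sum>i\<in>H. zeta h (- (int j * int i))) = 0"
proof -
  obtain l where l: "j = 2 * l" using j(1) by (elim evenE)
  have "zeta h (- (int j * int i)) = zeta p1 (- int l * int i)" for i
    using zeta_cancel[of 2 p1 "- int l * int i"] by (simp add: h l mult_ac)
  moreover have "\<not> int p1 dvd - int l" using j(2) by (auto simp: l)
  ultimately show ?thesis using vanishing_sum_conjugate[OF p1 H, of "- int l"] by simp
qed

lemma coprime_h_iff: "coprime j h \<longleftrightarrow> odd j \<and> \<not> p1 dvd j"
proof -
  have "coprime j p1 \<longleftrightarrow> \<not> p1 dvd j"
    using p1(1) by (metis coprime_commute prime_imp_coprime coprime_absorb_left not_prime_unit)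
  then show ?thesis by (simp add: h)
qed

section \<open>Fourier transforms of the two unions of classes\<close>

context
  fixes H :: "nat set"
  assumes H: "H \<subseteq> {0..<h}" and H0: "(\<Sum>i\<in>H. zeta p1 (int i)) = 0"
begin

definition "base_set = (\<Union>i\<in>H. cyclotomic_class h g1 i)"

definition "lift_set = (\<Union>i1\<in>{0..<s}. \<Union>i\<in>H. cyclotomic_class k g (2 * i1 + i * s))"

lemma finH: "finite H"
  using H finite_subset by blast

definition "weight j = (\<Sum>i\<in>H. zeta h (- (int j * int i)))"

lemma sum_base_set: "(\<Sum>x\<in>base_set. F x) = (\<Sum>i\<in>H. \<Sum>x\<in>cyclotomic_class h g1 i. F x)" for F :: "'a \<Rightarrow> complex"
  unfolding base_set_def
proof (rule A.union_class_sum[OF h_dvd_A finH])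
  show "inj_on (\<lambda>i. i mod h) H"
    using H by (intro inj_onI) (auto simp: subset_iff)
qed

text \<open>The classes are disjoint: modulo s the index determines i1, because 2 is invertible
  there, and then i modulo h.\<close>

lemma sum_lift_set: "(\<Sum>x\<in>lift_set. F x) = (\<Sum>i1<s. \<Sum>i\<in>H. \<Sum>x\<in>cyclotomic_class k g (2 * i1 + i * s). F x)"
  for F :: "'b \<Rightarrow> complex"
proof -
  define c where "c = (\<lambda>(i1, i). 2 * i1 + i * s)"
  have inj: "inj_on (\<lambda>x. c x mod k) ({..<s} \<times> H)"
  proof (rule inj_onI)
    fix x y assume xy: "x \<in> {..<s} \<times> H" "y \<in> {..<s} \<times> H" "c x mod k = c y mod k"
    obtain i1 i j1 j where ij: "x = (i1, i)" "y = (j1, j)" by (cases x, cases y)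
    have eq: "[2 * i1 + i * s = 2 * j1 + j * s] (mod k)" using xy(3) by (simp add: c_def ij cong_def)
    have sk: "s dvd k" by (simp add: k_eq)
    have "[2 * i1 + i * s = 2 * j1 + j * s] (mod s)" using eq sk by (rule cong_dvd_modulus_nat)
    then have "[2 * i1 = 2 * j1] (mod s)" by (simp add: cong_def)
    then have "[i1 = j1] (mod s)" using odd_s by (simp add: cong_mult_lcancel_nat)
    then have i1: "i1 = j1" using xy(1,2) by (simp add: ij cong_def)
    then have "[i * s = j * s] (mod h * s)" using eq by (simp add: cong_add_lcancel_nat k_eq)
    then have "(i mod h) * s = (j mod h) * s" by (simp add: cong_def mult_mod_left)
    then have "i mod h = j mod h" using pos by simp
    moreover have "i < h" "j < h" using xy(1,2) H by (auto simp: ij)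
    ultimately show "x = y" using i1 ij by simp
  qed
  then have injc: "inj_on c ({..<s} \<times> H)" by (auto simp: inj_on_def)
  have injmod: "inj_on (\<lambda>i. i mod k) (c ` ({..<s} \<times> H))"
    using inj by (auto simp: inj_on_def)
  have "lift_set = (\<Union>x\<in>c ` ({..<s} \<times> H). cyclotomic_class k g x)"
    by (force simp: lift_set_def c_def)
  then have "(\<Sum>x\<in>lift_set. F x) = (\<Sum>i\<in>c ` ({..<s} \<times> H). \<Sum>x\<in>cyclotomic_class k g i. F x)"
    using finH injmod by (simp only:, intro B.union_class_sum[OF k_dvd_B]) auto
  also have "\<dots> = (\<Sum>p\<in>{..<s} \<times> H. \<Sum>x\<in>cyclotomic_class k g (c p). F x)"
    using injc by (simp add: sum.reindex)
  also have "\<dots> = (\<Sum>i1<s. \<Sum>i\<in>H. \<Sum>x\<in>cyclotomic_class k g (2 * i1 + i * s). F x)"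
    by (simp add: sum.cartesian_product c_def case_prod_beta)
  finally show ?thesis .
qed

lemma card_base_set: "h * card base_set = card H * (CARD('a) - 1)"
proof -
  have "of_nat (card base_set) = (\<Sum>i\<in>H. of_nat (card (cyclotomic_class h g1 i)) :: complex)"
    using sum_base_set[of "\<lambda>_. 1"] by simp
  then have "of_nat (card base_set) = (of_nat (\<Sum>i\<in>H. card (cyclotomic_class h g1 i)) :: complex)" by simp
  then have "card base_set = (\<Sum>i\<in>H. card (cyclotomic_class h g1 i))" by (simp only: of_nat_eq_iff)
  then show ?thesis by (simp add: sum_distrib_left A.card_class[OF h_dvd_A])
qed

lemma card_lift_set: "k * card lift_set = s * card H * (CARD('b) - 1)"
proof -
  have "of_nat (card lift_set) = (\<Sum>i1<s. \<Sum>i\<in>H. of_nat (card (cyclotomic_class k g (2 * i1 + i * s))) :: complex)"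
    using sum_lift_set[of "\<lambda>_. 1"] by simp
  then have "of_nat (card lift_set) = (of_nat (\<Sum>i1<s. \<Sum>i\<in>H. card (cyclotomic_class k g (2 * i1 + i * s))) :: complex)" by simp
  then have "card lift_set = (\<Sum>i1<s. \<Sum>i\<in>H. card (cyclotomic_class k g (2 * i1 + i * s)))" by (simp only: of_nat_eq_iff)
  then show ?thesis by (simp add: sum_distrib_left B.card_class[OF k_dvd_B])
qed

text \<open>A union of classes that is half of the nonzero elements forces |H| = h/2, and this
  proportion is the same in the large field.\<close>

lemma card_transfer:
  assumes "2 * card base_set + 1 = CARD('a)"
  shows "card H = p1" "2 * card lift_set + 1 = CARD('b)"
proof -
  have "2 * card base_set = CARD('a) - 1" using assms by simp
  then have "h * (CARD('a) - 1) = 2 * card H * (CARD('a) - 1)" using card_base_set by (metis mult.assoc mult.left_commute)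
  then show c: "card H = p1" using A.n_pos by (simp add: h)
  have "k * (2 * card lift_set) = k * (CARD('b) - 1)"
    using card_lift_set by (simp add: c k_eq h)
  then have "2 * card lift_set = CARD('b) - 1" using pos by simp
  then show "2 * card lift_set + 1 = CARD('b)" using B.n_pos by simp
qed

lemma hat_base_set: "A.hat base_set (g1 ^ b) = (\<Sum>j<h. weight j * (A.gauss h (int j) * zeta h (- (int j * int b)))) / of_nat h"
proof -
  have "A.hat base_set (g1 ^ b) = (\<Sum>i\<in>H. (\<Sum>j<h. A.gauss h (int j) * zeta h (- (int j * (int b + int i)))) / of_nat h)"
    unfolding A.hat_def sum_base_set A.class_char_sum[OF h_dvd_A] ..
  also have "\<dots> = (\<Sum>i\<in>H. \<Sum>j<h. zeta h (- (int j * int i)) * (A.gauss h (int j) * zeta h (- (int j * int b)))) / of_nat h"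
  proof -
    have "zeta h (- (int j * (int b + int i))) = zeta h (- (int j * int i)) * zeta h (- (int j * int b))" for i j
      by (simp add: algebra_simps flip: zeta_add)
    then show ?thesis by (simp add: sum_divide_distrib mult_ac)
  qed
  also have "\<dots> = (\<Sum>j<h. weight j * (A.gauss h (int j) * zeta h (- (int j * int b)))) / of_nat h"
    unfolding weight_def sum_distrib_right by (subst sum.swap) (rule refl)
  finally show ?thesis .
qed

text \<open>Write the character index as j + h m. The factor from H depends only on j, because its
  exponents are multiples of s and h s = k; the rest is \<open>fibre\<close>.\<close>

lemma hat_lift_set: "B.hat lift_set (g ^ a) = (\<Sum>j<h. weight j * fibre a j) / of_nat k"
proof -
  have Hj: "(\<Sum>i\<in>H. zeta k (- (int (j + h * m) * int (i * s)))) = weight j" for j m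
    unfolding weight_def
  proof (rule sum.cong[OF refl])
    fix i
    have "zeta k (- (int (j + h * m) * int (i * s))) = zeta h (- (int (j + h * m) * int i))"
      using zeta_cancel[of s h "- (int (j + h * m) * int i)"] pos by (simp add: k_eq mult_ac)
    also have "\<dots> = zeta h (- (int j * int i))"
      using pos by (intro zeta_cong) (simp_all add: algebra_simps)
    finally show "zeta k (- (int (j + h * m) * int (i * s))) = zeta h (- (int j * int i))" .
  qed
  have "B.hat lift_set (g ^ a) = (\<Sum>i1<s. \<Sum>i\<in>H. (\<Sum>j<k. B.gauss k (int j) *
      zeta k (- (int j * (int a + int (2 * i1 + i * s))))) / of_nat k)"
    unfolding B.hat_def sum_lift_set B.class_char_sum[OF k_dvd_B] ..
  also have "\<dots> = (\<Sum>i1<s. \<Sum>i\<in>H. \<Sum>j<k. B.gauss k (int j) *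
      zeta k (- (int j * int (a + 2 * i1))) * zeta k (- (int j * int (i * s)))) / of_nat k"
  proof -
    have "zeta k (- (int j * (int a + int (2 * i1 + i * s)))) =
      zeta k (- (int j * int (a + 2 * i1))) * zeta k (- (int j * int (i * s)))" for i1 i j
      by (simp add: algebra_simps flip: zeta_add)
    then show ?thesis by (simp add: sum_divide_distrib mult.assoc)
  qed
  also have "(\<Sum>i1<s. \<Sum>i\<in>H. \<Sum>j<k. B.gauss k (int j) *
      zeta k (- (int j * int (a + 2 * i1))) * zeta k (- (int j * int (i * s)))) =
    (\<Sum>i1<s. \<Sum>j<k. \<Sum>i\<in>H. B.gauss k (int j) *
      zeta k (- (int j * int (a + 2 * i1))) * zeta k (- (int j * int (i * s))))"
    by (intro sum.cong refl sum.swap)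
  also have "\<dots> = (\<Sum>j<k. \<Sum>i1<s. B.gauss k (int j) *
      zeta k (- (int j * int (a + 2 * i1))) * (\<Sum>i\<in>H. zeta k (- (int j * int (i * s)))))"
    unfolding sum_distrib_left by (rule sum.swap)
  also have "\<dots> = (\<Sum>j<h. \<Sum>m<s. \<Sum>i1<s. B.gauss k (int (j + h * m)) *
      zeta k (- (int (j + h * m) * int (a + 2 * i1))) * weight j)"
    unfolding k_eq sum_lessThan_mult unfolding k_eq[symmetric] Hj ..
  also have "\<dots> = (\<Sum>j<h. weight j * fibre a j)"
    unfolding fibre_def sum_distrib_right[symmetric] by (simp only: mult.commute)
  finally show ?thesis .
qed

text \<open>The trivial character contributes -p1/h = -1/2 to both transforms, which explains the
  summand 1/2. Every other class j contributes \<open>ratio\<close> times its counterpart, or 0 on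
  both sides when \<open>weight j\<close> vanishes.\<close>

lemma hat_transfer:
  assumes cH: "card H = p1"
  shows "\<exists>b. B.hat lift_set (g ^ a) + 1 / 2 = ratio * (A.hat base_set (g1 ^ b) + 1 / 2)"
proof -
  obtain i b where i: "i < s" "a + 2 * i = s * b" "\<forall>i'<s. s dvd a + 2 * i' \<longleftrightarrow> i' = i"
    using ex_shift by blast
  have T: "weight j * fibre a j = of_nat s * ratio * (weight j * (A.gauss h (int j) * zeta h (- (int j * int b))))"
    if "j \<in> {1..<h}" for j
  proof -
    consider "coprime j h" | "p1 dvd j" | "even j" "\<not> p1 dvd j" using coprime_h_iff by blast
    then show ?thesis
    proof cases
      case 1
      then show ?thesis using fibre_coprime[OF 1 i] by simp
    next
      case 2
      then obtain l where l: "j = p1 * l" by (elim dvdE)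
      have "p1 * l < p1 * 2" "l \<noteq> 0" using that by (auto simp: l h)
      then have "l = 1" by simp
      then show ?thesis using fibre_p1[OF i(2)] by (simp add: l)
    next
      case 3
      then have "weight j = 0" unfolding weight_def using vanishing_even[OF finH H0] by blast
      then show ?thesis by simp
    qed
  qed
  have H00: "weight 0 = of_nat p1" by (simp add: weight_def cH)
  define U where "U = (\<Sum>j\<in>{1..<h}. weight j * (A.gauss h (int j) * zeta h (- (int j * int b))))"
  have split: "(\<Sum>j<h. F j) = F 0 + (\<Sum>j\<in>{1..<h}. F j)" for F :: "nat \<Rightarrow> complex"
  proof -
    have "{..<h} = insert 0 {1..<h}" using pos by auto
    then show ?thesis by simp
  qed
  have "(\<Sum>j\<in>{1..<h}. weight j * fibre a j) = of_nat s * ratio * U"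
    unfolding U_def sum_distrib_left[of "of_nat s * ratio"] by (intro sum.cong refl T)
  then have sum1: "(\<Sum>j<h. weight j * fibre a j) = of_nat s * (ratio * U - of_nat p1)"
    using split[of "\<lambda>j. weight j * fibre a j"] by (simp only: fibre_0 H00) (simp add: algebra_simps)
  have s0: "(of_nat s :: complex) \<noteq> 0" and p0: "(of_nat p1 :: complex) \<noteq> 0" using pos by simp_all
  have half: "of_nat p1 / of_nat h = (1 / 2 :: complex)" using p0 by (simp add: h)
  have "B.hat lift_set (g ^ a) = of_nat s * (ratio * U - of_nat p1) / (of_nat s * of_nat h)"
  proof -
    have "(of_nat k :: complex) = of_nat s * of_nat h" by (simp only: k_eq of_nat_mult mult.commute)
    then show ?thesis by (simp only: hat_lift_set sum1)
  qed
  also have "\<dots> = (ratio * U - of_nat p1) / of_nat h"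
    by (rule mult_divide_mult_cancel_left[OF s0])
  finally have 1: "B.hat lift_set (g ^ a) + 1 / 2 = ratio * (U / of_nat h)"
    by (simp only: diff_divide_distrib half) simp
  have "(\<Sum>j<h. weight j * (A.gauss h (int j) * zeta h (- (int j * int b)))) = U - of_nat p1"
    using split[of "\<lambda>j. weight j * (A.gauss h (int j) * zeta h (- (int j * int b)))"]
      A.gauss_0[OF h_dvd_A] by (simp add: H00 U_def)
  then have 2: "A.hat base_set (g1 ^ b) + 1 / 2 = U / of_nat h"
    unfolding hat_base_set by (simp only: diff_divide_distrib half) simp
  show ?thesis using 1 2 by metis
qed

lemma hat_square_transfer:
  assumes cH: "card H = p1"
    and D: "\<And>c. c \<noteq> 0 \<Longrightarrow> (A.hat base_set c + 1 / 2) ^ 2 = \<epsilon> * of_nat CARD('a) / 4" and c: "c \<noteq> 0"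
  shows "(B.hat lift_set c + 1 / 2) ^ 2 = \<epsilon> * of_nat CARD('b) / 4"
proof -
  obtain a where "c = g ^ a" using B.ex_g_power[OF c] by blast
  then obtain b where "B.hat lift_set c + 1 / 2 = ratio * (A.hat base_set (g1 ^ b) + 1 / 2)"
    using hat_transfer[OF cH] by blast
  then have "(B.hat lift_set c + 1 / 2) ^ 2 = ratio ^ 2 * (A.hat base_set (g1 ^ b) + 1 / 2) ^ 2"
    by (simp only: power_mult_distrib)
  also have "\<dots> = \<epsilon> * (ratio ^ 2 * of_nat CARD('a)) / 4" using D[of "g1 ^ b"] by simp
  finally show ?thesis unfolding ratio_square .
qed

lemma skew_transfer:
  assumes D: "skew_hadamard_difference_set base_set"
  shows "skew_hadamard_difference_set lift_set"
proof (rule B.hat_imp_skew)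
  note card = A.skew_imp_card[OF D]
  show "2 * card lift_set + 1 = CARD('b)" by (rule card_transfer(2)[OF card])
  show "(B.hat lift_set c + 1 / 2) ^ 2 = - of_nat CARD('b) / 4" if "c \<noteq> 0" for c
    using hat_square_transfer[OF card_transfer(1)[OF card], of "- 1"] A.skew_imp_hat[OF D] that by simp
qed

lemma paley_transfer:
  assumes D: "paley_type_pds base_set"
  shows "paley_type_pds lift_set"
proof (rule B.hat_imp_paley)
  note card = A.paley_imp_card[OF D]
  show "2 * card lift_set + 1 = CARD('b)" by (rule card_transfer(2)[OF card])
  have "CARD('b) = CARD('a) ^ s" by (simp add: cardA cardB power_mult)
  then have "CARD('b) mod 4 = (CARD('a) mod 4) ^ s mod 4" by (simp only: power_mod)
  then show "CARD('b) mod 4 = 1" unfolding A.paley_imp_mod[OF D] by simp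
  show "0 \<notin> lift_set" by (simp add: lift_set_def)
  show "(B.hat lift_set c + 1 / 2) ^ 2 = of_nat CARD('b) / 4" if "c \<noteq> 0" for c
    using hat_square_transfer[OF card_transfer(1)[OF card], of 1] A.paley_imp_hat[OF D] that by simp
qed

end

end

text \<open>Equal indices force the orders to grow like the totients, by the factor q^(x-1).\<close>

lemma ord_prime_power:
  assumes q: "prime q" and a: "coprime a q"
    and idx: "unit_index q a = unit_index (q ^ x) a" and x: "x \<ge> 1"
  shows "ord (q ^ x) a = ord q a * q ^ (x - 1)"
proof -
  have q1: "q > 1" using q prime_gt_1_nat by blast
  have "q ^ x > 1" using q1 x by (intro one_less_power) auto
  then have "unit_index q a * ord (q ^ x) a = q ^ (x - 1) * (q - 1)"
    using unit_index_mult_ord[of "q ^ x" a] a idx q x by (simp add: totient_prime_power)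
  also have "q - 1 = unit_index q a * ord q a"
    using unit_index_mult_ord[OF q1 a] q by (simp add: totient_prime)
  finally have "unit_index q a * ord (q ^ x) a = unit_index q a * (ord q a * q ^ (x - 1))" by (simp only: mult_ac)
  moreover have "unit_index q a * ord q a = q - 1"
    using unit_index_mult_ord[OF q1 a] by (simp only: totient_prime[OF q])
  then have "unit_index q a \<noteq> 0" using q1 by (cases "unit_index q a = 0") simp_all
  ultimately show ?thesis by (simp only: mult_cancel_left) simp
qed

lemma totient_div_unit_index:
  assumes "n > 1" "coprime a n"
  shows "totient n div unit_index n a = ord n a"
proof -
  have "unit_index n a * ord n a > 0" using assms unit_index_mult_ord[OF assms] by simp
  then have "unit_index n a \<noteq> 0" by (metis mult_0 less_irrefl)
  then show ?thesis unfolding unit_index_mult_ord[OF assms, symmetric] by (rule nonzero_mult_div_cancel_left)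
qed

theorem theorem3p5:
  fixes p1 p h k e e1 d f q1 q :: nat
    and H :: "nat set"
    and g1 :: "'a::{field,finite}" and g :: "'b::{field,finite}"
    and D :: "'a set" and D' :: "'b set"
  assumes "prime p1" "odd p1" "prime p" "odd p" "p \<noteq> p1" "gcd p1 (p - 1) = 1"
    and "\<And>x. x \<ge> 1 \<Longrightarrow> unit_index p1 p = unit_index (p1 ^ x) p"
    and "\<And>x. x \<ge> 1 \<Longrightarrow> unit_index (2 * p1) p = unit_index (2 * p1 ^ x) p"
    and "h = 2 * p1" "e = unit_index h p"
    and "e1 \<ge> 1" "k = 2 * p1 ^ e1" "unit_index k p = e"
    and "d = totient h div e" "f = totient k div e"
    and "q1 = p ^ d" "q = p ^ f"
    and "CARD('a) = q1" "CARD('b) = q"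
    and "primitive_element g1" "primitive_element g" "compatible_elements g1 g"
    and "H \<subseteq> {0..<h}"
    and "(\<Sum>i\<in>H. exp (2 * of_real pi * \<i> / of_nat p1) ^ i) = (0 :: complex)"
    and "D = (\<Union>i\<in>H. cyclotomic_class h g1 i)"
    and "D' = (\<Union>i1\<in>{0..<p1 ^ (e1 - 1)}. \<Union>i\<in>H. cyclotomic_class k g (2 * i1 + i * k div h))"
  shows "(skew_hadamard_difference_set D \<longrightarrow> skew_hadamard_difference_set D') \<and>
         (paley_type_pds D \<longrightarrow> paley_type_pds D')"
proof -
  have p1: "p1 > 1" using assms(1) prime_gt_1_nat by blast
  have cop: "coprime p p1" using assms(1,3,5) by (simp add: primes_coprime)
  have ord_d: "d = ord p1 p"
    using totient_div_unit_index[of h p] cop assms(2,4,9,10,14) p1 ord_double[of p1 p] by simp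
  have opp: "ord (p1 ^ x) p = d * p1 ^ (x - 1)" if "x \<ge> 1" for x
    unfolding ord_d using ord_prime_power[OF assms(1) cop assms(7)[OF that] that] .
  have "p1 ^ e1 > 0" using p1 by simp
  then have k1: "k > 1" unfolding assms(12) by linarith
  have "coprime p k" using cop assms(4) by (simp add: assms(12))
  then have "f = ord k p" using totient_div_unit_index[OF k1, of p] assms(13,15) by simp
  also have "\<dots> = ord (p1 ^ e1) p" unfolding assms(12) using assms(2,4) by (intro ord_double) auto
  finally have f: "f = d * p1 ^ (e1 - 1)" using opp[OF assms(11)] by simp
  from assms(22) obtain emb :: "'a \<Rightarrow> 'b" where emb:
    "\<And>x y. emb (x + y) = emb x + emb y" "\<And>x y. emb (x * y) = emb x * emb y" "emb 1 = 1"
    "emb g1 = g ^ ((CARD('b) - 1) div (CARD('a) - 1))"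
    unfolding compatible_elements_def by blast
  define s where "s = p1 ^ (e1 - 1)"
  have cA: "CARD('a) = p ^ d" using assms(16,18) by (simp only:)
  have cB: "CARD('b) = p ^ (d * s)" using assms(17,19) f by (simp only: s_def)
  have cop1: "coprime p1 (p - 1)" using assms(6) by (simp only: coprime_iff_gcd_eq_1)
  interpret field_tower p p1 d e1 s h k emb g1 g
    by unfold_locales (fact assms(1-5,9,11,12,20,21) emb cA cB cop1 opp s_def)+
  have "zeta p1 (int i) = exp (2 * of_real pi * \<i> / of_nat p1) ^ i" for i
  proof -
    have "zeta p1 1 = exp (2 * of_real pi * \<i> / of_nat p1)" by (simp add: zeta_def cis_conv_exp mult_ac)
    then show ?thesis using zeta_power[of p1 1 i] by simp
  qed
  then have H0: "(\<Sum>i\<in>H. zeta p1 (int i)) = 0" using assms(24) by simp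
  \<comment> \<open>\<open>i * k div h\<close> reads as \<open>(i * k) div h\<close>, and the
    division is exact.\<close>
  have "i * k div h = i * s" for i using pos by (simp add: k_eq)
  then have D': "D' = lift_set H" unfolding assms(26) lift_set_def[OF assms(23) H0] by (simp add: s_def)
  have D: "D = base_set H" unfolding assms(25) base_set_def[OF assms(23) H0] ..
  show ?thesis unfolding D D' using skew_transfer[OF assms(23) H0] paley_transfer[OF assms(23) H0] by blast
qed

end
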